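(* Let $0\le\mu<d$ be integers and let $\Delta$ be a rectilinear partition, with disjoint truncated $l$-edges, of a domain $\Psi\subset\mathbb{R}^2$. Let $A_1,\dots,A_V$ be the interior vertices of $\Delta$, let $E$ be the number of interior edges, and suppose that for every $i=1,\dots,V$ the number $N_i$ of distinct edge directions at $A_i$ satisfies $N_i\ge\mu+3$. Then $$\dim S_d^{\mu}(\Delta)=\mathrm{Low}(S_d^{\mu}(\Delta)),$$ where $$\mathrm{Low}(S_d^{\mu}(\Delta))=\binom{d+2}{2}+\binom{d-\mu+1}{2}E-\left[\binom{d+2}{2}-\binom{\mu+2}{2}\right]V+\sum_{i=1}^V\sigma_i,\qquad \sigma_i=\sum_{j=1}^{d-\mu}\bigl(\mu+1+j(1-N_i)\bigr)_+,$$ and $u_+=\max\{0,u\}$.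
   Context: A rectilinear partition $\Delta$ of a domain $\Psi\subset\mathbb{R}^2$ is a partition of $\Psi$ into polygonal cells formed by a finite set of straight line segments (for example triangulations, quadrangulations, quasi-cross-cut partitions; cells need not be triangles). Cells, edges and vertices are defined in the usual way: an edge is a segment between two adjacent vertices. A vertex is interior if it lies in the interior of $\Psi$; an edge is interior if it is not contained in $\partial\Psi$. An interior $l$-edge is a maximal straight segment (one that cannot be extended further) composed of collinear interior edges. It is a truncated $l$-edge if neither endpoint lies on $\partial\Psi$. $\Delta$ is a partition with disjoint truncated $l$-edges if its truncated $l$-edges are pairwise disjoint (no two have a common point). The number $N_i$ of distinct edge directions at an interior vertex $A_i$ is the number of distinct lines containing the edges incident to $A_i$ (two opposite collinear edges count once). $\mathbb{P}_d$ is the space of real bivariate polynomials of total degree at most $d$, and $S_d^\mu(\Delta)=\{f\in C^\mu(\Psi): f|_\psi\in\mathbb{P}_d\text{ for every cell }\psi\}$. The quantity $\mathrm{Low}(S_d^\mu(\Delta))$ is called the formal lower bound (it is Schumaker's lower bound when $\Delta$ is a triangulation).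
   Formalization: The domain Ψ is additionally assumed simply connected; without this the formula fails, e.g. for a square annulus cut along its diagonals into four trapezoids with μ=0, d=1, where Low=7 but dim=5. *)

theory Defs
  imports "HOL-Analysis.Analysis" "HOL-Library.Function_Algebras"
begin

(* Real-valued functions as a real vector space; provides fun_space.dim. *)
global_interpretation fun_space:
  vector_space "\<lambda>(c::real) (f::'a \<Rightarrow> real) x. c * f x"
  by unfold_locales (auto simp: fun_eq_iff algebra_simps)

(* The domain \<Psi> is an open connected set, so its boundary is frontier \<Psi>.
   A partition is given by the finite set \<Delta> of its edges, which are closed
   segments; edges lying on the boundary belong to \<Delta>. *)

definition vertices :: "(real \<times> real) set set \<Rightarrow> (real \<times> real) set" where
  "vertices \<Delta> = {a. \<exists>b. a \<noteq> b \<and> closed_segment a b \<in> \<Delta>}"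

(* The condition on open_segment says that an edge joins two adjacent vertices, i.e. has
   no vertex in its relative interior; the last conjunct says that the boundary is made up of
   edges. The cells are then polygonal, since they are bounded open sets whose frontiers
   lie in a finite union of segments. *)
definition rectilinear_partition ::
    "(real \<times> real) set \<Rightarrow> (real \<times> real) set set \<Rightarrow> bool" where
  "rectilinear_partition \<Psi> \<Delta> \<longleftrightarrow>
     open \<Psi> \<and> connected \<Psi> \<and> \<Psi> \<noteq> {} \<and> bounded \<Psi> \<and>
     finite \<Delta> \<and>
     (\<forall>e\<in>\<Delta>. \<exists>a b. a \<noteq> b \<and> e = closed_segment a b \<and> open_segment a b \<inter> vertices \<Delta> = {}) \<and>
     (\<forall>e\<in>\<Delta>. \<forall>e'\<in>\<Delta>. e \<noteq> e' \<longrightarrow> e \<inter> e' \<subseteq> vertices \<Delta>) \<and>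
     (\<forall>e\<in>\<Delta>. e \<subseteq> closure \<Psi>) \<and>
     frontier \<Psi> = \<Union>{e\<in>\<Delta>. e \<subseteq> frontier \<Psi>}"

definition cells :: "(real \<times> real) set \<Rightarrow> (real \<times> real) set set \<Rightarrow> (real \<times> real) set set" where
  "cells \<Psi> \<Delta> = components (\<Psi> - \<Union>\<Delta>)"

definition interior_vertices ::
    "(real \<times> real) set \<Rightarrow> (real \<times> real) set set \<Rightarrow> (real \<times> real) set" where
  "interior_vertices \<Psi> \<Delta> = vertices \<Delta> \<inter> interior \<Psi>"

definition interior_edges ::
    "(real \<times> real) set \<Rightarrow> (real \<times> real) set set \<Rightarrow> (real \<times> real) set set" where
  "interior_edges \<Psi> \<Delta> = {e\<in>\<Delta>. \<not> e \<subseteq> frontier \<Psi>}"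

(* A segment that is a union of interior edges; these are then automatically collinear. *)
definition edge_chain ::
    "(real \<times> real) set \<Rightarrow> (real \<times> real) set set \<Rightarrow> (real \<times> real) set \<Rightarrow> bool" where
  "edge_chain \<Psi> \<Delta> L \<longleftrightarrow>
     (\<exists>p q. p \<noteq> q \<and> L = closed_segment p q) \<and> (\<exists>F \<subseteq> interior_edges \<Psi> \<Delta>. L = \<Union>F)"

definition interior_l_edges ::
    "(real \<times> real) set \<Rightarrow> (real \<times> real) set set \<Rightarrow> (real \<times> real) set set" where
  "interior_l_edges \<Psi> \<Delta> =
     {L. edge_chain \<Psi> \<Delta> L \<and> (\<forall>L'. edge_chain \<Psi> \<Delta> L' \<and> L \<subseteq> L' \<longrightarrow> L' = L)}"

definition truncated_l_edges ::
    "(real \<times> real) set \<Rightarrow> (real \<times> real) set set \<Rightarrow> (real \<times> real) set set" where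
  "truncated_l_edges \<Psi> \<Delta> =
     {L \<in> interior_l_edges \<Psi> \<Delta>.
        \<exists>p q. L = closed_segment p q \<and> p \<notin> frontier \<Psi> \<and> q \<notin> frontier \<Psi>}"

definition disjoint_truncated_l_edges ::
    "(real \<times> real) set \<Rightarrow> (real \<times> real) set set \<Rightarrow> bool" where
  "disjoint_truncated_l_edges \<Psi> \<Delta> \<longleftrightarrow> pairwise disjnt (truncated_l_edges \<Psi> \<Delta>)"

definition num_directions :: "(real \<times> real) set set \<Rightarrow> real \<times> real \<Rightarrow> nat" where
  "num_directions \<Delta> A = card {affine hull e | e. e \<in> \<Delta> \<and> A \<in> e}"

definition bivariate_polys :: "nat \<Rightarrow> (real \<times> real \<Rightarrow> real) set" where
  "bivariate_polys d =
     {p. \<exists>c :: nat \<Rightarrow> nat \<Rightarrow> real. \<forall>x y. p (x, y) = (\<Sum>i\<le>d. \<Sum>j\<le>d - i. c i j * x ^ i * y ^ j)}"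

(* k-fold continuous differentiability on an open set *)
fun C_on :: "nat \<Rightarrow> (real \<times> real) set \<Rightarrow> (real \<times> real \<Rightarrow> real) \<Rightarrow> bool" where
  "C_on 0 S f \<longleftrightarrow> continuous_on S f"
| "C_on (Suc k) S f \<longleftrightarrow>
     (\<exists>f'. (\<forall>x\<in>S. (f has_derivative f' x) (at x)) \<and> (\<forall>v. C_on k S (\<lambda>x. f' x v)))"

(* Functions on \<Psi> are represented by their extension by 0 to the plane, so that the
   dimension is that of a space of functions on \<Psi>. *)
definition spline_space ::
    "nat \<Rightarrow> nat \<Rightarrow> (real \<times> real) set \<Rightarrow> (real \<times> real) set set \<Rightarrow> (real \<times> real \<Rightarrow> real) set" where
  "spline_space d \<mu> \<Psi> \<Delta> =
     {f. (\<forall>x. x \<notin> \<Psi> \<longrightarrow> f x = 0) \<and> C_on \<mu> \<Psi> f \<and>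
         (\<forall>\<psi>\<in>cells \<Psi> \<Delta>. \<exists>p\<in>bivariate_polys d. \<forall>x\<in>\<psi>. f x = p x)}"

definition sigma :: "nat \<Rightarrow> nat \<Rightarrow> nat \<Rightarrow> int" where
  "sigma d \<mu> N = (\<Sum>j=1..d - \<mu>. max 0 (int \<mu> + 1 + int j * (1 - int N)))"

definition Low :: "nat \<Rightarrow> nat \<Rightarrow> (real \<times> real) set \<Rightarrow> (real \<times> real) set set \<Rightarrow> int" where
  "Low d \<mu> \<Psi> \<Delta> =
     int ((d + 2) choose 2)
     + int ((d - \<mu> + 1) choose 2) * int (card (interior_edges \<Psi> \<Delta>))
     - (int ((d + 2) choose 2) - int ((\<mu> + 2) choose 2)) * int (card (interior_vertices \<Psi> \<Delta>))
     + (\<Sum>A\<in>interior_vertices \<Psi> \<Delta>. sigma d \<mu> (num_directions \<Delta> A))"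

end

theory Submission
  imports Defs
begin

text \<open>Smoothing cofactors. Across an interior edge \<open>e\<close> on the line \<open>l = 0\<close> a spline jumps by a
  polynomial \<open>l ^ (\<mu> + 1) * q\<close>, and around an interior vertex the signed jumps sum to zero.
  On a simply connected domain these vertex conditions are also sufficient: the function
  \<open>x \<mapsto> Im (Ln ((x - a) / (x - b))) / (2 * pi)\<close> jumps by one across the segment from \<open>a\<close> to \<open>b\<close>, and
  in the sum of these functions weighted by the cofactors the logarithms at interior vertices
  cancel, while those at the other vertices have global branches on the domain. So the
  dimension is that of the polynomials of degree at most \<open>d\<close> plus that of the kernel of the map from
  cofactors to vertex conditions. All conditions at \<open>A\<close> lie in the space of polynomials of degree
  at most \<open>d\<close> vanishing to order \<open>\<mu> + 1\<close> at \<open>A\<close>. This space is attained independently at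
  each vertex: a cofactor can be pushed from \<open>A\<close> along an \<open>l\<close>-edge to the boundary without
  affecting any other vertex; disjointness of the truncated \<open>l\<close>-edges leaves at least
  \<open>\<mu> + 2\<close> directions at \<open>A\<close> in which this works, and the \<open>(\<mu> + 1)\<close>-st powers of \<open>\<mu> + 2\<close>
  pairwise non-proportional linear forms span all forms of degree \<open>\<mu> + 1\<close>. As
  \<open>N\<^sub>i \<ge> \<mu> + 3\<close>, all \<open>\<sigma>\<^sub>i\<close> vanish.\<close>

section \<open>Subspaces of function spaces\<close>

abbreviation (input) smul :: "real \<Rightarrow> ('a \<Rightarrow> real) \<Rightarrow> 'a \<Rightarrow> real" where
  "smul c f \<equiv> (\<lambda>x. c * f x)"

definition has_dim :: "('a \<Rightarrow> real) set \<Rightarrow> nat \<Rightarrow> bool" where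
  "has_dim V n \<longleftrightarrow> (\<exists>B. finite B \<and> fun_space.independent B \<and> fun_space.span B = V \<and> card B = n)"

lemma has_dim_subspace: "has_dim V n \<Longrightarrow> fun_space.subspace V"
  unfolding has_dim_def using fun_space.subspace_span by blast

lemma has_dim_dim: "has_dim V n \<Longrightarrow> fun_space.dim V = n"
  unfolding has_dim_def using fun_space.dim_span_eq_card_independent by blast

lemma has_dim_unique: "has_dim V m \<Longrightarrow> has_dim V n \<Longrightarrow> m = n"
  using has_dim_dim by blast

lemma subspace_imp_has_dim:
  assumes "fun_space.subspace U" "U \<subseteq> V" "has_dim V n"
  shows "\<exists>m\<le>n. has_dim U m"
proof -
  obtain B where B: "finite B" "fun_space.span B = V" "card B = n"
    using assms(3) unfolding has_dim_def by blast
  obtain C where C: "C \<subseteq> U" "fun_space.independent C" "U \<subseteq> fun_space.span C"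
    using fun_space.maximal_independent_subset by blast
  have "finite C \<and> card C \<le> card B"
    using fun_space.independent_span_bound[OF B(1) C(2)] C(1) assms(2) B(2) by blast
  moreover have "fun_space.span C = U"
    using C assms(1) by (simp add: fun_space.span_minimal subset_antisym)
  ultimately show ?thesis unfolding has_dim_def using B C by blast
qed

lemma subspace_eq_if_same_dim:
  assumes "fun_space.subspace U" "U \<subseteq> V" "has_dim V n" "has_dim U n"
  shows "U = V"
proof (rule ccontr)
  assume "U \<noteq> V"
  then obtain v where v: "v \<in> V" "v \<notin> U" using assms(2) by blast
  obtain B where B: "finite B" "fun_space.span B = V" "card B = n"
    using assms(3) unfolding has_dim_def by blast
  obtain C where C: "finite C" "fun_space.independent C" "fun_space.span C = U" "card C = n"
    using assms(4) unfolding has_dim_def by blast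
  have ind: "fun_space.independent (insert v C)"
    using fun_space.independent_insertI C v by blast
  have "C \<subseteq> V" using C(3) assms(2) fun_space.span_superset[of C] by blast
  then have "card (insert v C) \<le> card B"
    using fun_space.independent_span_bound[OF B(1) ind] v B(2) by blast
  moreover have "v \<notin> C" using v C(3) fun_space.span_superset[of C] by blast
  ultimately show False using B C by simp
qed

lemma has_dim_zero: "has_dim {0} 0"
  unfolding has_dim_def
  by (rule exI[of _ "{}"]) (simp add: fun_space.independent_empty)

lemma rank_nullity_on:
  fixes T :: "('a \<Rightarrow> real) \<Rightarrow> ('b \<Rightarrow> real)"
  assumes V: "fun_space.subspace V"
    and add: "\<And>f g. f \<in> V \<Longrightarrow> g \<in> V \<Longrightarrow> T (f + g) = T f + T g"
    and scale: "\<And>c f. f \<in> V \<Longrightarrow> T (smul c f) = smul c (T f)"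
    and K: "has_dim {f \<in> V. T f = 0} m" and R: "has_dim (T ` V) n"
  shows "has_dim V (m + n)"
proof -
  obtain B where B: "finite B" "fun_space.independent B" "fun_space.span B = {f \<in> V. T f = 0}" "card B = m"
    using K unfolding has_dim_def by blast
  obtain C where C: "finite C" "fun_space.independent C" "fun_space.span C = T ` V" "card C = n"
    using R unfolding has_dim_def by blast
  have "C \<subseteq> T ` V" using C(3) fun_space.span_superset[of C] by simp
  then have "\<forall>c\<in>C. \<exists>f\<in>V. T f = c" by blast
  then obtain g where g: "\<And>c. c \<in> C \<Longrightarrow> g c \<in> V" "\<And>c. c \<in> C \<Longrightarrow> T (g c) = c" by metis
  have Bsub: "B \<subseteq> {f \<in> V. T f = 0}" using B(3) fun_space.span_superset[of B] by blast
  have T0: "T 0 = 0"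
    using scale[OF fun_space.subspace_0[OF V], of 0] by (simp add: zero_fun_def)
  have Tsum: "(\<Sum>i\<in>I. smul (r i) (h i)) \<in> V \<and> T (\<Sum>i\<in>I. smul (r i) (h i)) = (\<Sum>i\<in>I. smul (r i) (T (h i)))"
    if "finite I" "\<And>i. i \<in> I \<Longrightarrow> h i \<in> V" for I :: "'c set" and r h
    using that
  proof (induction I rule: finite_induct)
    case empty then show ?case unfolding sum.empty using T0 fun_space.subspace_0[OF V] by blast
  next
    case (insert i I)
    have 1: "smul (r i) (h i) \<in> V" using insert fun_space.subspace_scale[OF V] by auto
    have 2: "(\<Sum>j\<in>I. smul (r j) (h j)) \<in> V" "T (\<Sum>j\<in>I. smul (r j) (h j)) = (\<Sum>j\<in>I. smul (r j) (T (h j)))"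
      using insert by auto
    show ?case unfolding sum.insert[OF insert(1,2)]
      using fun_space.subspace_add[OF V 1 2(1)] add[OF 1 2(1)] 2(2) scale[of "h i" "r i"] insert(4)[OF insertI1]
      by (metis (no_types, lifting))
  qed
  have ginj: "inj_on g C" using g by (metis inj_onI)
  have C0: "0 \<notin> C" using C(2) fun_space.dependent_zero by blast
  have disj: "B \<inter> g ` C = {}" using Bsub g C0 by force
  let ?A = "B \<union> g ` C"
  have fin: "finite ?A" using B C by simp
  have card: "card ?A = m + n"
    using card_Un_disjoint[of B "g ` C"] disj B C card_image[OF ginj] by simp
  have AV: "?A \<subseteq> V" using Bsub g by blast
  have ind: "fun_space.independent ?A"
  proof
    assume "fun_space.dependent ?A"
    then obtain u where u: "\<exists>v\<in>?A. u v \<noteq> 0" "(\<Sum>v\<in>?A. smul (u v) v) = 0"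
      unfolding fun_space.dependent_finite[OF fin] by blast
    have "(\<Sum>v\<in>?A. smul (u v) v) = (\<Sum>v\<in>B. smul (u v) v) + (\<Sum>v\<in>g ` C. smul (u v) v)"
      by (rule sum.union_disjoint[OF B(1) finite_imageI[OF C(1)] disj])
    moreover have "(\<Sum>v\<in>g ` C. smul (u v) v) = (\<Sum>c\<in>C. smul (u (g c)) (g c))"
      by (rule sum.reindex[OF ginj, of "\<lambda>v. smul (u v) v", unfolded comp_def])
    ultimately have split: "(\<Sum>v\<in>?A. smul (u v) v) = (\<Sum>v\<in>B. smul (u v) v) + (\<Sum>c\<in>C. smul (u (g c)) (g c))"
      by (rule trans[OF _ arg_cong[of _ _ "plus _"]])
    have 1: "T (\<Sum>v\<in>B. smul (u v) v) = 0" "(\<Sum>v\<in>B. smul (u v) v) \<in> V"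
      using Tsum[OF B(1), of id u] Bsub by (auto intro!: sum.neutral simp: subset_iff zero_fun_def)
    have 2: "T (\<Sum>c\<in>C. smul (u (g c)) (g c)) = (\<Sum>c\<in>C. smul (u (g c)) c)" "(\<Sum>c\<in>C. smul (u (g c)) (g c)) \<in> V"
      using Tsum[OF C(1), of g "\<lambda>c. u (g c)"] g by auto
    have sum0: "(\<Sum>v\<in>B. smul (u v) v) + (\<Sum>c\<in>C. smul (u (g c)) (g c)) = 0"
      by (rule trans[OF split[symmetric] u(2)])
    have "(\<Sum>c\<in>C. smul (u (g c)) c) = 0"
      using add[OF 1(2) 2(2)] unfolding sum0 T0 1(1) 2(1) add_0 by (rule sym)
    then have uC: "\<forall>c\<in>C. u (g c) = 0"
      using fun_space.independentD[OF C(2) C(1) subset_refl, of "\<lambda>c. u (g c)"] by blast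
    then have Csum: "(\<Sum>c\<in>C. smul (u (g c)) (g c)) = 0"
      by (intro sum.neutral) (simp add: fun_eq_iff)
    have "(\<Sum>v\<in>B. smul (u v) v) = 0" using sum0 unfolding Csum add_0_right .
    then have "\<forall>b\<in>B. u b = 0"
      using fun_space.independentD[OF B(2) B(1) subset_refl, of u] by blast
    then show False using uC u(1) by blast
  qed
  have "V \<subseteq> fun_space.span ?A"
  proof
    fix f assume f: "f \<in> V"
    then have "T f \<in> fun_space.span C" using C(3) by blast
    then obtain u where u: "T f = (\<Sum>c\<in>C. smul (u c) c)" unfolding fun_space.span_finite[OF C(1)] by blast
    let ?h = "\<Sum>c\<in>C. smul (u c) (g c)"
    have h: "?h \<in> V" "T ?h = T f" using Tsum[OF C(1), of g u] g u by auto
    have nh: "- ?h \<in> V" using fun_space.subspace_neg[OF V h(1)] .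
    have "T (- ?h) = - T ?h" using scale[OF h(1), of "-1"] by (simp add: fun_Compl_def)
    then have "T (f - ?h) = 0" using add[OF f nh] h by simp
    moreover have "f - ?h \<in> V" using fun_space.subspace_diff[OF V f h(1)] .
    ultimately have "f - ?h \<in> fun_space.span B" using B(3) by blast
    then have 1: "f - ?h \<in> fun_space.span ?A" using fun_space.span_mono[of B ?A] by blast
    have 2: "?h \<in> fun_space.span ?A"
      by (intro fun_space.span_sum fun_space.span_scale fun_space.span_base) auto
    show "f \<in> fun_space.span ?A" using fun_space.span_add[OF 1 2] by simp
  qed
  then have "fun_space.span ?A = V" using fun_space.span_minimal[OF AV V] by blast
  then show ?thesis unfolding has_dim_def using fin ind card by blast
qed

lemma subspace_image_on:
  assumes V: "fun_space.subspace V"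
    and add: "\<And>f g. f \<in> V \<Longrightarrow> g \<in> V \<Longrightarrow> T (f + g) = T f + T g"
    and scale: "\<And>c f. f \<in> V \<Longrightarrow> T (smul c f) = smul c (T f)"
  shows "fun_space.subspace (T ` V)"
proof (rule fun_space.subspaceI)
  have "T 0 = 0" using scale[OF fun_space.subspace_0[OF V], of 0] by (simp add: zero_fun_def)
  then show "0 \<in> T ` V" using fun_space.subspace_0[OF V] by force
next
  fix x y assume "x \<in> T ` V" "y \<in> T ` V"
  then show "x + y \<in> T ` V" using add fun_space.subspace_add[OF V] by (metis (no_types, lifting) image_iff)
next
  fix c x assume "x \<in> T ` V"
  then obtain f where "f \<in> V" "x = T f" by blast
  then show "smul c x \<in> T ` V" using scale[of f c] fun_space.subspace_scale[OF V, of f c] by (metis image_eqI)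
qed

lemma has_dim_linear_image:
  assumes V: "has_dim V n"
    and add: "\<And>f g. f \<in> V \<Longrightarrow> g \<in> V \<Longrightarrow> T (f + g) = T f + T g"
    and scale: "\<And>c f. f \<in> V \<Longrightarrow> T (smul c f) = smul c (T f)"
    and inj: "\<And>f. f \<in> V \<Longrightarrow> T f = 0 \<Longrightarrow> f = 0"
  shows "has_dim (T ` V) n"
proof -
  note sV = has_dim_subspace[OF V]
  have T0: "T 0 = 0" using scale[OF fun_space.subspace_0[OF sV], of 0] by (simp add: zero_fun_def)
  have ker: "{f \<in> V. T f = 0} = {0}" using inj fun_space.subspace_0[OF sV] T0 by auto
  obtain B where B: "finite B" "fun_space.span B = V" using V unfolding has_dim_def by blast
  have "T ` V \<subseteq> fun_space.span (T ` B)"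
  proof safe
    fix f assume "f \<in> V"
    then have "f \<in> fun_space.span B" using B by simp
    then have "f \<in> V \<and> T f \<in> fun_space.span (T ` B)"
    proof (induction rule: fun_space.span_induct_alt)
      case base then show ?case unfolding T0 using fun_space.subspace_0[OF sV] fun_space.span_zero by blast
    next
      case (step c x y)
      then have x: "x \<in> V" using B(2) fun_space.span_base by blast
      have cx: "smul c x \<in> V" using fun_space.subspace_scale[OF sV x] .
      have "T (smul c x + y) = smul c (T x) + T y" using add[OF cx] step scale[OF x] by simp
      moreover have "smul c (T x) + T y \<in> fun_space.span (T ` B)"
        using step by (intro fun_space.span_add fun_space.span_scale) (auto intro: fun_space.span_base)
      ultimately show ?case using step cx fun_space.subspace_add[OF sV cx, of y] by metis
    qed
    then show "T f \<in> fun_space.span (T ` B)" by simp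
  qed
  moreover obtain C where C: "C \<subseteq> T ` V" "fun_space.independent C" "T ` V \<subseteq> fun_space.span C"
    using fun_space.maximal_independent_subset by blast
  ultimately have "finite C"
    using fun_space.independent_span_bound[of "T ` B" C] B by blast
  moreover have "fun_space.span C = T ` V"
    using C fun_space.span_minimal[OF C(1) subspace_image_on[OF sV add scale]] by blast
  ultimately have "has_dim (T ` V) (card C)" unfolding has_dim_def using C by blast
  from rank_nullity_on[OF sV add scale _ this, of 0] ker has_dim_zero
  have "has_dim V (card C)" by simp
  then show ?thesis using has_dim_unique V \<open>has_dim (T ` V) (card C)\<close> by blast
qed

definition fam_space :: "'i set \<Rightarrow> ('i \<Rightarrow> ('x \<Rightarrow> real) set) \<Rightarrow> ('i \<times> 'x \<Rightarrow> real) set" where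
  "fam_space I U = {h. (\<forall>i\<in>I. (\<lambda>x. h (i, x)) \<in> U i) \<and> (\<forall>i x. i \<notin> I \<longrightarrow> h (i, x) = 0)}"

lemma subspace_fam_space:
  assumes "\<And>i. i \<in> I \<Longrightarrow> fun_space.subspace (U i)"
  shows "fun_space.subspace (fam_space I U)"
proof (rule fun_space.subspaceI)
  show "0 \<in> fam_space I U" unfolding fam_space_def
    using fun_space.subspace_0[OF assms] by (simp add: zero_fun_def)
  show "x + y \<in> fam_space I U" if "x \<in> fam_space I U" "y \<in> fam_space I U" for x y
    using that fun_space.subspace_add[OF assms] unfolding fam_space_def by (simp add: plus_fun_def)
  show "smul c x \<in> fam_space I U" if "x \<in> fam_space I U" for x c
    using that fun_space.subspace_scale[OF assms] unfolding fam_space_def by simp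
qed

lemma has_dim_fam_space:
  assumes "finite I" "\<And>i. i \<in> I \<Longrightarrow> has_dim (U i) (n i)"
  shows "has_dim (fam_space I U) (\<Sum>i\<in>I. n i)"
  using assms
proof (induction I rule: finite_induct)
  case empty
  have "fam_space {} U = {0}" unfolding fam_space_def by (auto simp: zero_fun_def fun_eq_iff)
  then show ?case using has_dim_zero by simp
next
  case (insert k I)
  let ?V = "fam_space (insert k I) U"
  let ?T = "\<lambda>h x. h (k, x)"
  have sub: "\<And>i. i \<in> insert k I \<Longrightarrow> fun_space.subspace (U i)" using insert has_dim_subspace by blast
  have ker: "{h \<in> ?V. ?T h = 0} = fam_space I U"
    unfolding fam_space_def using insert(2) fun_space.subspace_0[OF sub]
    by (auto simp: zero_fun_def fun_eq_iff) metis+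
  have im: "?T ` ?V = U k"
  proof
    show "?T ` ?V \<subseteq> U k" unfolding fam_space_def by auto
    show "U k \<subseteq> ?T ` ?V"
    proof
      fix f assume f: "f \<in> U k"
      have "(\<lambda>x. if i = k then f x else 0) \<in> U i" if "i \<in> insert k I" for i
        using f fun_space.subspace_0[OF sub[OF that]] that by (cases "i = k") (auto simp: zero_fun_def)
      then have "(\<lambda>(i, x). if i = k then f x else 0) \<in> ?V" unfolding fam_space_def using f by auto
      then show "f \<in> ?T ` ?V" by (rule rev_image_eqI) simp
    qed
  qed
  have "has_dim ?V ((\<Sum>i\<in>I. n i) + n k)"
  proof (rule rank_nullity_on[where T = ?T])
    show "fun_space.subspace ?V" using sub by (rule subspace_fam_space)
  qed (use insert ker im in \<open>auto simp: plus_fun_def\<close>)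
  then show ?case using insert by (simp add: add.commute)
qed

section \<open>Bivariate polynomials\<close>

definition mono2 :: "nat \<times> nat \<Rightarrow> real \<times> real \<Rightarrow> real" where
  "mono2 k z = fst z ^ fst k * snd z ^ snd k"

lemma sum_fun_apply: "(sum f A) x = (\<Sum>a\<in>A. f a x)"
  by (induction A rule: infinite_finite_induct) auto

lemma polyfun_zero_near:
  fixes c :: "nat \<Rightarrow> real"
  assumes "\<epsilon> > 0" "\<And>s. \<bar>s\<bar> < \<epsilon> \<Longrightarrow> (\<Sum>i\<le>n. c i * s ^ i) = 0" "i \<le> n"
  shows "c i = 0"
proof (rule ccontr)
  assume "c i \<noteq> 0"
  then have "finite {s. (\<Sum>i\<le>n. c i * s ^ i) = 0}" using polyfun_finite_roots assms(3) by blast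
  moreover have "{-\<epsilon><..<\<epsilon>} \<subseteq> {s. (\<Sum>i\<le>n. c i * s ^ i) = 0}" using assms(2) by auto
  ultimately have "finite {-\<epsilon><..<\<epsilon>}" by (rule rev_finite_subset)
  then show False using assms(1) by (simp add: infinite_Ioo)
qed

lemma mono2_scalars_zero:
  assumes fin: "finite I" and 0: "\<And>z. (\<Sum>k\<in>I. u k * mono2 k z) = 0" and k: "k \<in> I"
  shows "u k = 0"
proof -
  obtain N where N: "\<And>i j. (i, j) \<in> I \<Longrightarrow> i \<le> N \<and> j \<le> N"
  proof -
    have "i \<le> Max (fst ` I) + Max (snd ` I) \<and> j \<le> Max (fst ` I) + Max (snd ` I)" if "(i, j) \<in> I" for i j
    proof -
      have "i \<in> fst ` I" "j \<in> snd ` I" using that by force+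
      then have "i \<le> Max (fst ` I)" "j \<le> Max (snd ` I)" using fin by auto
      then show ?thesis by simp
    qed
    then show ?thesis using that by blast
  qed
  define c where "c i j = (if (i, j) \<in> I then u (i, j) else 0)" for i j
  have "(\<Sum>i\<le>N. (\<Sum>j\<le>N. c i j * y ^ j) * x ^ i) = 0" for x y
  proof -
    have "(\<Sum>i\<le>N. (\<Sum>j\<le>N. c i j * y ^ j) * x ^ i) = (\<Sum>k\<in>{..N} \<times> {..N}. c (fst k) (snd k) * mono2 k (x, y))"
      by (simp add: sum.cartesian_product sum_distrib_right mono2_def case_prod_unfold mult.assoc)
        (intro sum.cong refl; simp add: mult_ac)
    also have "\<dots> = (\<Sum>k\<in>I. c (fst k) (snd k) * mono2 k (x, y))"
      by (rule sum.mono_neutral_right) (use N c_def in auto)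
    also have "\<dots> = (\<Sum>k\<in>I. u k * mono2 k (x, y))" by (rule sum.cong) (auto simp: c_def)
    finally show ?thesis using 0 by simp
  qed
  then have "\<And>y i. i \<le> N \<Longrightarrow> (\<Sum>j\<le>N. c i j * y ^ j) = 0"
    using polyfun_eq_0[where n = N and c = "\<lambda>i. \<Sum>j\<le>N. c i j * _ ^ j"] by blast
  then have "\<And>i j. i \<le> N \<Longrightarrow> j \<le> N \<Longrightarrow> c i j = 0"
    using polyfun_eq_0[where n = N and c = "\<lambda>j. c _ j"] by blast
  then show ?thesis using k N[of "fst k" "snd k"] by (metis c_def prod.collapse)
qed

lemma inj_mono2: "inj mono2"
proof (rule injI, rule ccontr)
  fix k l assume e: "mono2 k = mono2 l" and n: "k \<noteq> l"
  have "(\<Sum>m\<in>{k, l}. (if m = k then 1 else - 1) * mono2 m z) = 0" for z using n e by auto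
  from mono2_scalars_zero[OF _ this, of k] show False by simp
qed

lemma has_dim_span_mono2:
  assumes "finite I"
  shows "has_dim (fun_space.span (mono2 ` I)) (card I)"
proof -
  have inj: "inj_on mono2 I" using inj_mono2 inj_on_subset by blast
  have "fun_space.independent (mono2 ` I)"
  proof (rule fun_space.independent_if_scalars_zero)
    fix f x assume s: "(\<Sum>x\<in>mono2 ` I. smul (f x) x) = 0" and "x \<in> mono2 ` I"
    then obtain k where k: "x = mono2 k" "k \<in> I" by blast
    have "f (mono2 k) = 0"
    proof (rule mono2_scalars_zero[OF assms _ k(2), of "\<lambda>k. f (mono2 k)"])
      fix z
      have "(\<Sum>x\<in>mono2 ` I. smul (f x) x) z = 0" using s by simp
      then show "(\<Sum>k\<in>I. f (mono2 k) * mono2 k z) = 0"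
        by (simp add: sum_fun_apply sum.reindex[OF inj])
    qed
    then show "f x = 0" using k by simp
  qed (use assms in simp)
  then show ?thesis unfolding has_dim_def using assms card_image[OF inj] by blast
qed

abbreviation (input) deg_idx :: "nat \<Rightarrow> nat \<Rightarrow> (nat \<times> nat) set" where
  "deg_idx m d \<equiv> {(i, j). m \<le> i + j \<and> i + j \<le> d}"

lemma finite_deg_idx: "finite (deg_idx m d)"
  by (rule finite_subset[of _ "{..d} \<times> {..d}"]) auto

lemma card_deg_idx: "m \<le> d + 1 \<Longrightarrow> card (deg_idx m d) + (m + 1 choose 2) = (d + 2 choose 2)"
proof (induction d rule: nat_induct)
  have *: "card {(i, j). i + j = d} = d + 1" for d :: nat
  proof -
    have "{(i, j). i + j = d} = (\<lambda>i. (i, d - i)) ` {..d}" by force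
    moreover have "inj_on (\<lambda>i. (i, d - i)) {..d}" by (auto intro: inj_onI)
    ultimately show ?thesis by (simp add: card_image)
  qed
  {
    case 0
    then consider "m = 0" | "m = 1" by linarith
    then show ?case
    proof cases
      case 1
      have "deg_idx 0 0 = {(0, 0)}" by auto
      then show ?thesis using 1 by (simp add: numeral_2_eq_2)
    next
      case 2
      then have "deg_idx m 0 = {}" by auto
      then have "card (deg_idx m 0) = 0" by (metis card.empty)
      then show ?thesis using 2 by (simp add: numeral_2_eq_2)
    qed
  next
    case (Suc d)
    show ?case
    proof (cases "m = d + 2")
      case True
      then have "deg_idx m (Suc d) = {}" by auto
      then have "card (deg_idx m (Suc d)) = 0" by (metis card.empty)
      then show ?thesis using True by simp
    next
      case False
      then have m: "m \<le> d + 1" using Suc by simp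
      then have eq: "deg_idx m (Suc d) = deg_idx m d \<union> {(i, j). i + j = Suc d}" by auto
      have fin: "finite {(i, j). i + j = Suc d}"
        by (rule finite_subset[of _ "{..Suc d} \<times> {..Suc d}"]) auto
      have "card (deg_idx m (Suc d)) = card (deg_idx m d) + (d + 2)"
        unfolding eq using *[of "Suc d"] by (subst card_Un_disjoint) (use finite_deg_idx fin in auto)
      then show ?thesis using Suc.IH[OF m] by (simp add: numeral_2_eq_2)
    qed
  }
qed

lemma bivariate_polys_eq_span: "bivariate_polys d = fun_space.span (mono2 ` deg_idx 0 d)"
proof
  show "bivariate_polys d \<subseteq> fun_space.span (mono2 ` deg_idx 0 d)"
  proof
    fix p assume "p \<in> bivariate_polys d"
    then obtain c where c: "\<And>x y. p (x, y) = (\<Sum>i\<le>d. \<Sum>j\<le>d - i. c i j * x ^ i * y ^ j)"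
      unfolding bivariate_polys_def by blast
    have "p = (\<Sum>i\<le>d. \<Sum>j\<le>d - i. smul (c i j) (mono2 (i, j)))"
      by (auto simp: fun_eq_iff sum_fun_apply c mono2_def mult_ac)
    also have "\<dots> \<in> fun_space.span (mono2 ` deg_idx 0 d)"
      by (intro fun_space.span_sum fun_space.span_scale fun_space.span_base) auto
    finally show "p \<in> fun_space.span (mono2 ` deg_idx 0 d)" .
  qed
  have sub: "fun_space.subspace (bivariate_polys d)"
  proof (rule fun_space.subspaceI)
    show "0 \<in> bivariate_polys d" unfolding bivariate_polys_def
      by (auto intro!: exI[of _ "\<lambda>_ _. 0"])
    fix p q assume "p \<in> bivariate_polys d" "q \<in> bivariate_polys d"
    then obtain c e where "\<And>x y. p (x, y) = (\<Sum>i\<le>d. \<Sum>j\<le>d - i. c i j * x ^ i * y ^ j)"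
      "\<And>x y. q (x, y) = (\<Sum>i\<le>d. \<Sum>j\<le>d - i. e i j * x ^ i * y ^ j)"
      unfolding bivariate_polys_def by blast
    then show "p + q \<in> bivariate_polys d" unfolding bivariate_polys_def
      by (auto intro!: exI[of _ "\<lambda>i j. c i j + e i j"] simp: sum.distrib ring_distribs)
  next
    fix r p assume "p \<in> bivariate_polys d"
    then obtain c where "\<And>x y. p (x, y) = (\<Sum>i\<le>d. \<Sum>j\<le>d - i. c i j * x ^ i * y ^ j)"
      unfolding bivariate_polys_def by blast
    then show "smul r p \<in> bivariate_polys d" unfolding bivariate_polys_def
      by (auto intro!: exI[of _ "\<lambda>i j. r * c i j"] simp: sum_distrib_left mult_ac)
  qed
  have "mono2 k \<in> bivariate_polys d" if kd: "k \<in> deg_idx 0 d" for k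
  proof -
    obtain a b where k: "k = (a, b)" "a + b \<le> d" using kd by (cases k) auto
    have "mono2 k (x, y) = (\<Sum>i\<le>d. \<Sum>j\<le>d - i. (if i = a \<and> j = b then 1 else 0) * x ^ i * y ^ j)" for x y
    proof -
      have ab: "a \<in> {..d}" "b \<in> {..d - a}" using k by auto
      have "(\<Sum>i\<le>d. \<Sum>j\<le>d - i. (if i = a \<and> j = b then 1 else 0) * x ^ i * y ^ j)
        = (\<Sum>i\<le>d. if i = a then (\<Sum>j\<le>d - i. if j = b then x ^ i * y ^ j else 0) else 0)"
      proof (rule sum.cong[OF refl])
        show "(\<Sum>j\<le>d - i. (if i = a \<and> j = b then 1 else 0) * x ^ i * y ^ j)
          = (if i = a then (\<Sum>j\<le>d - i. if j = b then x ^ i * y ^ j else 0) else 0)" for i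
          by (cases "i = a") (simp_all only: simp_thms if_True if_False mult_zero_left sum.neutral_const,
              rule sum.cong[OF refl], simp)
      qed
      also have "\<dots> = (\<Sum>j\<le>d - a. if j = b then x ^ a * y ^ j else 0)"
        using ab by (simp only: sum.delta finite_atMost if_True)
      also have "\<dots> = x ^ a * y ^ b" using ab by (simp only: sum.delta finite_atMost if_True)
      finally show ?thesis using k by (simp add: mono2_def)
    qed
    then show ?thesis unfolding bivariate_polys_def
      by (auto intro!: exI[of _ "\<lambda>i j. if i = a \<and> j = b then 1 else 0"])
  qed
  then show "fun_space.span (mono2 ` deg_idx 0 d) \<subseteq> bivariate_polys d"
    using fun_space.span_minimal[OF _ sub] by blast
qed

lemma subspace_bivariate_polys: "fun_space.subspace (bivariate_polys d)"
  unfolding bivariate_polys_eq_span by (rule fun_space.subspace_span)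

lemma has_dim_bivariate_polys: "has_dim (bivariate_polys d) (d + 2 choose 2)"
proof -
  have "card (deg_idx 0 d) = (d + 2 choose 2)" using card_deg_idx[of 0 d] by (simp add: numeral_2_eq_2)
  then show ?thesis
    using has_dim_span_mono2[OF finite_deg_idx, of 0 d] unfolding bivariate_polys_eq_span by metis
qed

lemma bivariate_polys_mono: "d \<le> e \<Longrightarrow> bivariate_polys d \<subseteq> bivariate_polys e"
  unfolding bivariate_polys_eq_span by (intro fun_space.span_mono image_mono) auto

lemma mono2_in_bivariate_polys: "fst k + snd k \<le> d \<Longrightarrow> mono2 k \<in> bivariate_polys d"
  unfolding bivariate_polys_eq_span by (rule fun_space.span_base) (auto intro!: imageI)

lemma const_in_bivariate_polys: "(\<lambda>z. c) \<in> bivariate_polys d"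
proof -
  have "(\<lambda>z. c) = smul c (mono2 (0, 0))" by (simp add: mono2_def fun_eq_iff)
  then show ?thesis
    using fun_space.subspace_scale[OF subspace_bivariate_polys mono2_in_bivariate_polys[of "(0, 0)" d]] by simp
qed

lemma affine_in_bivariate_polys: "(\<lambda>z. a * fst z + b * snd z + c) \<in> bivariate_polys 1"
proof -
  have "(\<lambda>z. a * fst z + b * snd z + c) = smul a (mono2 (1, 0)) + smul b (mono2 (0, 1)) + (\<lambda>z. c)"
    by (simp add: mono2_def fun_eq_iff)
  also have "\<dots> \<in> bivariate_polys 1"
    by (intro fun_space.subspace_add[OF subspace_bivariate_polys] fun_space.subspace_scale[OF subspace_bivariate_polys]
        mono2_in_bivariate_polys const_in_bivariate_polys) auto
  finally show ?thesis .
qed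

lemma span_mono2_mult:
  assumes "p \<in> fun_space.span (mono2 ` deg_idx m a)" "q \<in> fun_space.span (mono2 ` deg_idx n b)"
  shows "(\<lambda>z. p z * q z) \<in> fun_space.span (mono2 ` deg_idx (m + n) (a + b))"
proof -
  note S = fun_space.subspace_span[of "mono2 ` deg_idx (m + n) (a + b)"]
  have mono2_mult: "(\<lambda>z. mono2 k z * q z) \<in> fun_space.span (mono2 ` deg_idx (m + n) (a + b))"
    if k: "k \<in> deg_idx m a" for k
    using assms(2)
  proof (induction rule: fun_space.span_induct_alt)
    case base
    show ?case using fun_space.subspace_0[OF S] by (simp add: zero_fun_def)
  next
    case (step c x y)
    then obtain l where l: "x = mono2 l" "l \<in> deg_idx n b" by blast
    have "(\<lambda>z. mono2 k z * (smul c x + y) z) = smul c (mono2 (fst k + fst l, snd k + snd l)) + (\<lambda>z. mono2 k z * y z)"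
      by (auto simp: fun_eq_iff l mono2_def power_add algebra_simps)
    also have "\<dots> \<in> fun_space.span (mono2 ` deg_idx (m + n) (a + b))"
    proof (intro fun_space.subspace_add[OF S] fun_space.subspace_scale[OF S])
      show "mono2 (fst k + fst l, snd k + snd l) \<in> fun_space.span (mono2 ` deg_idx (m + n) (a + b))"
        using k l by (intro fun_space.span_base imageI) (auto simp: case_prod_unfold)
    qed (rule step)
    finally show ?case .
  qed
  show ?thesis
    using assms(1)
  proof (induction rule: fun_space.span_induct_alt)
    case base
    show ?case using fun_space.subspace_0[OF S] by (simp add: zero_fun_def)
  next
    case (step c x y)
    then obtain k where k: "x = mono2 k" "k \<in> deg_idx m a" by blast
    have "(\<lambda>z. (smul c x + y) z * q z) = smul c (\<lambda>z. mono2 k z * q z) + (\<lambda>z. y z * q z)"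
      by (auto simp: fun_eq_iff k algebra_simps)
    also have "\<dots> \<in> fun_space.span (mono2 ` deg_idx (m + n) (a + b))"
      by (intro fun_space.subspace_add[OF S] fun_space.subspace_scale[OF S] mono2_mult k step)
    finally show ?case .
  qed
qed

lemma bivariate_polys_mult:
  assumes "p \<in> bivariate_polys a" "q \<in> bivariate_polys b"
  shows "(\<lambda>z. p z * q z) \<in> bivariate_polys (a + b)"
  using span_mono2_mult[of p 0 a q 0 b] assms by (simp add: bivariate_polys_eq_span)

lemma bivariate_polys_power:
  assumes "p \<in> bivariate_polys 1"
  shows "(\<lambda>z. p z ^ n) \<in> bivariate_polys n"
proof (induction n)
  case 0 then show ?case using const_in_bivariate_polys[of 1] by simp
next
  case (Suc n) then show ?case using bivariate_polys_mult[OF assms Suc] by simp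
qed

lemma bivariate_polys_compose:
  assumes p: "p \<in> bivariate_polys d" and "\<alpha> \<in> bivariate_polys 1" "\<beta> \<in> bivariate_polys 1"
  shows "(\<lambda>z. p (\<alpha> z, \<beta> z)) \<in> bivariate_polys d"
proof -
  note S = subspace_bivariate_polys[of d]
  show ?thesis
    using p[unfolded bivariate_polys_eq_span]
  proof (induction rule: fun_space.span_induct_alt)
    case base
    show ?case using fun_space.subspace_0[OF S] by (simp add: zero_fun_def)
  next
    case (step c x y)
    then obtain k where k: "x = mono2 k" "fst k + snd k \<le> d" by auto
    have "(\<lambda>z. (smul c x + y) (\<alpha> z, \<beta> z)) = smul c (\<lambda>z. \<alpha> z ^ fst k * \<beta> z ^ snd k) + (\<lambda>z. y (\<alpha> z, \<beta> z))"
      by (auto simp: fun_eq_iff k mono2_def)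
    also have "\<dots> \<in> bivariate_polys d"
    proof (intro fun_space.subspace_add[OF S] fun_space.subspace_scale[OF S])
      show "(\<lambda>z. \<alpha> z ^ fst k * \<beta> z ^ snd k) \<in> bivariate_polys d"
        using bivariate_polys_mult[OF bivariate_polys_power[OF assms(2)] bivariate_polys_power[OF assms(3)]]
          bivariate_polys_mono[OF k(2)] by blast
    qed (use step in auto)
    finally show ?case .
  qed
qed

lemma mono2_rpf: "real_polynomial_function (mono2 k)"
  unfolding mono2_def
  by (intro real_polynomial_function.intros(4) real_polynomial_function_power real_polynomial_function.intros(1)
      bounded_linear_fst bounded_linear_snd)

lemma bivariate_polys_rpf:
  assumes "p \<in> bivariate_polys d" shows "real_polynomial_function p"
  using assms[unfolded bivariate_polys_eq_span]
proof (induction rule: fun_space.span_induct_alt)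
  case base
  show ?case using real_polynomial_function.intros(2)[of 0] by (simp add: zero_fun_def)
next
  case (step c x y)
  then show ?case unfolding plus_fun_def using mono2_rpf
    by (intro real_polynomial_function.intros(2-4)) auto
qed

lemma rpf_zero_on_ball:
  fixes p :: "'a::real_normed_vector \<Rightarrow> real"
  assumes p: "real_polynomial_function p" and r: "r > 0" and 0: "\<And>x. x \<in> ball c r \<Longrightarrow> p x = 0"
  shows "p y = 0"
proof -
  have "polynomial_function (\<lambda>s. c + s *\<^sub>R (y - c))"
    by (intro polynomial_function_add polynomial_function_const polynomial_function_bounded_linear bounded_linear_scaleR_left)
  then have "real_polynomial_function (p \<circ> (\<lambda>s. c + s *\<^sub>R (y - c)))"
    using p by (rule real_polynomial_function_compose)
  then obtain a n where an: "\<And>s. p (c + s *\<^sub>R (y - c)) = (\<Sum>i\<le>n. a i * s ^ i)"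
    unfolding real_polynomial_function_iff_sum by (auto simp: fun_eq_iff)
  define \<epsilon> where "\<epsilon> = r / (norm (y - c) + 1)"
  have e: "\<epsilon> > 0" using r by (simp add: \<epsilon>_def add_nonneg_pos)
  have "a i = 0" if "i \<le> n" for i
  proof (rule polyfun_zero_near[OF e _ that])
    fix s :: real assume s: "\<bar>s\<bar> < \<epsilon>"
    have "\<bar>s\<bar> * norm (y - c) \<le> \<bar>s\<bar> * (norm (y - c) + 1)" by (intro mult_left_mono) auto
    also have "\<dots> < r" using s by (simp add: \<epsilon>_def pos_less_divide_eq add_nonneg_pos)
    finally have "c + s *\<^sub>R (y - c) \<in> ball c r" by (simp add: dist_norm)
    then show "(\<Sum>i\<le>n. a i * s ^ i) = 0" using 0 an by metis
  qed
  then have "p (c + 1 *\<^sub>R (y - c)) = 0" unfolding an by simp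
  then show ?thesis by simp
qed

lemma rpf_zero_on_open:
  fixes p :: "'a::real_normed_vector \<Rightarrow> real"
  assumes "real_polynomial_function p" "open S" "S \<noteq> {}" "\<And>x. x \<in> S \<Longrightarrow> p x = 0"
  shows "p = 0"
proof -
  obtain c r where "r > 0" "ball c r \<subseteq> S" using assms(2,3) by (meson all_not_in_conv openE)
  then have "p y = 0" for y using rpf_zero_on_ball[OF assms(1), of r c y] assms(4) by blast
  then show ?thesis by (simp add: fun_eq_iff)
qed

lemma rpf_has_derivative:
  fixes p :: "'a::real_normed_vector \<Rightarrow> real"
  assumes "real_polynomial_function p"
  shows "\<exists>p'. (\<forall>x. (p has_derivative p' x) (at x)) \<and> (\<forall>v. real_polynomial_function (\<lambda>x. p' x v))"
  using assms
proof (induction rule: real_polynomial_function.induct)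
  case (linear f)
  then show ?case
    by (intro exI[of _ "\<lambda>x. f"]) (auto simp: bounded_linear_imp_has_derivative)
next
  case (const c)
  then show ?case by (intro exI[of _ "\<lambda>x v. 0"]) auto
next
  case (add f g)
  then obtain f' g' where "\<forall>x. (f has_derivative f' x) (at x)" "\<forall>v. real_polynomial_function (\<lambda>x. f' x v)"
    "\<forall>x. (g has_derivative g' x) (at x)" "\<forall>v. real_polynomial_function (\<lambda>x. g' x v)" by blast
  then show ?case
    by (intro exI[of _ "\<lambda>x v. f' x v + g' x v"]) (auto intro!: derivative_eq_intros)
next
  case (mult f g)
  then obtain f' g' where "\<forall>x. (f has_derivative f' x) (at x)" "\<forall>v. real_polynomial_function (\<lambda>x. f' x v)"
    "\<forall>x. (g has_derivative g' x) (at x)" "\<forall>v. real_polynomial_function (\<lambda>x. g' x v)" by blast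
  then have "\<forall>x. ((\<lambda>x. f x * g x) has_derivative (\<lambda>v. f x * g' x v + f' x v * g x)) (at x)"
    "\<forall>v. real_polynomial_function (\<lambda>x. f x * g' x v + f' x v * g x)"
    using mult.hyps by (auto intro!: has_derivative_mult real_polynomial_function.intros(3,4))
  then show ?case by (intro exI[of _ "\<lambda>x v. f x * g' x v + f' x v * g x"]) simp
qed

definition pd :: "'a \<Rightarrow> ('a::real_normed_vector \<Rightarrow> real) \<Rightarrow> 'a \<Rightarrow> real" where
  "pd v p = (\<lambda>x. frechet_derivative p (at x) v)"

lemma pd_eqI: "(\<And>x. (p has_derivative p' x) (at x)) \<Longrightarrow> pd v p = (\<lambda>x. p' x v)"
  unfolding pd_def using frechet_derivative_at by metis

lemma has_derivative_pd:
  assumes "real_polynomial_function p"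
  shows "(p has_derivative (\<lambda>v. pd v p x)) (at x)"
proof -
  obtain p' where p': "\<And>x. (p has_derivative p' x) (at x)" using rpf_has_derivative[OF assms] by blast
  then have "(\<lambda>v. pd v p x) = p' x" using pd_eqI[OF p'] by (simp add: fun_eq_iff)
  then show ?thesis using p' by simp
qed

lemma pd_rpf:
  assumes "real_polynomial_function p"
  shows "real_polynomial_function (pd v p)"
proof -
  obtain p' where p': "\<And>x. (p has_derivative p' x) (at x)" "real_polynomial_function (\<lambda>x. p' x v)"
    using rpf_has_derivative[OF assms] by blast
  then show ?thesis using pd_eqI[OF p'(1), of v] by simp
qed

lemma pd_diff:
  assumes "real_polynomial_function p" "real_polynomial_function q"
  shows "pd v (\<lambda>x. p x - q x) = (\<lambda>x. pd v p x - pd v q x)"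
  by (rule pd_eqI[where p' = "\<lambda>x v. pd v p x - pd v q x"])
    (use assms in \<open>auto intro!: derivative_eq_intros has_derivative_pd\<close>)

lemma pd_mult:
  assumes "real_polynomial_function p" "real_polynomial_function q"
  shows "pd v (\<lambda>x. p x * q x) = (\<lambda>x. p x * pd v q x + pd v p x * q x)"
  by (rule pd_eqI[where p' = "\<lambda>x v. p x * pd v q x + pd v p x * q x"])
    (use assms in \<open>auto intro!: derivative_eq_intros has_derivative_pd\<close>)

lemma pd_power:
  assumes "real_polynomial_function p"
  shows "pd v (\<lambda>x. p x ^ n) = (\<lambda>x. real n * p x ^ (n - 1) * pd v p x)"
  by (rule pd_eqI[where p' = "\<lambda>x v. real n * p x ^ (n - 1) * pd v p x"])
    (use assms in \<open>auto intro!: derivative_eq_intros has_derivative_pd simp: mult_ac\<close>)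

lemma pd_sum:
  assumes "\<And>k. k \<in> K \<Longrightarrow> real_polynomial_function (h k)"
  shows "pd v (\<lambda>x. \<Sum>k\<in>K. a k * h k x) = (\<lambda>x. \<Sum>k\<in>K. a k * pd v (h k) x)"
  by (rule pd_eqI[where p' = "\<lambda>x v. \<Sum>k\<in>K. a k * pd v (h k) x"])
    (use assms in \<open>auto intro!: has_derivative_sum has_derivative_mult_right has_derivative_pd\<close>)

fun flat :: "nat \<Rightarrow> ('a::real_normed_vector \<Rightarrow> real) \<Rightarrow> 'a \<Rightarrow> bool" where
  "flat 0 p x \<longleftrightarrow> p x = 0"
| "flat (Suc k) p x \<longleftrightarrow> p x = 0 \<and> (\<forall>v. flat k (pd v p) x)"

lemma flat_zero: "flat k p x \<Longrightarrow> p x = 0"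
  by (cases k) auto

lemma flat_power_mult:
  assumes l: "real_polynomial_function l" "l x = 0" and q: "real_polynomial_function q"
  shows "flat k (\<lambda>z. l z ^ Suc k * q z) x"
  using q
proof (induction k arbitrary: q)
  case 0 then show ?case using l by simp
next
  case (Suc k)
  have "flat k (pd v (\<lambda>z. l z ^ Suc (Suc k) * q z)) x" for v
  proof -
    have "pd v (\<lambda>z. l z ^ Suc (Suc k) * q z)
      = (\<lambda>z. l z ^ Suc (Suc k) * pd v q z + real (Suc (Suc k)) * l z ^ Suc k * pd v l z * q z)"
      unfolding pd_mult[OF real_polynomial_function_power[OF l(1)] Suc.prems] pd_power[OF l(1)] by simp
    also have "\<dots> = (\<lambda>z. l z ^ Suc k * (l z * pd v q z + real (Suc (Suc k)) * pd v l z * q z))"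
      by (auto simp: fun_eq_iff algebra_simps)
    finally show ?thesis
      using Suc.IH[of "\<lambda>z. l z * pd v q z + real (Suc (Suc k)) * pd v l z * q z"] l Suc.prems
      by (simp add: real_polynomial_function.intros(2-4) pd_rpf)
  qed
  then show ?case using l by simp
qed

text \<open>Flatness passes to limits in the coefficients, although the polynomial itself is fixed.\<close>

lemma flat_limit:
  fixes h :: "'k \<Rightarrow> 'a::real_normed_vector \<Rightarrow> real"
  assumes "finite K" "\<And>k. k \<in> K \<Longrightarrow> real_polynomial_function (h k)"
    and "\<And>n. p = (\<lambda>z. \<Sum>k\<in>K. a n k * h k z)"
    and "\<And>k. k \<in> K \<Longrightarrow> flat m (h k) x \<or> (\<lambda>n::nat. a n k) \<longlonglongrightarrow> 0"
  shows "flat m p x"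
proof -
  have val: "(\<Sum>k\<in>K. a 0 k * g k x) = 0"
    if c: "\<And>n. (\<Sum>k\<in>K. a n k * g k x) = (\<Sum>k\<in>K. a 0 k * g k x)"
      and g: "\<And>k. k \<in> K \<Longrightarrow> g k x = 0 \<or> (\<lambda>n. a n k) \<longlonglongrightarrow> 0" for g :: "'k \<Rightarrow> 'a \<Rightarrow> real"
  proof -
    have "(\<lambda>n. \<Sum>k\<in>K. a n k * g k x) \<longlonglongrightarrow> (\<Sum>k\<in>K. 0)"
    proof (rule tendsto_sum)
      fix k assume "k \<in> K"
      then show "(\<lambda>n. a n k * g k x) \<longlonglongrightarrow> 0"
        using g[of k] tendsto_mult_left_zero[of "\<lambda>n. a n k" sequentially "g k x"] by auto
    qed
    moreover have "(\<lambda>n. \<Sum>k\<in>K. a n k * g k x) = (\<lambda>n. \<Sum>k\<in>K. a 0 k * g k x)"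
      by (rule ext) (rule c)
    ultimately have "(\<lambda>n::nat. \<Sum>k\<in>K. a 0 k * g k x) \<longlonglongrightarrow> 0" by simp
    then show ?thesis using LIMSEQ_unique tendsto_const by blast
  qed
  show ?thesis using assms(2-)
  proof (induction m arbitrary: p h)
    case 0
    have "(\<Sum>k\<in>K. a n k * h k x) = (\<Sum>k\<in>K. a 0 k * h k x)" for n
      using 0(2)[of n] 0(2)[of 0] by (metis (no_types, lifting))
    then show ?case using val[of h] 0(2)[of 0] 0(3) by (simp del: sum.cong)
  next
    case (Suc m)
    have "(\<Sum>k\<in>K. a n k * h k x) = (\<Sum>k\<in>K. a 0 k * h k x)" for n
      using Suc.prems(2)[of n] Suc.prems(2)[of 0] by (metis (no_types, lifting))
    then have "p x = 0" using val[of h] Suc.prems(2)[of 0] Suc.prems(3) flat_zero by fastforce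
    moreover have "flat m (pd v p) x" for v
    proof (rule Suc.IH[of "\<lambda>k. pd v (h k)"])
      show "pd v p = (\<lambda>z. \<Sum>k\<in>K. a n k * pd v (h k) z)" for n
        using pd_sum[OF Suc.prems(1), where K = K and v = v and a = "a n"] Suc.prems(2)[of n] by simp
      show "real_polynomial_function (pd v (h k))" if "k \<in> K" for k
        using pd_rpf[OF Suc.prems(1)[OF that]] .
    qed (use Suc.prems(3) in auto)
    ultimately show ?case by simp
  qed
qed

section \<open>Flatness, divisibility by powers of lines and powers of linear forms\<close>

text \<open>\<open>lf a b x\<close> is the imaginary part of \<open>(x - a) * cnj (x - b)\<close>, in which the quadratic terms
  cancel; so its sign is that of the angle at \<open>x\<close> subtended by the segment from \<open>b\<close> to \<open>a\<close>.\<close>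

definition lf :: "real \<times> real \<Rightarrow> real \<times> real \<Rightarrow> real \<times> real \<Rightarrow> real" where
  "lf a b x = (snd b - snd a) * fst x - (fst b - fst a) * snd x + (snd a * fst b - fst a * snd b)"

lemma lf_in_bivariate_polys: "lf a b \<in> bivariate_polys 1"
proof -
  have "lf a b = (\<lambda>z. (snd b - snd a) * fst z + (fst a - fst b) * snd z + (snd a * fst b - fst a * snd b))"
    by (auto simp: fun_eq_iff lf_def algebra_simps)
  then show ?thesis using affine_in_bivariate_polys by simp
qed

lemma lf_rpf: "real_polynomial_function (lf a b)"
  using bivariate_polys_rpf lf_in_bivariate_polys by blast

lemma flat_compose:
  assumes g: "real_polynomial_function g" and L: "bounded_linear L"
    and "flat k g (x0 + L w)"
  shows "flat k (\<lambda>w. g (x0 + L w)) w"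
  using g assms(3)
proof (induction k arbitrary: g)
  case (Suc k)
  have "pd v (\<lambda>w. g (x0 + L w)) = (\<lambda>w. pd (L v) g (x0 + L w))" for v
  proof (rule pd_eqI[where p' = "\<lambda>w v. pd (L v) g (x0 + L w)"])
    fix x
    have 1: "((\<lambda>w. x0 + L w) has_derivative L) (at x)"
      by (auto intro!: derivative_eq_intros bounded_linear_imp_has_derivative[OF L])
    show "((\<lambda>w. g (x0 + L w)) has_derivative (\<lambda>v. pd (L v) g (x0 + L x))) (at x)"
      using diff_chain_at[OF 1 has_derivative_pd[OF Suc.prems(1)]] by (simp add: comp_def)
  qed
  then show ?case using Suc.IH[OF pd_rpf[OF Suc.prems(1)]] Suc.prems by simp
qed simp

lemma flat_coeffs_zero:
  fixes G :: "real \<times> real \<Rightarrow> real"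
  assumes "real_polynomial_function G"
    and "\<And>s t. G (s, t) = (\<Sum>i\<le>m. \<Sum>j<n. C i j * s ^ i * t ^ j)"
    and e: "\<epsilon> > 0" and "\<And>s. \<bar>s\<bar> < \<epsilon> \<Longrightarrow> flat k G (s, 0)"
    and "i \<le> m" "j < n" "j \<le> k"
  shows "C i j = 0"
  using assms(1,2,4-)
proof (induction k arbitrary: G C n j)
  have base: "C i 0 = 0" if "\<And>s t. G (s, t) = (\<Sum>i\<le>m. \<Sum>j<Suc n. C i j * s ^ i * t ^ j)"
    "\<And>s. \<bar>s\<bar> < \<epsilon> \<Longrightarrow> G (s, 0) = 0" for G C n
  proof (rule polyfun_zero_near[where c = "\<lambda>i. C i 0", OF e _ assms(5)])
    fix s :: real assume "\<bar>s\<bar> < \<epsilon>"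
    then show "(\<Sum>i\<le>m. C i 0 * s ^ i) = 0"
      using that(2)[of s] unfolding that(1) sum.lessThan_Suc_shift by simp
  qed
  {
    case 0
    then obtain n' where n: "n = Suc n'" by (cases n) auto
    show ?case using base[OF 0(2)[unfolded n] flat_zero[OF 0(3)]] 0 by simp
  next
    case (Suc k)
    then obtain n' where n: "n = Suc n'" by (cases n) auto
    show ?case
    proof (cases j)
      case 0
      then show ?thesis using base[OF Suc.prems(2)[unfolded n] flat_zero[OF Suc.prems(3)]] by simp
    next
      case (Suc j')
      have "pd (0, 1) G (s, t) = (\<Sum>i\<le>m. \<Sum>j<n'. (C i (Suc j) * real (Suc j)) * s ^ i * t ^ j)" for s t
      proof -
        have 1: "((\<lambda>t. (s, t)) has_derivative (\<lambda>h. (0, h))) (at t)"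
          by (auto intro!: derivative_eq_intros)
        have "((\<lambda>t. G (s, t)) has_derivative (\<lambda>h. pd (0, h) G (s, t))) (at t)"
          using diff_chain_at[OF 1 has_derivative_pd[OF Suc.prems(1)]] by (simp add: comp_def)
        moreover have "((\<lambda>t. G (s, t)) has_real_derivative (\<Sum>i\<le>m. \<Sum>j<n. C i j * s ^ i * (real j * t ^ (j - 1)))) (at t)"
          unfolding Suc.prems(2)
        proof (intro DERIV_sum)
          show "((\<lambda>t. C i j * s ^ i * t ^ j) has_real_derivative C i j * s ^ i * (real j * t ^ (j - 1))) (at t)" for i j
            using DERIV_cmult[OF DERIV_pow[of j t UNIV], of "C i j * s ^ i"] by (simp add: mult_ac)
        qed
        ultimately have "(\<lambda>h. pd (0, h) G (s, t)) = (*) (\<Sum>i\<le>m. \<Sum>j<n. C i j * s ^ i * (real j * t ^ (j - 1)))"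
          unfolding has_field_derivative_def by (rule has_derivative_unique)
        from fun_cong[OF this, of 1]
        have "pd (0, 1) G (s, t) = (\<Sum>i\<le>m. \<Sum>j<n. C i j * s ^ i * (real j * t ^ (j - 1)))"
          unfolding mult_1_right .
        also have "\<dots> = (\<Sum>i\<le>m. \<Sum>j<n'. C i (Suc j) * real (Suc j) * s ^ i * t ^ j)"
          unfolding n sum.lessThan_Suc_shift
          by (simp only: of_nat_0 mult_zero_left mult_zero_right add_0_left diff_Suc_1 mult_ac)
        finally show ?thesis .
      qed
      from Suc.IH[OF pd_rpf[OF Suc.prems(1)] this, of j'] have "C i (Suc j') * real (Suc j') = 0"
      proof
        show "\<And>s. \<bar>s\<bar> < \<epsilon> \<Longrightarrow> flat k (pd (0, 1) G) (s, 0)" using Suc.prems(3) by simp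
      qed (use Suc.prems(4-6) Suc n in simp_all)
      then show ?thesis using Suc by simp
    qed
  }
qed

lemma subspace_mult_image:
  "fun_space.subspace V \<Longrightarrow> fun_space.subspace ((\<lambda>q z. l z * q z) ` V)"
  by (rule subspace_image_on) (auto simp: fun_eq_iff algebra_simps)

lemma flat_divisible:
  assumes g: "g \<in> bivariate_polys d" and ab: "a \<noteq> b" and x0: "lf a b x0 = 0" and e: "\<epsilon> > 0"
    and flat: "\<And>s. \<bar>s\<bar> < \<epsilon> \<Longrightarrow> flat k g (x0 + s *\<^sub>R (b - a))" and k: "k < d"
  shows "\<exists>q\<in>bivariate_polys (d - Suc k). g = (\<lambda>z. lf a b z ^ Suc k * q z)"
proof -
  define u where "u = b - a"
  define n where "n = (snd u, - fst u)"
  define R where "R = fst u ^ 2 + snd u ^ 2"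
  have "fst u \<noteq> 0 \<or> snd u \<noteq> 0" using ab by (auto simp: u_def prod_eq_iff)
  then have R: "R > 0" unfolding R_def by (auto simp: sum_power2_gt_zero_iff)
  define L where "L w = fst w *\<^sub>R u + snd w *\<^sub>R n" for w :: "real \<times> real"
  have L: "bounded_linear L" unfolding L_def
    by (intro bounded_linear_add bounded_linear_compose[OF bounded_linear_scaleR_left] bounded_linear_fst bounded_linear_snd)
  define G where "G w = g (x0 + L w)" for w
  have G: "G \<in> bivariate_polys d"
  proof -
    have "G = (\<lambda>w. g (fst u * fst w + fst n * snd w + fst x0, snd u * fst w + snd n * snd w + snd x0))"
      by (auto simp: G_def L_def fun_eq_iff algebra_simps intro!: arg_cong[of _ _ g] prod_eqI)
    also have "\<dots> \<in> bivariate_polys d"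
      by (intro bivariate_polys_compose[OF g] affine_in_bivariate_polys)
    finally show ?thesis .
  qed
  define S where "S x = fst u / R * fst x + snd u / R * snd x + (- (fst u * fst x0 + snd u * snd x0) / R)" for x
  define T where "T x = lf a b x / R" for x
  have inv: "x0 + L (S x, T x) = x" for x
  proof -
    have 1: "S x = (fst u * (fst x - fst x0) + snd u * (snd x - snd x0)) / R"
      by (simp add: S_def field_simps add_divide_distrib diff_divide_distrib)
    have 2: "T x = (snd u * (fst x - fst x0) - fst u * (snd x - snd x0)) / R"
      using x0 by (simp add: T_def lf_def u_def algebra_simps)
    have "fst u * S x + snd u * T x = (fst u ^ 2 + snd u ^ 2) * (fst x - fst x0) / R"
      unfolding 1 2 by (simp add: field_simps power2_eq_square add_divide_distrib diff_divide_distrib)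
    then have f: "fst u * S x + snd u * T x = fst x - fst x0" using R unfolding R_def[symmetric] by simp
    have "snd u * S x - fst u * T x = (fst u ^ 2 + snd u ^ 2) * (snd x - snd x0) / R"
      unfolding 1 2 by (simp add: field_simps power2_eq_square add_divide_distrib diff_divide_distrib)
    then have s: "snd u * S x - fst u * T x = snd x - snd x0" using R unfolding R_def[symmetric] by simp
    show ?thesis using f s by (auto simp: L_def n_def prod_eq_iff algebra_simps)
  qed
  obtain c where c: "\<And>x y. G (x, y) = (\<Sum>i\<le>d. \<Sum>j\<le>d - i. c i j * x ^ i * y ^ j)"
    using G unfolding bivariate_polys_def by blast
  define C where "C i j = (if i + j \<le> d then c i j else 0)" for i j
  have C: "G (x, y) = (\<Sum>i\<le>d. \<Sum>j<Suc d. C i j * x ^ i * y ^ j)" for x y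
    unfolding c
  proof (rule sum.cong[OF refl])
    fix i assume "i \<in> {..d}"
    then show "(\<Sum>j\<le>d - i. c i j * x ^ i * y ^ j) = (\<Sum>j<Suc d. C i j * x ^ i * y ^ j)"
      by (intro sum.mono_neutral_cong_left) (auto simp: C_def)
  qed
  have C0: "C i j = 0" if "i \<le> d" "j \<le> k" for i j
  proof (rule flat_coeffs_zero[OF bivariate_polys_rpf[OF G] C e _ that(1) _ that(2)])
    show "flat k G (s, 0)" if "\<bar>s\<bar> < \<epsilon>" for s
      unfolding G_def
      by (rule flat_compose[OF bivariate_polys_rpf[OF g] L]) (use flat[OF that] in \<open>simp add: L_def u_def\<close>)
  qed (use that k in auto)
  let ?U = "(\<lambda>q z. snd z ^ Suc k * q z) ` bivariate_polys (d - Suc k)"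
  have sU: "fun_space.subspace ?U" by (rule subspace_mult_image[OF subspace_bivariate_polys])
  have "G = (\<Sum>i\<le>d. \<Sum>j<Suc d. (\<lambda>z. C i j * mono2 (i, j) z))"
    using C by (auto simp: fun_eq_iff sum_fun_apply mono2_def mult_ac)
  also have "\<dots> \<in> ?U"
  proof (intro fun_space.subspace_sum[OF sU])
    fix i j assume "i \<in> {..d}"
    show "(\<lambda>z. C i j * mono2 (i, j) z) \<in> ?U"
    proof (cases "C i j = 0")
      case True
      then show ?thesis using fun_space.subspace_0[OF sU] by (simp add: zero_fun_def)
    next
      case False
      then have "k < j" using C0[of i j] \<open>i \<in> {..d}\<close> by (meson atMost_iff not_le)
      moreover have "i + j \<le> d" using False by (simp add: C_def split: if_splits)
      ultimately have ij: "i + j \<le> d" "k < j" by auto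
      then have "mono2 (i, j) = (\<lambda>z. snd z ^ Suc k * mono2 (i, j - Suc k) z)"
        by (auto simp: fun_eq_iff mono2_def power_add[symmetric] mult_ac simp del: power_Suc)
      moreover have "mono2 (i, j - Suc k) \<in> bivariate_polys (d - Suc k)"
        using ij by (intro mono2_in_bivariate_polys) auto
      ultimately have "mono2 (i, j) \<in> ?U" by blast
      then show ?thesis by (rule fun_space.subspace_scale[OF sU])
    qed
  qed
  finally obtain Q where Q: "Q \<in> bivariate_polys (d - Suc k)" "G = (\<lambda>z. snd z ^ Suc k * Q z)" by blast
  define q where "q x = (1 / R ^ Suc k) * Q (S x, T x)" for x
  have "g x = lf a b x ^ Suc k * q x" for x
  proof -
    have "g x = G (S x, T x)" by (simp add: G_def inv)
    then show ?thesis using R by (simp add: Q(2) q_def T_def power_divide)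
  qed
  moreover have "q \<in> bivariate_polys (d - Suc k)"
  proof -
    have "S \<in> bivariate_polys 1" unfolding S_def[abs_def] by (rule affine_in_bivariate_polys)
    moreover have "T \<in> bivariate_polys 1"
      using fun_space.subspace_scale[OF subspace_bivariate_polys lf_in_bivariate_polys, of "1 / R" a b]
      by (simp add: T_def[abs_def])
    ultimately show ?thesis unfolding q_def[abs_def]
      by (intro fun_space.subspace_scale[OF subspace_bivariate_polys] bivariate_polys_compose[OF Q(1)])
  qed
  ultimately show ?thesis by (auto simp: fun_eq_iff)
qed

definition line_polys :: "nat \<Rightarrow> nat \<Rightarrow> real \<times> real \<Rightarrow> real \<times> real \<Rightarrow> (real \<times> real \<Rightarrow> real) set" where
  "line_polys m r a b = (\<lambda>q z. lf a b z ^ m * q z) ` bivariate_polys r"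

lemma has_dim_line_polys:
  assumes "a \<noteq> b"
  shows "has_dim (line_polys m r a b) (r + 2 choose 2)"
  unfolding line_polys_def
proof (rule has_dim_linear_image[OF has_dim_bivariate_polys])
  fix q assume q: "q \<in> bivariate_polys r" and 0: "(\<lambda>z. lf a b z ^ m * q z) = 0"
  let ?S = "{z. lf a b z > 0}"
  have "open ?S" unfolding lf_def by (intro open_Collect_less continuous_intros)
  moreover have "?S \<noteq> {}"
  proof -
    let ?z = "a + (snd b - snd a, - (fst b - fst a))"
    have "lf a b ?z = (snd b - snd a)^2 + (fst b - fst a)^2"
      by (simp add: lf_def algebra_simps power2_eq_square)
    also have "\<dots> > 0" using assms by (auto simp: sum_power2_gt_zero_iff prod_eq_iff)
    finally show ?thesis by blast
  qed
  moreover have "q z = 0" if "z \<in> ?S" for z using fun_cong[OF 0, of z] that by simp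
  ultimately show "q = 0" using rpf_zero_on_open[OF bivariate_polys_rpf[OF q]] by blast
qed (auto simp: fun_eq_iff algebra_simps)

lemma line_polys_subset:
  assumes "m \<le> d" shows "line_polys m (d - m) a b \<subseteq> bivariate_polys d"
  using bivariate_polys_mult[OF bivariate_polys_power[OF lf_in_bivariate_polys[of a b], of m], where b = "d - m"] assms
  by (auto simp: line_polys_def)

definition ctr_polys :: "nat \<Rightarrow> nat \<Rightarrow> real \<times> real \<Rightarrow> (real \<times> real \<Rightarrow> real) set" where
  "ctr_polys m d A = (\<lambda>p z. p (z - A)) ` fun_space.span (mono2 ` deg_idx m d)"

lemma has_dim_ctr_polys: "has_dim (ctr_polys m d A) (card (deg_idx m d))"
  unfolding ctr_polys_def
proof (rule has_dim_linear_image[OF has_dim_span_mono2[OF finite_deg_idx]])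
  fix f assume 0: "(\<lambda>z. f (z - A)) = (0 :: real \<times> real \<Rightarrow> real)"
  have "f z = 0" for z using fun_cong[OF 0, of "z + A"] by simp
  then show "f = 0" by (simp add: fun_eq_iff)
qed (auto simp: fun_eq_iff)

lemma bivariate_polys_translate:
  assumes "p \<in> bivariate_polys d" shows "(\<lambda>z. p (z + A)) \<in> bivariate_polys d"
proof -
  have "(\<lambda>z. p (z + A)) = (\<lambda>z. p (1 * fst z + 0 * snd z + fst A, 0 * fst z + 1 * snd z + snd A))"
    by (auto simp: fun_eq_iff intro!: arg_cong[of _ _ p] prod_eqI)
  also have "\<dots> \<in> bivariate_polys d" by (intro bivariate_polys_compose assms affine_in_bivariate_polys)
  finally show ?thesis .
qed

definition dotf :: "real \<times> real \<Rightarrow> real \<times> real \<Rightarrow> real" where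
  "dotf w z = fst w * fst z + snd w * snd z"

lemma dotf_power_in_span: "(\<lambda>z. dotf w z ^ m) \<in> fun_space.span (mono2 ` deg_idx m m)"
proof (induction m)
  case 0
  have "(\<lambda>z. dotf w z ^ 0) = mono2 (0, 0)" by (simp add: fun_eq_iff mono2_def)
  then show ?case using fun_space.span_base[of "mono2 (0, 0)" "mono2 ` deg_idx 0 0"] by auto
next
  case (Suc m)
  have "dotf w = smul (fst w) (mono2 (1, 0)) + smul (snd w) (mono2 (0, 1))"
    by (simp add: fun_eq_iff mono2_def dotf_def)
  also have "\<dots> \<in> fun_space.span (mono2 ` deg_idx 1 1)"
    by (intro fun_space.span_add fun_space.span_scale fun_space.span_base imageI) auto
  finally show ?case using span_mono2_mult[OF _ Suc, of "dotf w" 1 1] by simp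
qed

lemma dotf_powers_independent:
  assumes "finite K" "card K \<le> Suc m"
    and "\<And>v w. v \<in> K \<Longrightarrow> w \<in> K \<Longrightarrow> v \<noteq> w \<Longrightarrow> fst v * snd w - snd v * fst w \<noteq> 0"
    and "\<And>w. w \<in> K \<Longrightarrow> w \<noteq> 0"
    and "\<And>z. (\<Sum>w\<in>K. c w * dotf w z ^ m) = 0" and "w \<in> K"
  shows "c w = 0"
  using assms
proof (induction m arbitrary: K c w)
  case 0
  then have "card K = 1" using card_gt_0_iff[of K] by fastforce
  then have "K = {w}" using 0 by (metis card_1_singletonE singletonD)
  then show ?case using 0(5)[of 0] by simp
next
  case (Suc m)
  have others: "c v = 0" if v: "v \<in> K" "v \<noteq> w" for v
  proof -
    define y where "y = (- snd w, fst w)"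
    have wy: "dotf w y = 0" by (simp add: dotf_def y_def)
    have "c v * dotf v y = 0"
    proof (rule Suc.IH[of "K - {w}" "\<lambda>v. c v * dotf v y"])
      fix z
      have "((\<lambda>t. \<Sum>v\<in>K. c v * dotf v (z + t *\<^sub>R y) ^ Suc m) has_real_derivative
          (\<Sum>v\<in>K. c v * (real (Suc m) * dotf v z ^ m * dotf v y))) (at 0)"
      proof (rule DERIV_sum)
        fix v
        have "((\<lambda>t. dotf v (z + t *\<^sub>R y)) has_real_derivative dotf v y) (at 0)"
          by (auto intro!: derivative_eq_intros simp: dotf_def)
        from DERIV_cmult[OF DERIV_power[OF this, of "Suc m"], of "c v"]
        show "((\<lambda>t. c v * dotf v (z + t *\<^sub>R y) ^ Suc m) has_real_derivative
            c v * (real (Suc m) * dotf v z ^ m * dotf v y)) (at 0)"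
          by (simp add: mult_ac del: of_nat_Suc power_Suc)
      qed
      moreover have "((\<lambda>t. \<Sum>v\<in>K. c v * dotf v (z + t *\<^sub>R y) ^ Suc m) has_real_derivative 0) (at 0)"
        unfolding Suc.prems(5) by (rule DERIV_const)
      ultimately have "(\<Sum>v\<in>K. c v * (real (Suc m) * dotf v z ^ m * dotf v y)) = 0"
        by (rule DERIV_unique)
      then have "real (Suc m) * (\<Sum>v\<in>K. c v * dotf v y * dotf v z ^ m) = 0"
        by (simp add: sum_distrib_left mult_ac del: of_nat_Suc)
      then have "(\<Sum>v\<in>K. c v * dotf v y * dotf v z ^ m) = 0" by (simp del: of_nat_Suc)
      then show "(\<Sum>v\<in>K - {w}. c v * dotf v y * dotf v z ^ m) = 0"
        using sum.remove[OF Suc.prems(1,6), of "\<lambda>v. c v * dotf v y * dotf v z ^ m"] wy by simp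
    next
      have "card (K - {w}) = card K - 1" using Suc.prems(1,6) by simp
      then show "card (K - {w}) \<le> Suc m" using Suc.prems(2) by linarith
    qed (use Suc.prems(1,3,4) v in blast)+
    moreover have "dotf v y \<noteq> 0" using Suc.prems(3)[OF v(1) Suc.prems(6) v(2)] by (simp add: dotf_def y_def algebra_simps)
    ultimately show ?thesis by simp
  qed
  have "c w * dotf w w ^ Suc m = 0"
    using Suc.prems(5)[of w] others sum.remove[OF Suc.prems(1,6), of "\<lambda>v. c v * dotf v w ^ Suc m"]
    by (simp del: power_Suc)
  moreover have "dotf w w \<noteq> 0" using Suc.prems(4)[OF Suc.prems(6)]
    by (auto simp: dotf_def prod_eq_iff sum_squares_eq_zero_iff)
  ultimately show ?case by simp
qed

lemma span_dotf_powers: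
  assumes K: "finite K" "card K = Suc m"
    and cross: "\<And>v w. v \<in> K \<Longrightarrow> w \<in> K \<Longrightarrow> v \<noteq> w \<Longrightarrow> fst v * snd w - snd v * fst w \<noteq> 0"
    and nz: "\<And>w. w \<in> K \<Longrightarrow> w \<noteq> 0"
  shows "fun_space.span ((\<lambda>w z. dotf w z ^ m) ` K) = fun_space.span (mono2 ` deg_idx m m)"
proof (rule subspace_eq_if_same_dim)
  let ?F = "\<lambda>w z. dotf w z ^ m"
  have indep: "c w = 0" if "\<And>z. (\<Sum>w\<in>K. c w * dotf w z ^ m) = 0" "w \<in> K" for c w
    by (rule dotf_powers_independent[OF K(1) eq_refl[OF K(2)] _ _ that]) (erule (2) cross, erule nz)
  have inj: "inj_on ?F K"
  proof (rule inj_onI, rule ccontr)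
    fix v w assume vw: "v \<in> K" "w \<in> K" "?F v = ?F w" "v \<noteq> w"
    define c :: "real \<times> real \<Rightarrow> real" where "c u = (if u = v then 1 else if u = w then -1 else 0)" for u
    have "(\<Sum>u\<in>K. c u * ?F u z) = (\<Sum>u\<in>{v, w}. c u * ?F u z)" for z
      by (rule sum.mono_neutral_right) (use K vw in \<open>auto simp: c_def\<close>)
    moreover have "(\<Sum>u\<in>{v, w}. c u * ?F u z) = 0" for z
      using vw(4) fun_cong[OF vw(3), of z] by (simp add: c_def)
    ultimately have "(\<Sum>u\<in>K. c u * dotf u z ^ m) = 0" for z by simp
    then have "c v = 0" by (rule indep[OF _ vw(1)])
    then show False by (simp add: c_def)
  qed
  have "fun_space.independent (?F ` K)"
  proof (rule fun_space.independent_if_scalars_zero)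
    fix f x assume s: "(\<Sum>x\<in>?F ` K. smul (f x) x) = 0" and "x \<in> ?F ` K"
    then obtain w where w: "x = ?F w" "w \<in> K" by blast
    have "(\<Sum>w\<in>K. f (?F w) * dotf w z ^ m) = 0" for z
    proof -
      have "(\<Sum>x\<in>?F ` K. smul (f x) x) z = 0" using s by simp
      then show ?thesis by (simp add: sum_fun_apply sum.reindex[OF inj])
    qed
    then have "f (?F w) = 0" by (rule indep[where c = "\<lambda>w. f (?F w)", OF _ w(2)])
    then show "f x = 0" using w by simp
  qed (use K in simp)
  then show "has_dim (fun_space.span (?F ` K)) (Suc m)"
    unfolding has_dim_def using K card_image[OF inj]
    by (intro exI[of _ "?F ` K"] conjI) auto
  have "card (deg_idx m m) = Suc m" using card_deg_idx[of m m] by (simp add: numeral_2_eq_2)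
  then show "has_dim (fun_space.span (mono2 ` deg_idx m m)) (Suc m)"
    using has_dim_span_mono2[OF finite_deg_idx, of m m] by simp
  show "fun_space.span (?F ` K) \<subseteq> fun_space.span (mono2 ` deg_idx m m)"
    by (rule fun_space.span_minimal[OF _ fun_space.subspace_span])
      (intro image_subsetI dotf_power_in_span)
qed (rule fun_space.subspace_span)

lemma ctr_polys_subset:
  assumes K: "finite K" "Suc m \<le> card K" and md: "m \<le> d"
    and cross: "\<And>v w. v \<in> K \<Longrightarrow> w \<in> K \<Longrightarrow> v \<noteq> w \<Longrightarrow> fst v * snd w - snd v * fst w \<noteq> 0"
    and nz: "\<And>w. w \<in> K \<Longrightarrow> w \<noteq> 0"
    and U: "fun_space.subspace U"
    and mem: "\<And>w q. w \<in> K \<Longrightarrow> q \<in> bivariate_polys (d - m) \<Longrightarrow> (\<lambda>z. dotf w (z - A) ^ m * q z) \<in> U"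
  shows "ctr_polys m d A \<subseteq> U"
proof -
  obtain K' where K': "K' \<subseteq> K" "card K' = Suc m" "finite K'"
    using K by (meson obtain_subset_with_card_n)
  have span: "fun_space.span ((\<lambda>w z. dotf w z ^ m) ` K') = fun_space.span (mono2 ` deg_idx m m)"
  proof (rule span_dotf_powers[OF K'(3,2)])
    show "fst v * snd w - snd v * fst w \<noteq> 0" if "v \<in> K'" "w \<in> K'" "v \<noteq> w" for v w
      by (rule cross[OF subsetD[OF K'(1) that(1)] subsetD[OF K'(1) that(2)] that(3)])
    show "w \<noteq> 0" if "w \<in> K'" for w by (rule nz[OF subsetD[OF K'(1) that]])
  qed
  have mono: "(\<lambda>z. mono2 k (z - A)) \<in> U" if k: "k \<in> deg_idx m d" for k
  proof -
    obtain i j where ij: "k = (i, j)" "m \<le> i + j" "i + j \<le> d" using k by (cases k) auto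
    define i1 j1 where "i1 = min i m" and "j1 = m - i1"
    have k1: "i1 \<le> i" "j1 \<le> j" "i1 + j1 = m" using ij by (auto simp: i1_def j1_def)
    define Q where "Q z = mono2 (i - i1, j - j1) (z - A)" for z
    have Q: "Q \<in> bivariate_polys (d - m)"
      using bivariate_polys_translate[OF mono2_in_bivariate_polys, of "(i - i1, j - j1)" "d - m" "- A"] ij k1
      by (simp add: Q_def[abs_def])
    have pow: "x ^ i = x ^ i1 * x ^ (i - i1)" "x ^ j = x ^ j1 * x ^ (j - j1)" for x :: real
      using k1 by (simp_all flip: power_add)
    have split: "mono2 k (z - A) = mono2 (i1, j1) (z - A) * Q z" for z
      unfolding ij(1) Q_def mono2_def fst_conv snd_conv pow[of "fst (z - A)"] pow[of "snd (z - A)"]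
      by (simp only: mult_ac)
    have gen: "(\<lambda>z. p (z - A) * Q z) \<in> U" if "p \<in> fun_space.span ((\<lambda>w z. dotf w z ^ m) ` K')" for p
      using that
    proof (induction rule: fun_space.span_induct_alt)
      case base then show ?case using fun_space.subspace_0[OF U] by (simp add: zero_fun_def)
    next
      case (step c x y)
      then obtain w where w: "w \<in> K'" "x = (\<lambda>z. dotf w z ^ m)" by blast
      have "(\<lambda>z. (smul c x + y) (z - A) * Q z) = smul c (\<lambda>z. dotf w (z - A) ^ m * Q z) + (\<lambda>z. y (z - A) * Q z)"
        by (auto simp: fun_eq_iff w algebra_simps)
      also have "\<dots> \<in> U"
        using K' w step by (intro fun_space.subspace_add[OF U] fun_space.subspace_scale[OF U] mem Q) auto
      finally show ?case .
    qed
    have "mono2 (i1, j1) \<in> fun_space.span (mono2 ` deg_idx m m)"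
      using k1 by (intro fun_space.span_base imageI) auto
    then have "(\<lambda>z. mono2 (i1, j1) (z - A) * Q z) \<in> U" by (intro gen) (simp only: span)
    then show ?thesis by (simp only: split)
  qed
  show ?thesis unfolding ctr_polys_def
  proof safe
    fix p assume "p \<in> fun_space.span (mono2 ` deg_idx m d)"
    then show "(\<lambda>z. p (z - A)) \<in> U"
    proof (induction rule: fun_space.span_induct_alt)
      case base then show ?case using fun_space.subspace_0[OF U] by (simp add: zero_fun_def)
    next
      case (step c x y)
      then obtain k where k: "k \<in> deg_idx m d" "x = mono2 k" by blast
      have "(\<lambda>z. (smul c x + y) (z - A)) = smul c (\<lambda>z. mono2 k (z - A)) + (\<lambda>z. y (z - A))"
        by (auto simp: fun_eq_iff k)
      also have "\<dots> \<in> U"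
        using mono k step by (intro fun_space.subspace_add[OF U] fun_space.subspace_scale[OF U]) auto
      finally show ?case .
    qed
  qed
qed

lemma lf_eq_dotf:
  assumes "lf a b A = 0"
  shows "lf a b z = dotf (snd b - snd a, - (fst b - fst a)) (z - A)"
  using assms by (simp add: lf_def dotf_def algebra_simps)

lemma line_polys_subset_ctr:
  assumes "lf a b A = 0" "m \<le> d"
  shows "line_polys m (d - m) a b \<subseteq> ctr_polys m d A"
proof
  fix f assume "f \<in> line_polys m (d - m) a b"
  then obtain q where q: "q \<in> bivariate_polys (d - m)" "f = (\<lambda>z. lf a b z ^ m * q z)"
    unfolding line_polys_def by blast
  let ?w = "(snd b - snd a, - (fst b - fst a))"
  have "(\<lambda>z. dotf ?w z ^ m * q (z + A)) \<in> fun_space.span (mono2 ` deg_idx (m + 0) (m + (d - m)))"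
    using bivariate_polys_translate[OF q(1), of A]
    unfolding bivariate_polys_eq_span by (rule span_mono2_mult[OF dotf_power_in_span])
  then have "(\<lambda>z. dotf ?w z ^ m * q (z + A)) \<in> fun_space.span (mono2 ` deg_idx m d)" using assms(2) by simp
  moreover have "f = (\<lambda>z. dotf ?w (z - A) ^ m * q ((z - A) + A))"
    by (simp add: q lf_eq_dotf[OF assms(1)])
  ultimately show "f \<in> ctr_polys m d A"
    unfolding ctr_polys_def by (intro image_eqI[where x = "\<lambda>z. dotf ?w z ^ m * q (z + A)"])
qed

section \<open>The angle subtended by a segment\<close>

definition cpx :: "real \<times> real \<Rightarrow> complex" where
  "cpx z = Complex (fst z) (snd z)"

definition omega :: "real \<times> real \<Rightarrow> real \<times> real \<Rightarrow> real \<times> real \<Rightarrow> real" where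
  "omega a b x = Im (Ln (cpx (x - a) / cpx (x - b))) / (2 * pi)"

lemma cpx_simps [simp]: "Re (cpx z) = fst z" "Im (cpx z) = snd z"
  by (simp_all add: cpx_def)

lemma cpx_eq_0_iff [simp]: "cpx z = 0 \<longleftrightarrow> z = 0"
  by (simp add: complex_eq_iff prod_eq_iff)

lemma continuous_on_cpx [continuous_intros]:
  "continuous_on S f \<Longrightarrow> continuous_on S (\<lambda>x. cpx (f x))"
  unfolding cpx_def Complex_eq by (intro continuous_intros)

lemma exp_eq_const_imp_constant_on:
  fixes h :: "'a::topological_space \<Rightarrow> complex"
  assumes S: "connected S" and h: "continuous_on S h" and k: "\<And>t. t \<in> S \<Longrightarrow> exp (h t) = k"
  shows "h constant_on S"
proof (rule continuous_discrete_range_constant[OF S h])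
  fix x assume x: "x \<in> S"
  have "2 * pi \<le> norm (h y - h x)" if y: "y \<in> S" "h y \<noteq> h x" for y
  proof -
    have "exp (h y) = exp (h x)" using k[OF x] k[OF y(1)] by simp
    then obtain n :: int where n: "h y = h x + (of_int (2 * n) * pi) * \<i>"
      unfolding exp_eq by blast
    then have "n \<noteq> 0" using y(2) by auto
    then have "1 \<le> \<bar>real_of_int n\<bar>" by linarith
    then have "2 * pi * 1 \<le> 2 * pi * \<bar>real_of_int n\<bar>" by (intro mult_left_mono) auto
    also have "\<dots> = norm (h y - h x)" unfolding n by (simp add: norm_mult)
    finally show ?thesis by simp
  qed
  then show "\<exists>e>0. \<forall>y. y \<in> S \<and> h y \<noteq> h x \<longrightarrow> e \<le> norm (h y - h x)"
    by (intro exI[of _ "2 * pi"]) auto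
qed

lemma sgn_Im_quotient:
  assumes "x \<noteq> b"
  shows "sgn (Im (cpx (x - a) / cpx (x - b))) = sgn (lf a b x)"
proof -
  let ?D = "(fst (x - b))\<^sup>2 + (snd (x - b))\<^sup>2"
  have "?D > 0" using assms by (auto simp: sum_power2_gt_zero_iff prod_eq_iff)
  moreover have "Im (cpx (x - a) / cpx (x - b)) = lf a b x / ?D"
    by (simp add: Im_divide lf_def algebra_simps)
  ultimately show ?thesis by (simp add: sgn_divide)
qed

lemma quotient_nonpos_imp_in_segment:
  assumes "x \<noteq> b" "cpx (x - a) / cpx (x - b) \<in> \<real>\<^sub>\<le>\<^sub>0"
  shows "x \<in> closed_segment a b"
proof -
  obtain r where r: "r \<le> 0" "cpx (x - a) / cpx (x - b) = of_real r"
    using assms(2) by (auto simp: nonpos_Reals_def)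
  then have e: "cpx (x - a) = of_real r * cpx (x - b)" using assms(1) by (simp add: field_simps)
  have f: "fst x - fst a = r * (fst x - fst b)" "snd x - snd a = r * (snd x - snd b)"
    using arg_cong[OF e, of Re] arg_cong[OF e, of Im] by simp_all
  define u where "u = - r / (1 - r)"
  have u: "0 \<le> u" "u \<le> 1" using r by (auto simp: u_def field_simps)
  have nz: "1 - r \<noteq> 0" using r(1) by simp
  have k: "(1 - r) * u = - r" using nz by (simp add: u_def)
  then have k': "(1 - r) * (1 - u) = 1" by (simp add: algebra_simps)
  have *: "(1 - r) * s = (1 - r) * ((1 - u) * s1 + u * s2)" if "s - s1 = r * (s - s2)" for s s1 s2
  proof -
    have "(1 - r) * ((1 - u) * s1 + u * s2) = ((1 - r) * (1 - u)) * s1 + ((1 - r) * u) * s2"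
      by (simp only: distrib_left mult.assoc)
    also have "\<dots> = (1 - r) * s" unfolding k k' using that by (simp add: algebra_simps)
    finally show ?thesis ..
  qed
  have "fst x = (1 - u) * fst a + u * fst b" "snd x = (1 - u) * snd a + u * snd b"
    using *[OF f(1)] *[OF f(2)] nz by (simp_all only: mult_cancel_left simp_thms)
  then have "x = (1 - u) *\<^sub>R a + u *\<^sub>R b" by (simp add: prod_eq_iff)
  then show ?thesis using u unfolding in_segment by blast
qed

lemma open_segment_imp_neg_quotient:
  assumes "x \<in> open_segment a b"
  shows "- (cpx (x - a) / cpx (x - b)) \<notin> \<real>\<^sub>\<le>\<^sub>0"
proof -
  obtain u where u: "a \<noteq> b" "0 < u" "u < 1" "x = (1 - u) *\<^sub>R a + u *\<^sub>R b"
    using assms unfolding in_segment by blast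
  have 1: "cpx (x - a) = of_real u * cpx (b - a)"
    by (simp add: u complex_eq_iff algebra_simps)
  have 2: "cpx (x - b) = - of_real (1 - u) * cpx (b - a)"
    by (simp add: u complex_eq_iff algebra_simps)
  have "- (cpx (x - a) / cpx (x - b)) = of_real (u / (1 - u))"
    unfolding 1 2 using u by (simp add: field_simps)
  moreover have "u / (1 - u) > 0" using u by simp
  ultimately show ?thesis by (simp only: nonpos_Reals_of_real_iff not_le)
qed

lemma omega_local:
  fixes g :: "'t::real_normed_vector \<Rightarrow> real \<times> real"
  assumes ab: "a \<noteq> b" and g: "continuous_on (ball t0 \<rho>) g" and \<rho>: "\<rho> > 0"
    and za: "continuous_on (ball t0 \<rho>) \<zeta>" "\<And>t. t \<in> ball t0 \<rho> \<Longrightarrow> exp (\<zeta> t) = cpx (g t - a)"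
    and zb: "continuous_on (ball t0 \<rho>) \<zeta>'" "\<And>t. t \<in> ball t0 \<rho> \<Longrightarrow> exp (\<zeta>' t) = cpx (g t - b)"
  shows "\<exists>r>0. \<exists>C. \<forall>t\<in>ball t0 r. g t \<notin> closed_segment a b \<longrightarrow>
    omega a b (g t) = Im (\<zeta> t) / (2 * pi) - Im (\<zeta>' t) / (2 * pi) + C
      + (if g t0 \<in> open_segment a b then sgn (lf a b (g t)) / 2 else 0)"
proof -
  let ?B = "ball t0 \<rho>"
  define q where "q t = cpx (g t - a) / cpx (g t - b)" for t
  have na: "g t \<noteq> a" and nb: "g t \<noteq> b" if "t \<in> ?B" for t
  proof -
    have "cpx (g t - a) \<noteq> 0" "cpx (g t - b) \<noteq> 0"
      by (simp_all only: za(2)[OF that, symmetric] zb(2)[OF that, symmetric] exp_not_eq_zero not_False_eq_True)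
    then show "g t \<noteq> a" "g t \<noteq> b" by auto
  qed
  have q: "continuous_on ?B q" unfolding q_def
    by (intro continuous_intros g) (simp add: nb)
  have qexp: "q t = exp (\<zeta> t - \<zeta>' t)" if "t \<in> ?B" for t
    unfolding q_def exp_diff by (simp add: za(2)[OF that] zb(2)[OF that])
  have t0: "t0 \<in> ?B" using \<rho> by simp
  have cl: "closed (\<real>\<^sub>\<le>\<^sub>0 :: complex set)" by (rule closed_nonpos_Reals_complex)
  show ?thesis
  proof (cases "g t0 \<in> open_segment a b")
    case False
    then have "g t0 \<notin> closed_segment a b"
      using na[OF t0] nb[OF t0] by (simp add: open_segment_def)
    moreover have "open (g -` (- closed_segment a b) \<inter> ?B)"
      using g continuous_on_open_vimage[OF open_ball, of t0 \<rho> g] open_Compl[OF closed_segment] by blast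
    ultimately obtain r where r: "r > 0" "ball t0 r \<subseteq> g -` (- closed_segment a b) \<inter> ?B"
      using t0 by (metis ComplI IntI open_contains_ball vimageI)
    let ?h = "\<lambda>t. Ln (q t) - (\<zeta> t - \<zeta>' t)"
    have qn: "q t \<notin> \<real>\<^sub>\<le>\<^sub>0" if "t \<in> ball t0 r" for t
    proof -
      have "t \<in> ?B" "g t \<notin> closed_segment a b" using subsetD[OF r(2) that] by auto
      then show ?thesis using quotient_nonpos_imp_in_segment[of "g t" b a] nb[of t] by (auto simp: q_def)
    qed
    have "?h constant_on ball t0 r"
    proof (rule exp_eq_const_imp_constant_on)
      show "continuous_on (ball t0 r) ?h"
        using r(2) by (intro continuous_intros continuous_on_subset[OF q] continuous_on_subset[OF za(1)]
            continuous_on_subset[OF zb(1)] qn) auto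
      fix t assume t: "t \<in> ball t0 r"
      then have "t \<in> ?B" "q t \<noteq> 0" using r(2) qn[OF t] by auto
      then show "exp (?h t) = 1" using qexp[of t] by (simp add: exp_diff)
    qed simp
    then obtain C where C: "\<And>t. t \<in> ball t0 r \<Longrightarrow> ?h t = C" by (auto simp: constant_on_def)
    have "omega a b (g t) = Im (\<zeta> t) / (2 * pi) - Im (\<zeta>' t) / (2 * pi) + Im C / (2 * pi)" if "t \<in> ball t0 r" for t
    proof -
      have "Ln (q t) = C + \<zeta> t - \<zeta>' t" using C[OF that] by (simp add: algebra_simps)
      then have "omega a b (g t) = Im (C + \<zeta> t - \<zeta>' t) / (2 * pi)" unfolding omega_def q_def by simp
      then show ?thesis by (simp add: add_divide_distrib diff_divide_distrib)
    qed
    then show ?thesis using False r(1) by (intro exI[of _ r] conjI exI[of _ "Im C / (2 * pi)"]) auto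
  next
    case True
    then have "- q t0 \<notin> \<real>\<^sub>\<le>\<^sub>0" unfolding q_def by (rule open_segment_imp_neg_quotient)
    moreover have "open ((\<lambda>t. - q t) -` (- \<real>\<^sub>\<le>\<^sub>0) \<inter> ?B)"
      using continuous_on_open_vimage[OF open_ball, of t0 \<rho> "\<lambda>t. - q t"] continuous_on_minus[OF q] open_Compl[OF cl] by blast
    ultimately obtain r where r: "r > 0" "ball t0 r \<subseteq> (\<lambda>t. - q t) -` (- \<real>\<^sub>\<le>\<^sub>0) \<inter> ?B"
      using t0 by (metis (no_types, lifting) ComplI IntI open_contains_ball vimageI)
    let ?h = "\<lambda>t. Ln (- q t) - (\<zeta> t - \<zeta>' t)"
    have qn: "- q t \<notin> \<real>\<^sub>\<le>\<^sub>0" if "t \<in> ball t0 r" for t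
      using that r(2) by auto
    have "?h constant_on ball t0 r"
    proof (rule exp_eq_const_imp_constant_on)
      show "continuous_on (ball t0 r) ?h"
        using r(2) by (intro continuous_intros continuous_on_subset[OF q] continuous_on_subset[OF za(1)]
            continuous_on_subset[OF zb(1)] qn) auto
      fix t assume t: "t \<in> ball t0 r"
      then have "t \<in> ?B" "q t \<noteq> 0" using r(2) qn[OF t] by auto
      then show "exp (?h t) = -1" using qexp[of t] by (simp add: exp_diff)
    qed simp
    then obtain C where C: "\<And>t. t \<in> ball t0 r \<Longrightarrow> ?h t = C" by (auto simp: constant_on_def)
    have "omega a b (g t) = Im (\<zeta> t) / (2 * pi) - Im (\<zeta>' t) / (2 * pi) + Im C / (2 * pi) + sgn (lf a b (g t)) / 2"
      if t: "t \<in> ball t0 r" and ns: "g t \<notin> closed_segment a b" for t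
    proof -
      have tB: "t \<in> ?B" using t r(2) by auto
      have q0: "- q t \<noteq> 0" using qn[OF t] by auto
      have sg: "sgn (Im (q t)) = sgn (lf a b (g t))" unfolding q_def by (rule sgn_Im_quotient[OF nb[OF tB]])
      have "Im (q t) \<noteq> 0"
      proof
        assume "Im (q t) = 0"
        moreover have "q t \<notin> \<real>\<^sub>\<le>\<^sub>0"
          using quotient_nonpos_imp_in_segment[of "g t" b a] nb[OF tB] ns by (auto simp: q_def)
        ultimately show False using qn[OF t] by (auto simp: complex_nonpos_Reals_iff)
      qed
      then have "Im (Ln (q t)) = Im (Ln (- q t)) + pi * sgn (Im (q t))"
        using Ln_minus[OF q0] by (auto simp: sgn_if)
      moreover have "Ln (- q t) = C + \<zeta> t - \<zeta>' t" using C[OF t] by (simp add: algebra_simps)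
      ultimately have "Im (Ln (q t)) = Im C + Im (\<zeta> t) - Im (\<zeta>' t) + pi * sgn (lf a b (g t))"
        using sg by simp
      then have "omega a b (g t) = (Im C + Im (\<zeta> t) - Im (\<zeta>' t) + pi * sgn (lf a b (g t))) / (2 * pi)"
        unfolding omega_def q_def by simp
      also have "\<dots> = Im (\<zeta> t) / (2 * pi) - Im (\<zeta>' t) / (2 * pi) + Im C / (2 * pi) + sgn (lf a b (g t)) / 2"
        by (simp add: field_simps)
      finally show ?thesis .
    qed
    then show ?thesis using True r(1) by (intro exI[of _ r] conjI exI[of _ "Im C / (2 * pi)"]) auto
  qed
qed

lemma continuous_omega:
  assumes "x \<notin> closed_segment a b"
  shows "isCont (omega a b) x"
proof -
  have ne: "x \<noteq> a" "x \<noteq> b" using assms by auto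
  have "continuous_on (- closed_segment a b) (\<lambda>x. Ln (cpx (x - a) / cpx (x - b)))"
  proof (rule continuous_on_Ln')
    show "continuous_on (- closed_segment a b) (\<lambda>x. cpx (x - a) / cpx (x - b))"
      by (intro continuous_on_divide continuous_on_cpx continuous_intros) auto
    fix z assume z: "z \<in> - closed_segment a b"
    show "cpx (z - a) / cpx (z - b) \<notin> \<real>\<^sub>\<le>\<^sub>0"
      using quotient_nonpos_imp_in_segment[of z b a] z by auto
  qed
  then have "continuous_on (- closed_segment a b) (omega a b)"
    unfolding omega_def[abs_def] by (intro continuous_on_divide continuous_on_Im continuous_on_const) auto
  then show ?thesis using assms by (simp add: continuous_on_eq_continuous_at open_Compl closed_segment)
qed

lemma log_on_simply_connected:
  fixes g :: "'t::real_normed_vector \<Rightarrow> real \<times> real"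
  assumes "open S" "simply_connected S" "continuous_on S g" "\<And>t. t \<in> S \<Longrightarrow> g t \<noteq> A"
  obtains \<zeta> where "continuous_on S \<zeta>" "\<And>t. t \<in> S \<Longrightarrow> exp (\<zeta> t) = cpx (g t - A)"
proof (rule continuous_logarithm_on_simply_connected[of S "\<lambda>t. cpx (g t - A)"])
  show "continuous_on S (\<lambda>t. cpx (g t - A))" by (intro continuous_intros assms)
  show "locally path_connected S" using assms(1) by (simp add: open_imp_locally_path_connected)
qed (use assms that in auto)

section \<open>Edges, sides and jumps\<close>

lemma lf_affine: "u + v = 1 \<Longrightarrow> lf a b (u *\<^sub>R x + v *\<^sub>R y) = u * lf a b x + v * lf a b y"
proof -
  assume "u + v = 1"
  then have v: "v = 1 - u" by simp
  show ?thesis unfolding v lf_def by (simp add: algebra_simps)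
qed

lemma lf_endpoints [simp]: "lf a b a = 0" "lf a b b = 0"
  by (simp_all add: lf_def algebra_simps)

lemma lf_closed_segment: "x \<in> closed_segment a b \<Longrightarrow> lf a b x = 0"
  unfolding in_segment using lf_affine[of "1 - u" u a b a b for u] by auto

lemma continuous_on_lf [continuous_intros]:
  "continuous_on S f \<Longrightarrow> continuous_on S (\<lambda>x. lf a b (f x))"
  unfolding lf_def by (intro continuous_intros)

lemma lf_zero_imp_on_line:
  assumes "a \<noteq> b" "lf a b x = 0"
  shows "\<exists>s. x = a + s *\<^sub>R (b - a)"
proof -
  define p q where "p = fst b - fst a" and "q = snd b - snd a"
  have D: "p\<^sup>2 + q\<^sup>2 > 0" using assms(1) by (auto simp: p_def q_def sum_power2_gt_zero_iff prod_eq_iff)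
  have l: "q * (fst x - fst a) = p * (snd x - snd a)"
    using assms(2) by (simp add: lf_def p_def q_def algebra_simps)
  define N where "N = p * (fst x - fst a) + q * (snd x - snd a)"
  have 1: "N * p = (p\<^sup>2 + q\<^sup>2) * (fst x - fst a)"
    unfolding N_def using arg_cong[OF l, of "\<lambda>z. q * z"] by (simp add: power2_eq_square algebra_simps)
  have 2: "N * q = (p\<^sup>2 + q\<^sup>2) * (snd x - snd a)"
    unfolding N_def using arg_cong[OF l, of "\<lambda>z. p * z"] by (simp add: power2_eq_square algebra_simps)
  have D0: "p\<^sup>2 + q\<^sup>2 \<noteq> 0" using D by (rule less_imp_neq[symmetric])
  have "fst x - fst a = N * p / (p\<^sup>2 + q\<^sup>2)" "snd x - snd a = N * q / (p\<^sup>2 + q\<^sup>2)"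
    unfolding 1 2 nonzero_mult_div_cancel_left[OF D0] by (rule refl)+
  then have "x = a + (N / (p\<^sup>2 + q\<^sup>2)) *\<^sub>R (b - a)"
    unfolding prod_eq_iff fst_add snd_add fst_scaleR snd_scaleR fst_diff snd_diff p_def[symmetric] q_def[symmetric]
    by (simp add: diff_eq_eq)
  then show ?thesis by blast
qed

lemma lf_sides:
  assumes "a \<noteq> b" "lf a b x0 = 0" "r > 0"
  shows "\<exists>x\<in>ball x0 r. lf a b x > 0" "\<exists>x\<in>ball x0 r. lf a b x < 0"
proof -
  define n where "n = (snd b - snd a, - (fst b - fst a))"
  have n0: "n \<noteq> 0" using assms(1) by (auto simp: n_def prod_eq_iff)
  have lfn: "lf a b (x0 + s *\<^sub>R n) = s * ((snd b - snd a)\<^sup>2 + (fst b - fst a)\<^sup>2)" for s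
    using assms(2) by (simp add: lf_def n_def algebra_simps power2_eq_square)
  have D: "(snd b - snd a)\<^sup>2 + (fst b - fst a)\<^sup>2 > 0"
    using assms(1) by (auto simp: sum_power2_gt_zero_iff prod_eq_iff)
  define s where "s = r / (2 * norm n)"
  have s: "s > 0" using assms(3) n0 by (simp add: s_def)
  have "norm (s *\<^sub>R n) < r" using assms(3) n0 by (simp add: s_def)
  then have "x0 + s *\<^sub>R n \<in> ball x0 r" "x0 + (- s) *\<^sub>R n \<in> ball x0 r" by (simp_all add: dist_norm)
  moreover have "lf a b (x0 + s *\<^sub>R n) > 0" "lf a b (x0 + (- s) *\<^sub>R n) < 0"
    unfolding lfn using s D by (simp_all add: mult_neg_pos)
  ultimately show "\<exists>x\<in>ball x0 r. lf a b x > 0" "\<exists>x\<in>ball x0 r. lf a b x < 0" by blast+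
qed

lemma convex_lf_side: "convex {x. lf a b x > 0}" "convex {x. lf a b x < 0}"
proof -
  show "convex {x. lf a b x > 0}"
  proof (rule convexI)
    fix x y u v assume *: "x \<in> {x. lf a b x > 0}" "y \<in> {x. lf a b x > 0}" "0 \<le> u" "0 \<le> v" "u + v = (1::real)"
    then have "u * lf a b x + v * lf a b y > 0"
      by (cases "u = 0") (auto intro!: add_pos_nonneg)
    then show "u *\<^sub>R x + v *\<^sub>R y \<in> {x. lf a b x > 0}" using lf_affine[OF *(5), of a b x y] by simp
  qed
  show "convex {x. lf a b x < 0}"
  proof (rule convexI)
    fix x y u v assume *: "x \<in> {x. lf a b x < 0}" "y \<in> {x. lf a b x < 0}" "0 \<le> u" "0 \<le> v" "u + v = (1::real)"
    then have "u * (- lf a b x) + v * (- lf a b y) > 0"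
    proof (cases "u = 0")
      case False
      then have "u * (- lf a b x) > 0" "v * (- lf a b y) \<ge> 0" using * by (auto intro!: mult_pos_neg mult_nonneg_nonpos)
      then show ?thesis by linarith
    qed auto
    then show "u *\<^sub>R x + v *\<^sub>R y \<in> {x. lf a b x < 0}" using lf_affine[OF *(5), of a b x y] by simp
  qed
qed

definition endp :: "(real \<times> real) set \<Rightarrow> (real \<times> real) \<times> (real \<times> real)" where
  "endp e = (SOME p. fst p \<noteq> snd p \<and> e = closed_segment (fst p) (snd p))"

abbreviation src where "src e \<equiv> fst (endp e)"
abbreviation tgt where "tgt e \<equiv> snd (endp e)"

locale rpart =
  fixes \<Psi> :: "(real \<times> real) set" and \<Delta> :: "(real \<times> real) set set"
  assumes rp: "rectilinear_partition \<Psi> \<Delta>" and sc: "simply_connected \<Psi>"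
begin

abbreviation "E \<equiv> interior_edges \<Psi> \<Delta>"
abbreviation "V \<equiv> interior_vertices \<Psi> \<Delta>"

lemma open_dom: "open \<Psi>" and connected_dom: "connected \<Psi>" and finite_edges: "finite \<Delta>"
  and frontier_dom: "frontier \<Psi> = \<Union>{e\<in>\<Delta>. e \<subseteq> frontier \<Psi>}"
  using rp unfolding rectilinear_partition_def by auto

lemma edge_closure: "e \<in> \<Delta> \<Longrightarrow> e \<subseteq> closure \<Psi>"
  using rp unfolding rectilinear_partition_def by blast

lemma edges_meet: "e \<in> \<Delta> \<Longrightarrow> e' \<in> \<Delta> \<Longrightarrow> e \<noteq> e' \<Longrightarrow> x \<in> e \<Longrightarrow> x \<in> e' \<Longrightarrow> x \<in> vertices \<Delta>"
  using rp unfolding rectilinear_partition_def by blast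

lemma edge_ends:
  assumes "e \<in> \<Delta>"
  shows "src e \<noteq> tgt e" "closed_segment (src e) (tgt e) = e"
    "open_segment (src e) (tgt e) \<inter> vertices \<Delta> = {}"
proof -
  obtain a b where ab: "a \<noteq> b" "e = closed_segment a b" "open_segment a b \<inter> vertices \<Delta> = {}"
  proof -
    have "\<forall>e\<in>\<Delta>. \<exists>a b. a \<noteq> b \<and> e = closed_segment a b \<and> open_segment a b \<inter> vertices \<Delta> = {}"
      using rp unfolding rectilinear_partition_def by (elim conjE)
    then show ?thesis using assms that by (elim ballE exE conjE) auto
  qed
  have "\<exists>p. fst p \<noteq> snd p \<and> e = closed_segment (fst p) (snd p)"
    using ab by (intro exI[of _ "(a, b)"]) auto
  then have *: "src e \<noteq> tgt e \<and> e = closed_segment (src e) (tgt e)"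
    unfolding endp_def by (rule someI_ex)
  show "src e \<noteq> tgt e" by (rule conjunct1[OF *])
  show 2: "closed_segment (src e) (tgt e) = e" by (rule conjunct2[OF *, symmetric])
  have eq: "closed_segment a b = closed_segment (src e) (tgt e)" unfolding 2 by (rule ab(2)[symmetric])
  then have ends: "{a, b} = {src e, tgt e}" unfolding closed_segment_eq .
  have "open_segment (src e) (tgt e) = open_segment a b" unfolding open_segment_def eq ends ..
  then show "open_segment (src e) (tgt e) \<inter> vertices \<Delta> = {}" using ab(3) by (simp only:)
qed

lemma ends_in_vertices:
  assumes "e \<in> \<Delta>" shows "src e \<in> vertices \<Delta>" "tgt e \<in> vertices \<Delta>"
proof -
  show "src e \<in> vertices \<Delta>" unfolding vertices_def
    using edge_ends(1,2)[OF assms] assms by (intro CollectI exI[of _ "tgt e"]) simp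
  have "closed_segment (tgt e) (src e) \<in> \<Delta>" using edge_ends(2)[OF assms] assms
    by (simp add: closed_segment_commute)
  then show "tgt e \<in> vertices \<Delta>" unfolding vertices_def
    using edge_ends(1)[OF assms] by (intro CollectI exI[of _ "src e"]) simp
qed

lemma finite_vertices: "finite (vertices \<Delta>)"
proof -
  have "vertices \<Delta> \<subseteq> src ` \<Delta> \<union> tgt ` \<Delta>"
  proof
    fix x assume "x \<in> vertices \<Delta>"
    then obtain b where b: "x \<noteq> b" "closed_segment x b \<in> \<Delta>" unfolding vertices_def by blast
    have "{x, b} = {src (closed_segment x b), tgt (closed_segment x b)}"
      using edge_ends(2)[OF b(2), symmetric] unfolding closed_segment_eq .
    then have "x = src (closed_segment x b) \<or> x = tgt (closed_segment x b)"
      unfolding doubleton_eq_iff by (elim disjE conjE) (rule disjI1, assumption, rule disjI2, assumption)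
    then show "x \<in> src ` \<Delta> \<union> tgt ` \<Delta>"
      using imageI[OF b(2), of src] imageI[OF b(2), of tgt] by (elim disjE) simp_all
  qed
  then show ?thesis by (rule finite_subset) (simp add: finite_edges)
qed

lemma V_eq: "V = vertices \<Delta> \<inter> \<Psi>"
  unfolding interior_vertices_def interior_open[OF open_dom] ..

lemma finite_V: "finite V"
  unfolding V_eq using finite_vertices by simp

lemma E_sub: "E \<subseteq> \<Delta>" and finite_E: "finite E"
  using finite_edges by (auto simp: interior_edges_def)

lemma edge_meets_dom: "e \<in> \<Delta> \<Longrightarrow> x \<in> e \<Longrightarrow> x \<in> \<Psi> \<Longrightarrow> e \<in> E"
  using open_dom by (auto simp: interior_edges_def frontier_def interior_open)

lemma open_segment_other:
  assumes "e \<in> \<Delta>" "e' \<in> \<Delta>" "x \<in> open_segment (src e) (tgt e)" "x \<in> e'"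
  shows "e' = e"
proof (rule ccontr)
  assume "e' \<noteq> e"
  moreover have "x \<in> e" using assms(3) edge_ends(2)[OF assms(1)] open_closed_segment by blast
  ultimately have "x \<in> vertices \<Delta>" using edges_meet[OF assms(1,2)] assms(4) by blast
  then show False using edge_ends(3)[OF assms(1)] assms(3) by blast
qed

lemma open_segment_sub:
  assumes "e \<in> E" shows "open_segment (src e) (tgt e) \<subseteq> \<Psi>"
proof
  fix x assume x: "x \<in> open_segment (src e) (tgt e)"
  have e: "e \<in> \<Delta>" "\<not> e \<subseteq> frontier \<Psi>" using assms by (auto simp: interior_edges_def)
  have xe: "x \<in> e" using x edge_ends(2)[OF e(1)] open_closed_segment by blast
  show "x \<in> \<Psi>"
  proof (rule ccontr)
    assume "x \<notin> \<Psi>"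
    then have "x \<in> frontier \<Psi>" using edge_closure[OF e(1)] xe open_dom
      by (auto simp: frontier_def interior_open)
    then obtain e' where e': "e' \<in> \<Delta>" "e' \<subseteq> frontier \<Psi>" "x \<in> e'" using frontier_dom by blast
    then show False using open_segment_other[OF e(1) e'(1) x e'(3)] e(2) by simp
  qed
qed

lemma dom_cases:
  assumes "x \<in> \<Psi>" "x \<notin> vertices \<Delta>"
  obtains "x \<in> \<Psi> - \<Union>\<Delta>" | e where "e \<in> E" "x \<in> open_segment (src e) (tgt e)"
proof (cases "x \<in> \<Union>\<Delta>")
  case True
  then obtain e where e: "e \<in> \<Delta>" "x \<in> e" by blast
  have "x \<in> open_segment (src e) (tgt e)"
    using edge_ends(2)[OF e(1)] ends_in_vertices[OF e(1)] e(2) assms(2) unfolding open_segment_def by blast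
  then show ?thesis using that(2) edge_meets_dom[OF e assms(1)] by blast
qed (use assms that in auto)

lemma edge_closed: "e \<in> \<Delta> \<Longrightarrow> closed e"
  using edge_ends(2)[of e] closed_segment by metis

lemma avoiding_ball:
  assumes "x \<in> \<Psi>"
  shows "\<exists>r>0. ball x r \<subseteq> \<Psi> \<and> (\<forall>e\<in>\<Delta>. x \<notin> e \<longrightarrow> ball x r \<inter> e = {})"
proof -
  let ?S = "\<Psi> - \<Union>{e\<in>\<Delta>. x \<notin> e}"
  have "closed (\<Union>{e\<in>\<Delta>. x \<notin> e})" using finite_edges edge_closed by (intro closed_Union) auto
  then have "open ?S" using open_dom by (rule open_Diff[rotated])
  moreover have "x \<in> ?S" using assms by blast
  ultimately obtain r where r: "r > 0" "ball x r \<subseteq> ?S" by (rule openE)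
  have "ball x r \<subseteq> \<Psi>" using r(2) by blast
  moreover have "\<forall>e\<in>\<Delta>. x \<notin> e \<longrightarrow> ball x r \<inter> e = {}" using r(2) by blast
  ultimately show ?thesis using r(1) by (intro exI[of _ r] conjI)
qed

lemma compl_open: "open (\<Psi> - \<Union>\<Delta>)"
  using open_dom finite_edges edge_closed by (intro open_Diff closed_Union) auto

lemma edge_near:
  assumes "e \<in> E" "x0 \<in> open_segment (src e) (tgt e)"
  shows "\<exists>r>0. ball x0 r \<subseteq> \<Psi> \<and> (\<forall>x\<in>ball x0 r. x \<in> \<Union>\<Delta> \<longleftrightarrow> lf (src e) (tgt e) x = 0)"
proof -
  have e: "e \<in> \<Delta>" using assms E_sub by blast
  note ends = edge_ends[OF e]
  obtain r1 where r1: "r1 > 0" "ball x0 r1 \<subseteq> \<Psi>" "\<And>e'. e' \<in> \<Delta> \<Longrightarrow> x0 \<notin> e' \<Longrightarrow> ball x0 r1 \<inter> e' = {}"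
    using avoiding_ball[OF subsetD[OF open_segment_sub[OF assms(1)] assms(2)]] by (elim exE conjE) simp
  obtain u where u: "0 < u" "u < 1" "x0 = (1 - u) *\<^sub>R src e + u *\<^sub>R tgt e"
    using assms(2) unfolding in_segment by blast
  let ?D = "norm (tgt e - src e)"
  have D: "?D > 0" using ends(1) by simp
  define r where "r = min r1 (min u (1 - u) * ?D)"
  have r: "r > 0" "r \<le> r1" "r \<le> u * ?D" "r \<le> (1 - u) * ?D"
    using r1 u D by (auto simp: r_def min_mult_distrib_right)
  have "x \<in> \<Union>\<Delta> \<longleftrightarrow> lf (src e) (tgt e) x = 0" if x: "x \<in> ball x0 r" for x
  proof
    assume "x \<in> \<Union>\<Delta>"
    then obtain e' where e': "e' \<in> \<Delta>" "x \<in> e'" by blast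
    have "x \<in> ball x0 r1" using x r(2) by auto
    then have "x0 \<in> e'" using r1(3)[OF e'(1)] e'(2) by blast
    then have "x \<in> e" using open_segment_other[OF e e'(1) assms(2)] e' by simp
    then show "lf (src e) (tgt e) x = 0" using ends(2) lf_closed_segment by blast
  next
    assume "lf (src e) (tgt e) x = 0"
    then obtain s where s: "x = src e + s *\<^sub>R (tgt e - src e)" using lf_zero_imp_on_line[OF ends(1)] by blast
    have "x - x0 = (s - u) *\<^sub>R (tgt e - src e)" unfolding s u(3) by (simp add: algebra_simps)
    then have "norm (x - x0) = \<bar>s - u\<bar> * ?D" by (simp only: norm_scaleR real_norm_def)
    moreover have "norm (x - x0) < r" using x by (simp add: dist_norm norm_minus_commute)
    ultimately have "\<bar>s - u\<bar> * ?D < r" by (simp only:)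
    then have "\<bar>s - u\<bar> * ?D < u * ?D" "\<bar>s - u\<bar> * ?D < (1 - u) * ?D" using r by auto
    then have "\<bar>s - u\<bar> < u" "\<bar>s - u\<bar> < 1 - u" using D by simp_all
    then have "0 \<le> s" "s \<le> 1" by auto
    moreover have "x = (1 - s) *\<^sub>R src e + s *\<^sub>R tgt e" unfolding s by (simp add: algebra_simps)
    ultimately have "x \<in> closed_segment (src e) (tgt e)" unfolding in_segment by blast
    then show "x \<in> \<Union>\<Delta>" using ends(2) e by blast
  qed
  then show ?thesis using r r1(2) by (intro exI[of _ r]) auto
qed

lemma complement_dense:
  assumes "open U" "U \<inter> \<Psi> \<noteq> {}"
  shows "\<exists>x\<in>U. x \<in> \<Psi> - \<Union>\<Delta>"
proof (rule ccontr)
  assume "\<not> ?thesis"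
  then have sub: "U \<inter> \<Psi> \<subseteq> \<Union>\<Delta>" by blast
  have "negligible e" if "e \<in> \<Delta>" for e
  proof -
    have "interior (closed_segment (src e) (tgt e)) = {}" by (rule interior_closed_segment_ge2) simp
    then show ?thesis using edge_ends(2)[OF that] negligible_convex_interior convex_closed_segment by metis
  qed
  then have "negligible (\<Union>\<Delta>)" by (intro negligible_Union finite_edges)
  then have "negligible (U \<inter> \<Psi>)" using sub negligible_subset by blast
  then show False using open_not_negligible[of "U \<inter> \<Psi>"] assms open_dom by blast
qed

definition loc_const :: "(real \<times> real \<Rightarrow> real) \<Rightarrow> bool" where
  "loc_const u \<longleftrightarrow> (\<forall>x\<in>\<Psi> - \<Union>\<Delta>. \<exists>r>0. \<forall>y\<in>ball x r. u y = u x)"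

definition jump_at :: "(real \<times> real \<Rightarrow> real) \<Rightarrow> (real \<times> real) set \<Rightarrow> real \<Rightarrow> real \<times> real \<Rightarrow> bool" where
  "jump_at u e j x0 \<longleftrightarrow> (\<exists>r>0. \<exists>c. \<forall>x\<in>ball x0 r - \<Union>\<Delta>. u x = c + j * sgn (lf (src e) (tgt e) x) / 2)"

definition jump :: "(real \<times> real \<Rightarrow> real) \<Rightarrow> (real \<times> real) set \<Rightarrow> real \<Rightarrow> bool" where
  "jump u e j \<longleftrightarrow> (\<forall>x\<in>open_segment (src e) (tgt e). jump_at u e j x)"

lemma loc_const_constant:
  assumes "loc_const u" "connected S" "S \<subseteq> \<Psi> - \<Union>\<Delta>" "x \<in> S" "y \<in> S"
  shows "u x = u y"
proof -
  have "u constant_on S"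
  proof (rule locally_constant_imp_constant[OF assms(2)])
    fix a assume a: "a \<in> S"
    then have "a \<in> \<Psi> - \<Union>\<Delta>" using assms(3) by blast
    then obtain r where r: "r > 0" "\<forall>y\<in>ball a r. u y = u a" using assms(1) unfolding loc_const_def by blast
    have "openin (top_of_set S) (S \<inter> ball a r)" by (rule openin_open_Int[OF open_ball])
    moreover have "a \<in> S \<inter> ball a r" using a r(1) by simp
    moreover have "\<forall>x\<in>S \<inter> ball a r. u x = u a" using r(2) by simp
    ultimately show "\<exists>T. openin (top_of_set S) T \<and> a \<in> T \<and> (\<forall>x\<in>T. u x = u a)"
      by (intro exI[of _ "S \<inter> ball a r"] conjI)
  qed
  then show ?thesis using assms(4,5) by (auto simp: constant_on_def)
qed

definition side :: "(real \<times> real) set \<Rightarrow> real \<times> real \<Rightarrow> real \<Rightarrow> real \<Rightarrow> (real \<times> real) set" where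
  "side e x0 r s = ball x0 r \<inter> {x. s * lf (src e) (tgt e) x > 0}"

lemma convex_side: "s = 1 \<or> s = -1 \<Longrightarrow> convex (side e x0 r s)"
  unfolding side_def using convex_lf_side[of "src e" "tgt e"] by (elim disjE) (auto intro!: convex_Int)

lemma open_side: "open (side e x0 r s)"
  unfolding side_def by (intro open_Int open_ball open_Collect_less continuous_intros)

lemma jump_at_values:
  assumes "loc_const u" and r: "r > 0"
    and near: "ball x0 r \<subseteq> \<Psi>" "\<forall>x\<in>ball x0 r. x \<in> \<Union>\<Delta> \<longleftrightarrow> lf (src e) (tgt e) x = 0"
    and p: "p \<in> side e x0 r 1" and q: "q \<in> side e x0 r (-1)"
  shows "jump_at u e (u p - u q) x0"
  unfolding jump_at_def
proof (intro exI conjI ballI)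
  fix x assume x: "x \<in> ball x0 r - \<Union>\<Delta>"
  have sub: "side e x0 r 1 \<subseteq> \<Psi> - \<Union>\<Delta>" "side e x0 r (-1) \<subseteq> \<Psi> - \<Union>\<Delta>"
    using near unfolding side_def by auto
  have "lf (src e) (tgt e) x \<noteq> 0" using x near by blast
  then consider "lf (src e) (tgt e) x > 0" | "lf (src e) (tgt e) x < 0" by linarith
  then show "u x = (u p + u q) / 2 + (u p - u q) * sgn (lf (src e) (tgt e) x) / 2"
  proof cases
    case 1
    then have "x \<in> side e x0 r 1" using x by (simp add: side_def)
    then have "u x = u p" using loc_const_constant[OF assms(1) _ sub(1) _ p] convex_connected[OF convex_side] by blast
    then show ?thesis using 1 by (simp add: field_simps)
  next
    case 2
    then have "x \<in> side e x0 r (-1)" using x by (simp add: side_def)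
    then have "u x = u q" using loc_const_constant[OF assms(1) _ sub(2) _ q] convex_connected[OF convex_side] by blast
    then show ?thesis using 2 by (simp add: field_simps)
  qed
qed (rule r)

lemma jump_at_exists:
  assumes "loc_const u" "e \<in> E" "x0 \<in> open_segment (src e) (tgt e)"
  shows "\<exists>j. jump_at u e j x0"
proof -
  obtain r where r: "r > 0" "ball x0 r \<subseteq> \<Psi>" "\<forall>x\<in>ball x0 r. x \<in> \<Union>\<Delta> \<longleftrightarrow> lf (src e) (tgt e) x = 0"
    using edge_near[OF assms(2,3)] by blast
  have e: "src e \<noteq> tgt e" using edge_ends assms(2) E_sub by blast
  have l0: "lf (src e) (tgt e) x0 = 0" using lf_closed_segment open_closed_segment assms(3) by blast
  obtain p q where "p \<in> side e x0 r 1" "q \<in> side e x0 r (-1)"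
    using lf_sides[OF e l0 r(1)] unfolding side_def by auto
  then show ?thesis using jump_at_values[OF assms(1) r] by blast
qed

lemma jump_at_unique:
  assumes "e \<in> E" "x0 \<in> open_segment (src e) (tgt e)" "jump_at u e j x0" "jump_at u e k x0"
  shows "j = k"
proof -
  obtain r where r: "r > 0" "ball x0 r \<subseteq> \<Psi>" "\<forall>x\<in>ball x0 r. x \<in> \<Union>\<Delta> \<longleftrightarrow> lf (src e) (tgt e) x = 0"
    using edge_near[OF assms(1,2)] by blast
  have e: "src e \<noteq> tgt e" using edge_ends assms(1) E_sub by blast
  have l0: "lf (src e) (tgt e) x0 = 0" using lf_closed_segment open_closed_segment assms(2) by blast
  obtain r1 c1 where 1: "r1 > 0" "\<forall>x\<in>ball x0 r1 - \<Union>\<Delta>. u x = c1 + j * sgn (lf (src e) (tgt e) x) / 2"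
    using assms(3) unfolding jump_at_def by blast
  obtain r2 c2 where 2: "r2 > 0" "\<forall>x\<in>ball x0 r2 - \<Union>\<Delta>. u x = c2 + k * sgn (lf (src e) (tgt e) x) / 2"
    using assms(4) unfolding jump_at_def by blast
  define m where "m = min r (min r1 r2)"
  have m: "m > 0" using r 1 2 by (simp add: m_def)
  obtain p q where p: "p \<in> ball x0 m" "lf (src e) (tgt e) p > 0" and q: "q \<in> ball x0 m" "lf (src e) (tgt e) q < 0"
    using lf_sides[OF e l0 m] by blast
  have "p \<in> ball x0 r - \<Union>\<Delta>" "q \<in> ball x0 r - \<Union>\<Delta>" using p q r(3) by (auto simp: m_def)
  then have "p \<in> ball x0 r1 - \<Union>\<Delta>" "q \<in> ball x0 r1 - \<Union>\<Delta>" "p \<in> ball x0 r2 - \<Union>\<Delta>" "q \<in> ball x0 r2 - \<Union>\<Delta>"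
    using p q by (auto simp: m_def)
  then have "u p = c1 + j * 1 / 2" "u q = c1 + j * (-1) / 2" "u p = c2 + k * 1 / 2" "u q = c2 + k * (-1) / 2"
    using 1(2) 2(2) p(2) q(2) by (metis sgn_pos sgn_neg)+
  then show ?thesis by simp
qed

lemma open_segment_nonempty: "e \<in> E \<Longrightarrow> \<exists>x. x \<in> open_segment (src e) (tgt e)"
  using edge_ends(1)[of e] E_sub open_segment_eq_empty[of "src e" "tgt e"] by blast

lemma jump_unique: "e \<in> E \<Longrightarrow> jump u e j \<Longrightarrow> jump u e k \<Longrightarrow> j = k"
  using open_segment_nonempty jump_at_unique unfolding jump_def by blast

lemma jump_from_point:
  assumes u: "loc_const u" and e: "e \<in> E" and x1: "x1 \<in> open_segment (src e) (tgt e)" and j: "jump_at u e j x1"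
  shows "jump u e j"
  unfolding jump_def
proof
  fix x assume x: "x \<in> open_segment (src e) (tgt e)"
  show "jump_at u e j x"
  proof (rule connected_induction_simple[OF _ x1 x])
    show "connected (open_segment (src e) (tgt e))" by (rule convex_connected[OF convex_open_segment])
    fix a assume a: "a \<in> open_segment (src e) (tgt e)"
    obtain k where k: "jump_at u e k a" using jump_at_exists[OF u e a] by blast
    then obtain r c where r: "r > 0" "\<And>x. x \<in> ball a r - \<Union>\<Delta> \<Longrightarrow> u x = c + k * sgn (lf (src e) (tgt e) x) / 2"
      unfolding jump_at_def by blast
    have near: "jump_at u e k y" if y: "y \<in> ball a r" for y
    proof -
      obtain s where s: "s > 0" "ball y s \<subseteq> ball a r" using y open_ball open_contains_ball by blast
      then show ?thesis unfolding jump_at_def using r(2) by (intro exI[of _ s] conjI exI[of _ c]) auto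
    qed
    let ?T = "open_segment (src e) (tgt e) \<inter> ball a r"
    have "jump_at u e j z" if yz: "y \<in> ?T" "z \<in> ?T" "jump_at u e j y" for y z
    proof -
      have "j = k" using jump_at_unique[OF e _ yz(3) near] yz(1) by blast
      then show ?thesis using near[of z] yz(2) by blast
    qed
    then have "\<forall>x\<in>?T. \<forall>y\<in>?T. jump_at u e j x \<longrightarrow> jump_at u e j y" by blast
    moreover have "openin (top_of_set (open_segment (src e) (tgt e))) ?T" by (rule openin_open_Int[OF open_ball])
    moreover have "a \<in> ?T" using a r(1) by simp
    ultimately show "\<exists>T. openin (top_of_set (open_segment (src e) (tgt e))) T \<and> a \<in> T \<and>
        (\<forall>x\<in>T. \<forall>y\<in>T. jump_at u e j x \<longrightarrow> jump_at u e j y)"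
      by (intro exI[of _ ?T] conjI)
  qed (rule j)
qed

section \<open>Locally constant functions with prescribed jumps\<close>

text \<open>The choice in \<open>bdry_log A\<close> is meaningful only for \<open>A \<notin> \<Psi>\<close>.\<close>

definition bdry_log :: "real \<times> real \<Rightarrow> real \<times> real \<Rightarrow> complex" where
  "bdry_log A = (SOME \<zeta>. continuous_on \<Psi> \<zeta> \<and> (\<forall>x\<in>\<Psi>. exp (\<zeta> x) = cpx (x - A)))"

definition bdry_arg :: "real \<times> real \<Rightarrow> real \<times> real \<Rightarrow> real" where
  "bdry_arg A x = (if A \<in> \<Psi> then 0 else Im (bdry_log A x) / (2 * pi))"

text \<open>Subtracting the branches at the endpoints outside \<open>\<Psi>\<close> leaves multivaluedness only at the
  interior vertices.\<close>

definition edge_omega :: "(real \<times> real) set \<Rightarrow> real \<times> real \<Rightarrow> real" where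
  "edge_omega e x = omega (src e) (tgt e) x - bdry_arg (src e) x + bdry_arg (tgt e) x"

definition vsum :: "((real \<times> real) set \<Rightarrow> real) \<Rightarrow> real \<times> real \<Rightarrow> real" where
  "vsum j A = (\<Sum>e\<in>E. j e * (of_bool (src e = A) - of_bool (tgt e = A)))"

definition hjump :: "((real \<times> real) set \<Rightarrow> real) \<Rightarrow> real \<times> real \<Rightarrow> real \<times> real \<Rightarrow> real" where
  "hjump j x0 x = (\<Sum>e\<in>E. if x0 \<in> open_segment (src e) (tgt e) then j e * sgn (lf (src e) (tgt e) x) / 2 else 0)"

lemma bdry_log:
  assumes "A \<notin> \<Psi>"
  shows "continuous_on \<Psi> (bdry_log A)" "\<And>x. x \<in> \<Psi> \<Longrightarrow> exp (bdry_log A x) = cpx (x - A)"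
proof -
  have "\<exists>\<zeta>. continuous_on \<Psi> \<zeta> \<and> (\<forall>x\<in>\<Psi>. exp (\<zeta> x) = cpx (x - A))"
  proof (rule log_on_simply_connected[OF open_dom sc continuous_on_id])
    show "x \<noteq> A" if "x \<in> \<Psi>" for x using that assms by auto
    fix \<zeta> assume "continuous_on \<Psi> \<zeta>" "\<And>t. t \<in> \<Psi> \<Longrightarrow> exp (\<zeta> t) = cpx (t - A)"
    then show "\<exists>\<zeta>. continuous_on \<Psi> \<zeta> \<and> (\<forall>x\<in>\<Psi>. exp (\<zeta> x) = cpx (x - A))" by (intro exI[of _ \<zeta>]) simp
  qed
  then have *: "continuous_on \<Psi> (bdry_log A) \<and> (\<forall>x\<in>\<Psi>. exp (bdry_log A x) = cpx (x - A))"
    unfolding bdry_log_def by (rule someI_ex)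
  show "continuous_on \<Psi> (bdry_log A)" by (rule conjunct1[OF *])
  show "exp (bdry_log A x) = cpx (x - A)" if "x \<in> \<Psi>" for x by (rule bspec[OF conjunct2[OF *] that])
qed

lemma continuous_bdry_arg: "continuous_on \<Psi> (bdry_arg A)"
proof (cases "A \<in> \<Psi>")
  case True
  then show ?thesis by (simp add: bdry_arg_def[abs_def])
next
  case False
  then show ?thesis unfolding bdry_arg_def[abs_def] if_not_P[OF False]
    by (intro continuous_on_divide continuous_on_Im bdry_log(1) continuous_on_const) auto
qed

lemma continuous_edge_omega:
  assumes "x \<in> \<Psi>" "e \<in> E" "x \<notin> e"
  shows "isCont (edge_omega e) x"
proof -
  have "x \<notin> closed_segment (src e) (tgt e)" using assms edge_ends(2)[of e] E_sub by auto
  then have 1: "isCont (omega (src e) (tgt e)) x" by (rule continuous_omega)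
  have 2: "isCont (bdry_arg A) x" for A
    using continuous_bdry_arg[of A] assms(1) open_dom by (simp add: continuous_on_eq_continuous_at)
  show ?thesis unfolding edge_omega_def[abs_def] by (intro continuous_add continuous_diff 1 2)
qed

lemma edge_omega_local:
  fixes g :: "'t::real_normed_vector \<Rightarrow> real \<times> real"
  assumes \<rho>: "\<rho> > 0" and g: "continuous_on (ball t0 \<rho>) g" and gdom: "\<And>t. t \<in> ball t0 \<rho> \<Longrightarrow> g t \<in> \<Psi>"
    and z1: "\<And>A. A \<in> V \<Longrightarrow> continuous_on (ball t0 \<rho>) (\<zeta> A)"
    and z2: "\<And>A t. A \<in> V \<Longrightarrow> t \<in> ball t0 \<rho> \<Longrightarrow> exp (\<zeta> A t) = cpx (g t - A)"
    and e: "e \<in> E"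
  shows "\<exists>r>0. \<exists>C. \<forall>t\<in>ball t0 r. g t \<notin> \<Union>\<Delta> \<longrightarrow>
    edge_omega e (g t) = (if src e \<in> V then Im (\<zeta> (src e) t) / (2 * pi) else 0)
      - (if tgt e \<in> V then Im (\<zeta> (tgt e) t) / (2 * pi) else 0) + C
      + (if g t0 \<in> open_segment (src e) (tgt e) then sgn (lf (src e) (tgt e) (g t)) / 2 else 0)"
proof -
  have e\<Delta>: "e \<in> \<Delta>" using e E_sub by blast
  define Z where "Z A t = (if A \<in> V then \<zeta> A t else bdry_log A (g t))" for A t
  have Z1: "continuous_on (ball t0 \<rho>) (Z A)" if "A \<in> vertices \<Delta>" for A
  proof (cases "A \<in> V")
    case True
    then show ?thesis using z1 unfolding Z_def[abs_def] by simp
  next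
    case False
    then have "A \<notin> \<Psi>" using that V_eq by blast
    then have "continuous_on (ball t0 \<rho>) (\<lambda>t. bdry_log A (g t))"
      by (rule continuous_on_compose2[OF bdry_log(1) g]) (use gdom in auto)
    then show ?thesis using False unfolding Z_def[abs_def] by simp
  qed
  have Z2: "exp (Z A t) = cpx (g t - A)" if "A \<in> vertices \<Delta>" "t \<in> ball t0 \<rho>" for A t
  proof (cases "A \<in> V")
    case True
    then show ?thesis using z2[OF True that(2)] unfolding Z_def by simp
  next
    case False
    then have "A \<notin> \<Psi>" using that V_eq by blast
    then show ?thesis using bdry_log(2)[OF _ gdom[OF that(2)]] False unfolding Z_def by simp
  qed
  note vs = ends_in_vertices[OF e\<Delta>]
  have Zl: "Im (Z A t) / (2 * pi) - bdry_arg A (g t) = (if A \<in> V then Im (\<zeta> A t) / (2 * pi) else 0)"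
    if "A \<in> vertices \<Delta>" for A t
    using that unfolding Z_def bdry_arg_def V_eq by auto
  have "\<exists>r>0. \<exists>C. \<forall>t\<in>ball t0 r. g t \<notin> closed_segment (src e) (tgt e) \<longrightarrow>
    omega (src e) (tgt e) (g t) = Im (Z (src e) t) / (2 * pi) - Im (Z (tgt e) t) / (2 * pi) + C
      + (if g t0 \<in> open_segment (src e) (tgt e) then sgn (lf (src e) (tgt e) (g t)) / 2 else 0)"
    by (rule omega_local[OF edge_ends(1)[OF e\<Delta>] g \<rho> Z1[OF vs(1)] Z2[OF vs(1)] Z1[OF vs(2)] Z2[OF vs(2)]])
  then obtain r C where r: "r > 0" and C: "\<forall>t\<in>ball t0 r. g t \<notin> closed_segment (src e) (tgt e) \<longrightarrow>
    omega (src e) (tgt e) (g t) = Im (Z (src e) t) / (2 * pi) - Im (Z (tgt e) t) / (2 * pi) + C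
      + (if g t0 \<in> open_segment (src e) (tgt e) then sgn (lf (src e) (tgt e) (g t)) / 2 else 0)"
    by (elim exE conjE)
  show ?thesis
  proof (intro exI conjI ballI impI)
    fix t assume t: "t \<in> ball t0 r" "g t \<notin> \<Union>\<Delta>"
    have "g t \<notin> closed_segment (src e) (tgt e)" using t(2) edge_ends(2)[OF e\<Delta>] e\<Delta> by auto
    note * = mp[OF bspec[OF C t(1)] this]
    show "edge_omega e (g t) = (if src e \<in> V then Im (\<zeta> (src e) t) / (2 * pi) else 0)
      - (if tgt e \<in> V then Im (\<zeta> (tgt e) t) / (2 * pi) else 0) + C
      + (if g t0 \<in> open_segment (src e) (tgt e) then sgn (lf (src e) (tgt e) (g t)) / 2 else 0)"
      unfolding edge_omega_def * Zl[OF vs(1), symmetric] Zl[OF vs(2), symmetric] by simp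
  qed (rule r)
qed

lemma vsum_swap:
  "(\<Sum>e\<in>E. j e * ((if src e \<in> V then x (src e) else 0) - (if tgt e \<in> V then x (tgt e) else 0)))
    = (\<Sum>A\<in>V. vsum j A * x A)"
proof -
  have d: "(if B \<in> V then x B else 0) = (\<Sum>A\<in>V. of_bool (B = A) * x A)" for B :: "real \<times> real" and x :: "_ \<Rightarrow> real"
  proof -
    have "(\<Sum>A\<in>V. of_bool (B = A) * x A) = (\<Sum>A\<in>V. if B = A then x A else 0)"
      by (rule sum.cong) auto
    then show ?thesis using finite_V by (simp only: sum.delta')
  qed
  have "(\<Sum>e\<in>E. j e * ((if src e \<in> V then x (src e) else 0) - (if tgt e \<in> V then x (tgt e) else 0)))
    = (\<Sum>e\<in>E. \<Sum>A\<in>V. j e * (of_bool (src e = A) - of_bool (tgt e = A)) * x A)"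
    unfolding d by (simp only: sum_subtractf[symmetric] left_diff_distrib[symmetric] sum_distrib_left mult.assoc)
  also have "\<dots> = (\<Sum>A\<in>V. \<Sum>e\<in>E. j e * (of_bool (src e = A) - of_bool (tgt e = A)) * x A)"
    by (rule sum.swap)
  finally show ?thesis unfolding vsum_def sum_distrib_right .
qed

lemma sum_edge_omega_local:
  fixes g :: "'t::real_normed_vector \<Rightarrow> real \<times> real"
  assumes \<rho>: "\<rho> > 0" and g: "continuous_on (ball t0 \<rho>) g" and gdom: "\<And>t. t \<in> ball t0 \<rho> \<Longrightarrow> g t \<in> \<Psi>"
    and z1: "\<And>A. A \<in> V \<Longrightarrow> continuous_on (ball t0 \<rho>) (\<zeta> A)"
    and z2: "\<And>A t. A \<in> V \<Longrightarrow> t \<in> ball t0 \<rho> \<Longrightarrow> exp (\<zeta> A t) = cpx (g t - A)"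
  shows "\<exists>r>0. \<exists>C. \<forall>t\<in>ball t0 r. g t \<notin> \<Union>\<Delta> \<longrightarrow>
    (\<Sum>e\<in>E. j e * edge_omega e (g t)) = C + (\<Sum>A\<in>V. vsum j A * (Im (\<zeta> A t) / (2 * pi))) + hjump j (g t0) (g t)"
proof -
  have "\<forall>e\<in>E. \<exists>p. fst p > 0 \<and> (\<forall>t\<in>ball t0 (fst p). g t \<notin> \<Union>\<Delta> \<longrightarrow>
    edge_omega e (g t) = (if src e \<in> V then Im (\<zeta> (src e) t) / (2 * pi) else 0)
      - (if tgt e \<in> V then Im (\<zeta> (tgt e) t) / (2 * pi) else 0) + snd p
      + (if g t0 \<in> open_segment (src e) (tgt e) then sgn (lf (src e) (tgt e) (g t)) / 2 else 0))"
    (is "\<forall>e\<in>E. \<exists>p. ?Q e p")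
  proof
    fix e assume "e \<in> E"
    from edge_omega_local[OF \<rho> g gdom z1 z2 this, simplified]
    obtain r C where "r > 0" "?Q e (r, C)" by auto
    then show "\<exists>p. ?Q e p" by (intro exI[of _ "(r, C)"])
  qed
  then obtain P where P: "\<forall>e\<in>E. ?Q e (P e)" by (rule bchoice[THEN exE])
  define r where "r = Min (insert 1 ((\<lambda>e. fst (P e)) ` E))"
  have fin: "finite (insert 1 ((\<lambda>e. fst (P e)) ` E))" using finite_E by simp
  have r: "r > 0" unfolding r_def using P by (subst Min_gr_iff[OF fin]) auto
  have rle: "r \<le> fst (P e)" if "e \<in> E" for e
    unfolding r_def using that by (intro Min_le fin) auto
  have split: "k * (a - b + c + (if Q then s / 2 else 0)) = k * c + k * (a - b) + (if Q then k * s / 2 else 0)"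
    for k a b c s :: real and Q by (simp add: algebra_simps)
  show ?thesis
  proof (intro exI conjI ballI impI)
    fix t assume t: "t \<in> ball t0 r" "g t \<notin> \<Union>\<Delta>"
    have "(\<Sum>e\<in>E. j e * edge_omega e (g t)) = (\<Sum>e\<in>E. j e * snd (P e)
        + j e * ((if src e \<in> V then Im (\<zeta> (src e) t) / (2 * pi) else 0) - (if tgt e \<in> V then Im (\<zeta> (tgt e) t) / (2 * pi) else 0))
        + (if g t0 \<in> open_segment (src e) (tgt e) then j e * sgn (lf (src e) (tgt e) (g t)) / 2 else 0))"
    proof (rule sum.cong[OF refl])
      fix e assume e: "e \<in> E"
      have "t \<in> ball t0 (fst (P e))" using t(1) rle[OF e] by simp
      then have *: "edge_omega e (g t) = (if src e \<in> V then Im (\<zeta> (src e) t) / (2 * pi) else 0)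
        - (if tgt e \<in> V then Im (\<zeta> (tgt e) t) / (2 * pi) else 0) + snd (P e)
        + (if g t0 \<in> open_segment (src e) (tgt e) then sgn (lf (src e) (tgt e) (g t)) / 2 else 0)"
        using bspec[OF P e] t(2) by blast
      show "j e * edge_omega e (g t) = j e * snd (P e)
        + j e * ((if src e \<in> V then Im (\<zeta> (src e) t) / (2 * pi) else 0) - (if tgt e \<in> V then Im (\<zeta> (tgt e) t) / (2 * pi) else 0))
        + (if g t0 \<in> open_segment (src e) (tgt e) then j e * sgn (lf (src e) (tgt e) (g t)) / 2 else 0)"
        unfolding * by (rule split)
    qed
    also have "\<dots> = (\<Sum>e\<in>E. j e * snd (P e)) + (\<Sum>A\<in>V. vsum j A * (Im (\<zeta> A t) / (2 * pi))) + hjump j (g t0) (g t)"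
      unfolding sum.distrib hjump_def vsum_swap[of j "\<lambda>A. Im (\<zeta> A t) / (2 * pi)"] ..
    finally show "(\<Sum>e\<in>E. j e * edge_omega e (g t))
      = (\<Sum>e\<in>E. j e * snd (P e)) + (\<Sum>A\<in>V. vsum j A * (Im (\<zeta> A t) / (2 * pi))) + hjump j (g t0) (g t)" .
  qed (rule r)
qed

lemma hjump_off: "x0 \<notin> \<Union>\<Delta> \<Longrightarrow> hjump j x0 x = 0"
proof -
  assume x0: "x0 \<notin> \<Union>\<Delta>"
  have "x0 \<notin> open_segment (src e) (tgt e)" if "e \<in> E" for e
  proof
    assume "x0 \<in> open_segment (src e) (tgt e)"
    then have "x0 \<in> closed_segment (src e) (tgt e)" by (rule open_closed_segment)
    then show False using edge_ends(2)[of e] that E_sub x0 by auto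
  qed
  then show ?thesis unfolding hjump_def by (intro sum.neutral) simp
qed

lemma hjump_on:
  assumes "e \<in> E" "x0 \<in> open_segment (src e) (tgt e)"
  shows "hjump j x0 x = j e * sgn (lf (src e) (tgt e) x) / 2"
proof -
  have "hjump j x0 x = (\<Sum>e'\<in>E. if e' = e then j e * sgn (lf (src e) (tgt e) x) / 2 else 0)"
    unfolding hjump_def
  proof (rule sum.cong[OF refl])
    fix e' assume e': "e' \<in> E"
    have "x0 \<in> open_segment (src e') (tgt e') \<longleftrightarrow> e' = e"
    proof
      assume x: "x0 \<in> open_segment (src e') (tgt e')"
      then have "x0 \<in> closed_segment (src e') (tgt e')" by (rule open_closed_segment)
      then have "x0 \<in> e'" using edge_ends(2)[of e'] e' E_sub by auto
      then show "e' = e" using open_segment_other[OF _ _ assms(2)] assms(1) e' E_sub by blast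
    qed (use assms in simp)
    then show "(if x0 \<in> open_segment (src e') (tgt e') then j e' * sgn (lf (src e') (tgt e') x) / 2 else 0)
      = (if e' = e then j e * sgn (lf (src e) (tgt e) x) / 2 else 0)" by simp
  qed
  then show ?thesis using finite_E assms(1) by (simp only: sum.delta if_True)
qed

lemma jump_local:
  assumes u: "loc_const u" and j: "\<And>e. e \<in> E \<Longrightarrow> jump u e (j e)" and x0: "x0 \<in> \<Psi>" "x0 \<notin> vertices \<Delta>"
  shows "\<exists>r>0. \<exists>c. \<forall>x\<in>ball x0 r - \<Union>\<Delta>. u x = c + hjump j x0 x"
  using x0
proof (cases rule: dom_cases)
  case 1
  then obtain r where r: "r > 0" "\<forall>y\<in>ball x0 r. u y = u x0" using u unfolding loc_const_def by blast
  have h: "hjump j x0 x = 0" for x using 1 by (intro hjump_off) simp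
  have "u x = u x0 + hjump j x0 x" if "x \<in> ball x0 r - \<Union>\<Delta>" for x
    unfolding h add_0_right using that by (intro bspec[OF r(2)]) simp
  then show ?thesis using r(1) by (intro exI[of _ r] conjI exI[of _ "u x0"] ballI)
next
  case (2 e)
  have "jump_at u e (j e) x0" using j[OF 2(1)] 2(2) unfolding jump_def by (rule bspec)
  then obtain r c where "r > 0" "\<forall>x\<in>ball x0 r - \<Union>\<Delta>. u x = c + j e * sgn (lf (src e) (tgt e) x) / 2"
    unfolding jump_at_def by (elim exE conjE)
  then show ?thesis unfolding hjump_on[OF 2] by (intro exI[of _ r] conjI exI[of _ c])
qed

text \<open>Every vertex of the partition outside \<open>\<Psi>\<close> has a global logarithm on the simply connected
  \<open>\<Psi>\<close>, so only the interior vertices obstruct the existence of a locally constant function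
  with prescribed jumps.\<close>

lemma sum_edge_omega_near:
  assumes vs: "\<And>A. A \<in> V \<Longrightarrow> vsum j A = 0" and x0: "x0 \<in> \<Psi>" "x0 \<notin> vertices \<Delta>"
  shows "\<exists>r>0. \<exists>c. \<forall>x\<in>ball x0 r - \<Union>\<Delta>. (\<Sum>e\<in>E. j e * edge_omega e x) = c + hjump j x0 x"
proof -
  have "open (\<Psi> - vertices \<Delta>)" using open_dom finite_imp_closed[OF finite_vertices] by (rule open_Diff)
  moreover have "x0 \<in> \<Psi> - vertices \<Delta>" using x0 by blast
  ultimately obtain \<rho> where \<rho>: "\<rho> > 0" "ball x0 \<rho> \<subseteq> \<Psi> - vertices \<Delta>" by (rule openE)
  have ex: "\<exists>\<zeta>. continuous_on (ball x0 \<rho>) \<zeta> \<and> (\<forall>t\<in>ball x0 \<rho>. exp (\<zeta> t) = cpx (t - A))" if "A \<in> V" for A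
  proof (rule log_on_simply_connected[OF open_ball convex_imp_simply_connected[OF convex_ball] continuous_on_id])
    show "t \<noteq> A" if "t \<in> ball x0 \<rho>" for t using subsetD[OF \<rho>(2) that] \<open>A \<in> V\<close> unfolding V_eq by auto
    fix \<zeta> assume "continuous_on (ball x0 \<rho>) \<zeta>" "\<And>t. t \<in> ball x0 \<rho> \<Longrightarrow> exp (\<zeta> t) = cpx (t - A)"
    then show "\<exists>\<zeta>. continuous_on (ball x0 \<rho>) \<zeta> \<and> (\<forall>t\<in>ball x0 \<rho>. exp (\<zeta> t) = cpx (t - A))"
      by (intro exI[of _ \<zeta>]) simp
  qed
  define Z where "Z A = (SOME \<zeta>. continuous_on (ball x0 \<rho>) \<zeta> \<and> (\<forall>t\<in>ball x0 \<rho>. exp (\<zeta> t) = cpx (t - A)))" for A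
  have Z: "continuous_on (ball x0 \<rho>) (Z A) \<and> (\<forall>t\<in>ball x0 \<rho>. exp (Z A t) = cpx (t - A))" if "A \<in> V" for A
    unfolding Z_def by (rule someI_ex[OF ex[OF that]])
  have Z1: "continuous_on (ball x0 \<rho>) (Z A)" if "A \<in> V" for A by (rule conjunct1[OF Z[OF that]])
  have Z2: "exp (Z A t) = cpx (t - A)" if "A \<in> V" "t \<in> ball x0 \<rho>" for A t
    by (rule bspec[OF conjunct2[OF Z[OF that(1)]] that(2)])
  have "t \<in> \<Psi>" if "t \<in> ball x0 \<rho>" for t using subsetD[OF \<rho>(2) that] by blast
  then have "\<exists>r>0. \<exists>C. \<forall>x\<in>ball x0 r. x \<notin> \<Union>\<Delta> \<longrightarrow>
      (\<Sum>e\<in>E. j e * edge_omega e x) = C + (\<Sum>A\<in>V. vsum j A * (Im (Z A x) / (2 * pi))) + hjump j x0 x"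
    by (rule sum_edge_omega_local[OF \<rho>(1) continuous_on_id _ Z1 Z2])
  then obtain r C where r: "r > 0" and C: "\<forall>t\<in>ball x0 r. t \<notin> \<Union>\<Delta> \<longrightarrow>
      (\<Sum>e\<in>E. j e * edge_omega e t) = C + (\<Sum>A\<in>V. vsum j A * (Im (Z A t) / (2 * pi))) + hjump j x0 t"
    by (elim exE conjE)
  have z: "(\<Sum>A\<in>V. vsum j A * (Im (Z A t) / (2 * pi))) = 0" for t
    by (rule sum.neutral) (simp add: vs)
  show ?thesis
  proof (intro exI conjI ballI)
    fix x assume "x \<in> ball x0 r - \<Union>\<Delta>"
    then show "(\<Sum>e\<in>E. j e * edge_omega e x) = C + hjump j x0 x" using C z[of x] by simp
  qed (rule r)
qed

lemma sum_edge_omega_loc_const: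
  assumes vs: "\<And>A. A \<in> V \<Longrightarrow> vsum j A = 0"
  shows "loc_const (\<lambda>x. \<Sum>e\<in>E. j e * edge_omega e x)"
  unfolding loc_const_def
proof
  fix x0 assume x0: "x0 \<in> \<Psi> - \<Union>\<Delta>"
  have v: "x0 \<notin> vertices \<Delta>"
    using x0 ends_in_vertices unfolding vertices_def by auto
  obtain r1 c where r1: "r1 > 0" "\<forall>x\<in>ball x0 r1 - \<Union>\<Delta>. (\<Sum>e\<in>E. j e * edge_omega e x) = c + hjump j x0 x"
    using sum_edge_omega_near[OF vs, of x0] x0 v by blast
  obtain r2 where r2: "r2 > 0" "ball x0 r2 \<subseteq> \<Psi> - \<Union>\<Delta>" using compl_open x0 by (rule openE)
  have *: "(\<Sum>e\<in>E. j e * edge_omega e y) = c" if "y \<in> ball x0 (min r1 r2)" for y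
  proof -
    have "y \<in> ball x0 r1" "y \<notin> \<Union>\<Delta>" using that r2(2) by auto
    then show ?thesis using r1(2) hjump_off[of x0] x0 by auto
  qed
  show "\<exists>r>0. \<forall>y\<in>ball x0 r. (\<Sum>e\<in>E. j e * edge_omega e y) = (\<Sum>e\<in>E. j e * edge_omega e x0)"
  proof (intro exI conjI ballI)
    show "min r1 r2 > 0" using r1 r2 by simp
    then have "(\<Sum>e\<in>E. j e * edge_omega e x0) = c" by (intro *) simp
    then show "(\<Sum>e\<in>E. j e * edge_omega e y) = (\<Sum>e\<in>E. j e * edge_omega e x0)" if "y \<in> ball x0 (min r1 r2)" for y
      using *[OF that] by simp
  qed
qed

lemma sum_edge_omega_jump:
  assumes vs: "\<And>A. A \<in> V \<Longrightarrow> vsum j A = 0" and e: "e \<in> E"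
  shows "jump (\<lambda>x. \<Sum>e\<in>E. j e * edge_omega e x) e (j e)"
  unfolding jump_def
proof
  fix x0 assume x0: "x0 \<in> open_segment (src e) (tgt e)"
  have "x0 \<in> \<Psi>" "x0 \<notin> vertices \<Delta>"
    using open_segment_sub[OF e] x0 edge_ends(3)[of e] e E_sub by blast+
  then obtain r1 c where "r1 > 0" "\<forall>x\<in>ball x0 r1 - \<Union>\<Delta>. (\<Sum>e\<in>E. j e * edge_omega e x) = c + hjump j x0 x"
    using sum_edge_omega_near[OF vs, of x0] by blast
  then show "jump_at (\<lambda>x. \<Sum>e\<in>E. j e * edge_omega e x) e (j e) x0"
    unfolding jump_at_def hjump_on[OF e x0] by (intro exI[of _ r1] conjI exI[of _ c])
qed

lemma loc_const_no_jumps_constant: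
  assumes u: "loc_const u" and j: "\<And>e. e \<in> E \<Longrightarrow> jump u e 0" and xy: "x \<in> \<Psi> - \<Union>\<Delta>" "y \<in> \<Psi> - \<Union>\<Delta>"
  shows "u x = u y"
proof -
  let ?S = "\<Psi> - vertices \<Delta>"
  have nv: "z \<in> ?S" if "z \<in> \<Psi> - \<Union>\<Delta>" for z
    using that unfolding vertices_def by auto
  have openS: "open ?S" using open_dom finite_imp_closed[OF finite_vertices] by (rule open_Diff)
  show ?thesis
  proof (rule connected_induction[where S = ?S and P = "\<lambda>z. z \<notin> \<Union>\<Delta>" and Q = "\<lambda>z. u x = u z" and a = x and b = y])
    show "connected ?S"
      by (rule connected_open_delete_finite[OF open_dom connected_dom _ finite_vertices]) simp
    show "\<exists>z. z \<in> T \<and> z \<notin> \<Union>\<Delta>" if T: "openin (top_of_set ?S) T" "a \<in> T" for T a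
    proof -
      have oT: "open T" "T \<subseteq> ?S" using T(1) openS by (auto simp: openin_open_eq)
      then have "T \<inter> \<Psi> \<noteq> {}" using T(2) by blast
      then show ?thesis using complement_dense[OF oT(1)] by blast
    qed
    fix a assume a: "a \<in> ?S"
    then obtain r c where r: "r > 0" "\<forall>z\<in>ball a r - \<Union>\<Delta>. u z = c + hjump (\<lambda>_. 0) a z"
      using jump_local[OF u j, of a] by blast
    have h0: "hjump (\<lambda>_. 0) a z = 0" for z unfolding hjump_def by (rule sum.neutral) simp
    have "openin (top_of_set ?S) (?S \<inter> ball a r)" by (rule openin_open_Int[OF open_ball])
    moreover have "a \<in> ?S \<inter> ball a r" using a r(1) by simp
    moreover have "\<forall>z\<in>?S \<inter> ball a r. \<forall>w\<in>?S \<inter> ball a r. z \<notin> \<Union>\<Delta> \<and> w \<notin> \<Union>\<Delta> \<and> u x = u z \<longrightarrow> u x = u w"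
      using r(2) h0 by simp
    ultimately show "\<exists>T. openin (top_of_set ?S) T \<and> a \<in> T \<and>
        (\<forall>z\<in>T. \<forall>w\<in>T. z \<notin> \<Union>\<Delta> \<and> w \<notin> \<Union>\<Delta> \<and> u x = u z \<longrightarrow> u x = u w)"
      by (intro exI[of _ "?S \<inter> ball a r"] conjI)
  qed (use xy nv in auto)
qed

text \<open>The jumps seen on a small loop around an interior vertex \<open>A\<close> sum to zero: on the logarithmic
  cover \<open>w \<mapsto> A + exp w\<close> the function \<open>H\<close> below has no jumps at all.\<close>

lemma vsum_zero:
  assumes u: "loc_const u" and j: "\<And>e. e \<in> E \<Longrightarrow> jump u e (j e)" and A: "A \<in> V"
  shows "vsum j A = 0"
proof -
  define g where "g w = A + (Re (exp w), Im (exp w))" for w :: complex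
  have cg: "continuous_on S g" for S unfolding g_def[abs_def]
    by (intro continuous_intros)
  have gA: "cpx (g w - A) = exp w" for w by (simp add: g_def complex_eq_iff)
  have "open (\<Psi> - (vertices \<Delta> - {A}))" using open_dom finite_vertices by (intro open_Diff finite_imp_closed) auto
  moreover have "A \<in> \<Psi> - (vertices \<Delta> - {A})" using A V_eq by blast
  ultimately obtain \<rho> where \<rho>: "\<rho> > 0" "ball A \<rho> \<subseteq> \<Psi> - (vertices \<Delta> - {A})" by (rule openE)
  define N where "N = {w. Re w < ln \<rho>}"
  have oN: "open N" unfolding N_def by (intro open_Collect_less continuous_intros)
  have cN: "connected N" unfolding N_def by (intro convex_connected convex_halfspace_Re_lt)
  have gN: "g w \<in> ball A \<rho>" "g w \<noteq> A" if "w \<in> N" for w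
  proof -
    have "dist A (g w) = norm (exp w)"
      by (simp add: g_def dist_norm norm_Pair cmod_def real_sqrt_abs2)
    also have "\<dots> = exp (Re w)" by (rule norm_exp_eq_Re)
    also have "\<dots> < \<rho>" using that \<rho>(1) unfolding N_def by (metis exp_less_cancel_iff exp_ln mem_Collect_eq)
    finally show "g w \<in> ball A \<rho>" by simp
    have "cpx (g w - A) \<noteq> 0" unfolding gA by (rule exp_not_eq_zero)
    then show "g w \<noteq> A" by auto
  qed
  have gv: "g w \<in> \<Psi>" "g w \<notin> vertices \<Delta>" if "w \<in> N" for w
    using subsetD[OF \<rho>(2) gN(1)[OF that]] gN(2)[OF that] by auto
  have ex: "\<exists>\<zeta>. continuous_on (ball A \<rho>) \<zeta> \<and> (\<forall>t\<in>ball A \<rho>. exp (\<zeta> t) = cpx (t - B))" if "B \<in> V - {A}" for B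
  proof (rule log_on_simply_connected[OF open_ball convex_imp_simply_connected[OF convex_ball] continuous_on_id])
    show "t \<noteq> B" if "t \<in> ball A \<rho>" for t using subsetD[OF \<rho>(2) that] \<open>B \<in> V - {A}\<close> unfolding V_eq by auto
    fix \<zeta> assume "continuous_on (ball A \<rho>) \<zeta>" "\<And>t. t \<in> ball A \<rho> \<Longrightarrow> exp (\<zeta> t) = cpx (t - B)"
    then show "\<exists>\<zeta>. continuous_on (ball A \<rho>) \<zeta> \<and> (\<forall>t\<in>ball A \<rho>. exp (\<zeta> t) = cpx (t - B))"
      by (intro exI[of _ \<zeta>]) simp
  qed
  define Y where "Y B = (SOME \<zeta>. continuous_on (ball A \<rho>) \<zeta> \<and> (\<forall>t\<in>ball A \<rho>. exp (\<zeta> t) = cpx (t - B)))" for B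
  have Y: "continuous_on (ball A \<rho>) (Y B) \<and> (\<forall>t\<in>ball A \<rho>. exp (Y B t) = cpx (t - B))" if "B \<in> V - {A}" for B
    unfolding Y_def by (rule someI_ex[OF ex[OF that]])
  define Z where "Z B w = (if B = A then w else Y B (g w))" for B w
  have Z1: "continuous_on N (Z B)" if "B \<in> V" for B
  proof (cases "B = A")
    case True then show ?thesis unfolding Z_def[abs_def] by (simp add: continuous_on_id)
  next
    case False
    then have "B \<in> V - {A}" using that by blast
    have "continuous_on N (\<lambda>w. Y B (g w))"
      by (rule continuous_on_compose2[OF conjunct1[OF Y[OF \<open>B \<in> V - {A}\<close>]] cg]) (use gN in auto)
    then show ?thesis using False unfolding Z_def[abs_def] by simp
  qed
  have Z2: "exp (Z B w) = cpx (g w - B)" if "B \<in> V" "w \<in> N" for B w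
  proof (cases "B = A")
    case True then show ?thesis by (simp add: Z_def gA)
  next
    case False
    then have "B \<in> V - {A}" using that by blast
    then show ?thesis using bspec[OF conjunct2[OF Y] gN(1)[OF that(2)]] False by (simp add: Z_def)
  qed
  define H where "H w = u (g w) - (\<Sum>e\<in>E. j e * edge_omega e (g w)) + (\<Sum>B\<in>V. vsum j B * (Im (Z B w) / (2 * pi)))" for w
  have local: "\<exists>r>0. \<exists>C. \<forall>w\<in>ball w0 r. g w \<notin> \<Union>\<Delta> \<longrightarrow> H w = C" if w0: "w0 \<in> N" for w0
  proof -
    obtain \<delta> where \<delta>: "\<delta> > 0" "ball w0 \<delta> \<subseteq> N" using oN w0 by (rule openE)
    have z1: "continuous_on (ball w0 \<delta>) (Z B)" if "B \<in> V" for B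
      by (rule continuous_on_subset[OF Z1[OF that] \<delta>(2)])
    have z2: "exp (Z B w) = cpx (g w - B)" if "B \<in> V" "w \<in> ball w0 \<delta>" for B w
      by (rule Z2[OF that(1) subsetD[OF \<delta>(2) that(2)]])
    have "g w \<in> \<Psi>" if "w \<in> ball w0 \<delta>" for w by (rule gv(1)[OF subsetD[OF \<delta>(2) that]])
    then have "\<exists>r>0. \<exists>C. \<forall>w\<in>ball w0 r. g w \<notin> \<Union>\<Delta> \<longrightarrow>
      (\<Sum>e\<in>E. j e * edge_omega e (g w)) = C + (\<Sum>B\<in>V. vsum j B * (Im (Z B w) / (2 * pi))) + hjump j (g w0) (g w)"
      by (rule sum_edge_omega_local[OF \<delta>(1) cg _ z1 z2])
    then obtain r1 C1 where r1: "r1 > 0" "\<forall>w\<in>ball w0 r1. g w \<notin> \<Union>\<Delta> \<longrightarrow>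
      (\<Sum>e\<in>E. j e * edge_omega e (g w)) = C1 + (\<Sum>B\<in>V. vsum j B * (Im (Z B w) / (2 * pi))) + hjump j (g w0) (g w)"
      by (elim exE conjE)
    obtain r2 c where r2: "r2 > 0" "\<forall>x\<in>ball (g w0) r2 - \<Union>\<Delta>. u x = c + hjump j (g w0) x"
      using jump_local[OF u j gv[OF w0]] by blast
    have "open (g -` ball (g w0) r2)" using cg[of UNIV] by (simp add: continuous_on_open_vimage)
    moreover have "w0 \<in> g -` ball (g w0) r2" using r2(1) by simp
    ultimately obtain r3 where r3: "r3 > 0" "ball w0 r3 \<subseteq> g -` ball (g w0) r2" by (rule openE)
    show ?thesis
    proof (intro exI conjI ballI impI)
      show "min r1 r3 > 0" using r1 r3 by simp
      fix w assume w: "w \<in> ball w0 (min r1 r3)" "g w \<notin> \<Union>\<Delta>"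
      have 1: "(\<Sum>e\<in>E. j e * edge_omega e (g w)) = C1 + (\<Sum>B\<in>V. vsum j B * (Im (Z B w) / (2 * pi))) + hjump j (g w0) (g w)"
        using r1(2) w by simp
      have "g w \<in> ball (g w0) r2" using r3(2) w(1) by auto
      then have 2: "u (g w) = c + hjump j (g w0) (g w)" using r2(2) w(2) by blast
      show "H w = c - C1" unfolding H_def 1 2 by simp
    qed
  qed
  have dens: "\<exists>w\<in>T. g w \<notin> \<Union>\<Delta>" if T: "open T" "T \<subseteq> N" "w0 \<in> T" for T w0
  proof -
    define h where "h y = w0 + Ln (cpx (y - A) / exp w0)" for y
    have w0: "w0 \<in> N" using T by blast
    have "cpx (g w0 - A) / exp w0 = 1" by (simp add: gA)
    then have hc: "isCont h (g w0)" and h0: "h (g w0) = w0"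
      unfolding h_def[abs_def] cpx_def
      by (auto intro!: continuous_intros simp: Complex_eq)
    have "\<exists>U. open U \<and> g w0 \<in> U \<and> (\<forall>y\<in>U. h y \<in> T)"
      using hc T(1,3) h0 unfolding continuous_at_open by simp
    then obtain U where U: "open U" "g w0 \<in> U" "\<forall>y\<in>U. h y \<in> T" by blast
    have "open (U - {A})" "(U - {A}) \<inter> \<Psi> \<noteq> {}" using U(1,2) gN(2)[OF w0] gv(1)[OF w0] by (auto simp: open_delete)
    then obtain y where y: "y \<in> U - {A}" "y \<in> \<Psi> - \<Union>\<Delta>" using complement_dense by blast
    have "cpx (y - A) / exp w0 \<noteq> 0" using y(1) by simp
    then have "exp (h y) = cpx (y - A)" by (simp add: h_def exp_add)
    then have "g (h y) = y" by (simp add: g_def prod_eq_iff)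
    then show ?thesis using U(3) y by (intro bexI[of _ "h y"]) auto
  qed
  obtain w1 where w1: "w1 \<in> N" "g w1 \<notin> \<Union>\<Delta>"
  proof -
    have "of_real (ln \<rho> - 1) \<in> N" by (simp add: N_def)
    then show ?thesis using dens[OF oN subset_refl] that by blast
  qed
  define w2 where "w2 = w1 + 2 * of_real pi * \<i>"
  have exp2: "exp w2 = exp w1" by (simp add: w2_def exp_add)
  have g2: "g w2 = g w1" unfolding g_def exp2 ..
  have "H w1 = H w2"
  proof (rule connected_induction[where S = N and P = "\<lambda>z. g z \<notin> \<Union>\<Delta>" and Q = "\<lambda>z. H w1 = H z" and a = w1 and b = w2])
    show "\<exists>z. z \<in> T \<and> g z \<notin> \<Union>\<Delta>" if T: "openin (top_of_set N) T" "a \<in> T" for T a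
    proof -
      have oT: "open T" "T \<subseteq> N" using T(1) oN by (auto simp: openin_open_eq)
      then show ?thesis using dens[OF oT T(2)] by blast
    qed
    fix a assume a: "a \<in> N"
    then obtain r C where r: "r > 0" "\<forall>w\<in>ball a r. g w \<notin> \<Union>\<Delta> \<longrightarrow> H w = C" using local by blast
    have "openin (top_of_set N) (N \<inter> ball a r)" by (rule openin_open_Int[OF open_ball])
    moreover have "a \<in> N \<inter> ball a r" using a r(1) by simp
    moreover have "\<forall>z\<in>N \<inter> ball a r. \<forall>w\<in>N \<inter> ball a r. g z \<notin> \<Union>\<Delta> \<and> g w \<notin> \<Union>\<Delta> \<and> H w1 = H z \<longrightarrow> H w1 = H w"
      using r(2) by simp
    ultimately show "\<exists>T. openin (top_of_set N) T \<and> a \<in> T \<and>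
        (\<forall>z\<in>T. \<forall>w\<in>T. g z \<notin> \<Union>\<Delta> \<and> g w \<notin> \<Union>\<Delta> \<and> H w1 = H z \<longrightarrow> H w1 = H w)"
      by (intro exI[of _ "N \<inter> ball a r"] conjI)
  qed (use cN w1 g2 in \<open>auto simp: N_def w2_def\<close>)
  then have eq: "(\<Sum>B\<in>V. vsum j B * (Im (Z B w1) / (2 * pi))) = (\<Sum>B\<in>V. vsum j B * (Im (Z B w2) / (2 * pi)))"
    unfolding H_def g2 by simp
  have "(\<Sum>B\<in>V. vsum j B * (Im (Z B w2) / (2 * pi))) - (\<Sum>B\<in>V. vsum j B * (Im (Z B w1) / (2 * pi)))
    = (\<Sum>B\<in>V. if B = A then vsum j B else 0)"
    unfolding sum_subtractf[symmetric]
  proof (rule sum.cong[OF refl])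
    fix B
    show "vsum j B * (Im (Z B w2) / (2 * pi)) - vsum j B * (Im (Z B w1) / (2 * pi)) = (if B = A then vsum j B else 0)"
    proof (cases "B = A")
      case True
      then show ?thesis by (simp add: Z_def w2_def field_simps)
    qed (simp add: Z_def g2)
  qed
  also have "\<dots> = vsum j A" using finite_V A by (simp only: sum.delta if_True)
  finally show ?thesis using eq by simp
qed

end

section \<open>Gluing polynomials along closed sets\<close>

lemma rpf_isCont: "real_polynomial_function p \<Longrightarrow> isCont p x"
  by (rule has_derivative_continuous[OF has_derivative_pd])

lemma C_on_glue:
  fixes p :: "'i \<Rightarrow> real \<times> real \<Rightarrow> real"
  assumes I: "finite I" and oS: "open S" and cl: "\<And>i. i \<in> I \<Longrightarrow> closed (C i)"
    and cov: "\<And>x. x \<in> S \<Longrightarrow> \<exists>i\<in>I. x \<in> C i"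
    and p: "\<And>i. i \<in> I \<Longrightarrow> real_polynomial_function (p i)"
    and f: "\<And>i x. i \<in> I \<Longrightarrow> x \<in> S \<Longrightarrow> x \<in> C i \<Longrightarrow> f x = p i x"
    and flat: "\<And>i j x. i \<in> I \<Longrightarrow> j \<in> I \<Longrightarrow> x \<in> S \<Longrightarrow> x \<in> C i \<Longrightarrow> x \<in> C j \<Longrightarrow> flat k (\<lambda>z. p i z - p j z) x"
  shows "C_on k S f"
proof -
  have ev: "eventually (\<lambda>y. \<exists>i\<in>I. x \<in> C i \<and> y \<in> C i \<and> y \<in> S) (nhds x)" if x: "x \<in> S" for x
  proof -
    let ?U = "S - \<Union>(C ` {i \<in> I. x \<notin> C i})"
    have "closed (\<Union>(C ` {i \<in> I. x \<notin> C i}))" using I cl by (intro closed_Union) auto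
    then have "open ?U" by (rule open_Diff[OF oS])
    moreover have "x \<in> ?U" using x by blast
    moreover have "\<exists>i\<in>I. x \<in> C i \<and> y \<in> C i \<and> y \<in> S" if "y \<in> ?U" for y
      using that cov[of y] by blast
    ultimately show ?thesis unfolding eventually_nhds by blast
  qed
  show ?thesis using p f flat
  proof (induction k arbitrary: p f)
    case 0
    have "isCont f x" if x: "x \<in> S" for x
      unfolding isCont_def
    proof (rule tendstoI)
      fix \<epsilon> :: real assume \<epsilon>: "\<epsilon> > 0"
      have "\<forall>i\<in>{i\<in>I. x \<in> C i}. eventually (\<lambda>y. dist (p i y) (p i x) < \<epsilon>) (nhds x)"
      proof
        fix i assume "i \<in> {i\<in>I. x \<in> C i}"
        then have "isCont (p i) x" using rpf_isCont[OF 0(1)[of i]] by simp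
        then show "eventually (\<lambda>y. dist (p i y) (p i x) < \<epsilon>) (nhds x)"
          using \<epsilon> by (intro tendstoD) (simp_all add: isCont_def tendsto_nhds_iff)
      qed
      then have "eventually (\<lambda>y. \<forall>i\<in>{i\<in>I. x \<in> C i}. dist (p i y) (p i x) < \<epsilon>) (nhds x)"
        using I by (intro eventually_ball_finite) auto
      then have "eventually (\<lambda>y. dist (f y) (f x) < \<epsilon>) (nhds x)" using ev[OF x]
      proof eventually_elim
        case (elim y)
        then obtain i where i: "i \<in> I" "x \<in> C i" "y \<in> C i" "y \<in> S" by blast
        show ?case unfolding 0(2)[OF i(1) x i(2)] 0(2)[OF i(1,4,3)] using elim(1) i by blast
      qed
      then show "eventually (\<lambda>y. dist (f y) (f x) < \<epsilon>) (at x)" by (simp add: eventually_at_filter eventually_mono)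
    qed
    then show ?case unfolding C_on.simps by (intro continuous_at_imp_continuous_on) simp
  next
    case (Suc k)
    define ix where "ix x = (SOME i. i \<in> I \<and> x \<in> C i)" for x
    have ix: "ix x \<in> I \<and> x \<in> C (ix x)" if "x \<in> S" for x
      unfolding ix_def using cov[OF that] unfolding Bex_def by (rule someI_ex)
    define f' where "f' x v = pd v (p (ix x)) x" for x v
    have flat': "flat k (\<lambda>z. pd v (p i) z - pd v (p j) z) x"
      if "i \<in> I" "j \<in> I" "x \<in> S" "x \<in> C i" "x \<in> C j" for i j x v
    proof -
      have "flat k (pd v (\<lambda>z. p i z - p j z)) x" using Suc.prems(3)[OF that] unfolding flat.simps by (elim conjE) (rule spec)
      then show ?thesis unfolding pd_diff[OF Suc.prems(1)[OF that(1)] Suc.prems(1)[OF that(2)]] .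
    qed
    have f': "f' x v = pd v (p i) x" if "i \<in> I" "x \<in> S" "x \<in> C i" for i x v
      using flat_zero[OF flat'[OF conjunct1[OF ix[OF that(2)]] that(1,2) conjunct2[OF ix[OF that(2)]] that(3), of v]]
      unfolding f'_def by (simp only: right_minus_eq)
    have "(f has_derivative f' x) (at x)" if x: "x \<in> S" for x
      unfolding has_derivative_at_alt
    proof (intro conjI allI impI)
      have eq: "f' x = (\<lambda>v. pd v (p i) x)" if "i \<in> I" "x \<in> C i" for i
        by (rule ext) (rule f'[OF that(1) x that(2)])
      have hd: "(p i has_derivative f' x) (at x)" if "i \<in> I" "x \<in> C i" for i
        unfolding eq[OF that] by (rule has_derivative_pd[OF Suc.prems(1)[OF that(1)]])
      show "bounded_linear (f' x)" using hd ix[OF x] has_derivative_bounded_linear by blast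
      fix \<epsilon> :: real assume \<epsilon>: "\<epsilon> > 0"
      have "\<forall>i\<in>{i\<in>I. x \<in> C i}. eventually (\<lambda>y. norm (p i y - p i x - f' x (y - x)) \<le> \<epsilon> * norm (y - x)) (nhds x)"
      proof
        fix i assume "i \<in> {i\<in>I. x \<in> C i}"
        then obtain \<delta> where \<delta>: "\<delta> > 0" "\<forall>y. norm (y - x) < \<delta> \<longrightarrow> norm (p i y - p i x - f' x (y - x)) \<le> \<epsilon> * norm (y - x)"
          using hd[of i] \<epsilon> unfolding has_derivative_at_alt by blast
        then show "eventually (\<lambda>y. norm (p i y - p i x - f' x (y - x)) \<le> \<epsilon> * norm (y - x)) (nhds x)"
          unfolding eventually_nhds_metric by (intro exI[of _ \<delta>]) (simp add: dist_norm)
      qed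
      then have "eventually (\<lambda>y. \<forall>i\<in>{i\<in>I. x \<in> C i}. norm (p i y - p i x - f' x (y - x)) \<le> \<epsilon> * norm (y - x)) (nhds x)"
        using I by (intro eventually_ball_finite) auto
      then have "eventually (\<lambda>y. norm (f y - f x - f' x (y - x)) \<le> \<epsilon> * norm (y - x)) (nhds x)" using ev[OF x]
      proof eventually_elim
        case (elim y)
        then obtain i where i: "i \<in> I" "x \<in> C i" "y \<in> C i" "y \<in> S" by blast
        show ?case unfolding Suc.prems(2)[OF i(1) x i(2)] Suc.prems(2)[OF i(1,4,3)] using elim(1) i by blast
      qed
      then show "\<exists>\<delta>>0. \<forall>y. norm (y - x) < \<delta> \<longrightarrow> norm (f y - f x - f' x (y - x)) \<le> \<epsilon> * norm (y - x)"
        unfolding eventually_nhds_metric by (simp add: dist_norm)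
    qed
    moreover have "C_on k S (\<lambda>x. f' x v)" for v
    proof (rule Suc.IH)
      show "real_polynomial_function (pd v (p i))" if "i \<in> I" for i by (rule pd_rpf[OF Suc.prems(1)[OF that]])
    qed (erule (2) f', erule (4) flat')
    ultimately show ?case unfolding C_on.simps by (intro exI[of _ f'] conjI ballI allI)
  qed
qed

lemma C_on_continuous: "C_on k S f \<Longrightarrow> continuous_on S f"
proof (cases k)
  case (Suc n)
  assume "C_on k S f"
  then obtain f' where f': "\<forall>x\<in>S. (f has_derivative f' x) (at x)" unfolding Suc C_on.simps by (elim exE conjE)
  show "continuous_on S f"
    by (rule continuous_at_imp_continuous_on) (use f' has_derivative_continuous in blast)
qed simp

lemma continuous_eq_on_closure:
  fixes f g :: "real \<times> real \<Rightarrow> real"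
  assumes "isCont f x" "isCont g x" "x \<in> closure V" "\<And>y. y \<in> V \<Longrightarrow> f y = g y"
  shows "f x = g x"
proof -
  obtain s where s: "\<And>n::nat. s n \<in> V" "s \<longlonglongrightarrow> x" using assms(3) unfolding closure_sequential by blast
  have "(\<lambda>n. f (s n)) \<longlonglongrightarrow> f x" "(\<lambda>n. g (s n)) \<longlonglongrightarrow> g x"
    using isCont_tendsto_compose[OF _ s(2)] assms(1,2) by auto
  moreover have "(\<lambda>n. f (s n)) = (\<lambda>n. g (s n))" using assms(4)[OF s(1)] by simp
  ultimately show ?thesis using LIMSEQ_unique by metis
qed

lemma C_on_imp_flat:
  assumes oS: "open S" and xS: "x \<in> S" and cf: "C_on k S f"
    and V: "open V" "V \<subseteq> S" "x \<in> closure V" "\<And>y. y \<in> V \<Longrightarrow> f y = p y"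
    and W: "open W" "W \<subseteq> S" "x \<in> closure W" "\<And>y. y \<in> W \<Longrightarrow> f y = q y"
    and p: "real_polynomial_function p" and q: "real_polynomial_function q"
  shows "flat k (\<lambda>z. p z - q z) x"
  using cf V(4) W(4) p q
proof (induction k arbitrary: f p q)
  have zero: "p x - q x = 0"
    if "continuous_on S f" "\<And>y. y \<in> V \<Longrightarrow> f y = p y" "\<And>y. y \<in> W \<Longrightarrow> f y = q y"
      "real_polynomial_function p" "real_polynomial_function q" for f p q
  proof -
    have "isCont f x" using that(1) oS xS by (simp add: continuous_on_eq_continuous_at)
    then have "f x = p x" "f x = q x"
      using continuous_eq_on_closure[OF _ rpf_isCont[OF that(4)] V(3) that(2)]
        continuous_eq_on_closure[OF _ rpf_isCont[OF that(5)] W(3) that(3)] by auto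
    then show ?thesis by simp
  qed
  {
    case 0
    then show ?case using zero[of f p q] by simp
  next
    case (Suc k)
    obtain f' where f': "\<forall>x\<in>S. (f has_derivative f' x) (at x)" "\<forall>v. C_on k S (\<lambda>x. f' x v)"
      using Suc.prems(1) unfolding C_on.simps by (elim exE conjE)
    have der: "f' y v = pd v g y"
      if "open U" "U \<subseteq> S" "\<And>y. y \<in> U \<Longrightarrow> f y = g y" "real_polynomial_function g" "y \<in> U" for U g y v
    proof -
      have "(f has_derivative f' y) (at y)" using f'(1) that by blast
      moreover have "(f has_derivative (\<lambda>v. pd v g y)) (at y)"
        by (rule has_derivative_transform_within_open[OF has_derivative_pd[OF that(4)] that(1,5)])
          (rule that(3)[symmetric])
      ultimately have "f' y = (\<lambda>v. pd v g y)" by (rule has_derivative_unique)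
      then show ?thesis by simp
    qed
    have "flat k (\<lambda>z. pd v p z - pd v q z) x" for v
    proof (rule Suc.IH)
      show "C_on k S (\<lambda>x. f' x v)" by (rule spec[OF f'(2)])
      show "f' y v = pd v p y" if "y \<in> V" for y by (rule der[OF V(1,2) Suc.prems(2,4) that])
      show "f' y v = pd v q y" if "y \<in> W" for y by (rule der[OF W(1,2) Suc.prems(3,5) that])
    qed (rule pd_rpf[OF Suc.prems(4)], rule pd_rpf[OF Suc.prems(5)])
    then show ?case
      using zero[OF C_on_continuous[OF Suc.prems(1)] Suc.prems(2-5)]
      by (simp add: pd_diff[OF Suc.prems(4,5)])
  }
qed

context rpart
begin

text \<open>Each cell is a union of chambers of the arrangement of all lines carrying edges, and the
  chambers are distinguished by their sign vectors.\<close>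

lemma finite_cells: "finite (cells \<Psi> \<Delta>)"
proof -
  let ?l = "\<lambda>e. lf (src e) (tgt e)"
  have "\<exists>x\<in>\<psi>. \<forall>e\<in>\<Delta>. ?l e x \<noteq> 0" if \<psi>: "\<psi> \<in> cells \<Psi> \<Delta>" for \<psi>
  proof (rule ccontr)
    assume "\<not> ?thesis"
    then have sub: "\<psi> \<subseteq> \<Union>((\<lambda>e. {x. ?l e x = 0}) ` \<Delta>)" by blast
    have "negligible {x. ?l e x = 0}" if e: "e \<in> \<Delta>" for e
    proof -
      have "convex {x. ?l e x = 0}" by (rule convexI) (simp add: lf_affine)
      moreover have "interior {x. ?l e x = 0} = {}"
      proof (rule ccontr)
        assume "interior {x. ?l e x = 0} \<noteq> {}"
        then obtain x r where "r > 0" "ball x r \<subseteq> {x. ?l e x = 0}" unfolding interior_def by (auto elim: openE) (meson open_contains_ball subset_trans)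
        then have z: "?l e y = 0" if "y \<in> ball x r" for y using that by auto
        have "?l e x = 0" using z[of x] \<open>r > 0\<close> by simp
        from lf_sides(1)[OF edge_ends(1)[OF e] this \<open>r > 0\<close>] obtain y where "y \<in> ball x r" "?l e y > 0" by blast
        then show False using z[of y] by simp
      qed
      ultimately show ?thesis using negligible_convex_interior by blast
    qed
    then have "negligible (\<Union>((\<lambda>e. {x. ?l e x = 0}) ` \<Delta>))" using finite_edges by (intro negligible_Union) auto
    then have "negligible \<psi>" using sub negligible_subset by blast
    moreover have "open \<psi>" using \<psi> open_components[OF compl_open] unfolding cells_def by blast
    moreover have "\<psi> \<noteq> {}" using \<psi> in_components_nonempty unfolding cells_def by blast
    ultimately show False using open_not_negligible by blast
  qed
  then obtain pick where pick: "\<And>\<psi>. \<psi> \<in> cells \<Psi> \<Delta> \<Longrightarrow> pick \<psi> \<in> \<psi>"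
    "\<And>\<psi> e. \<psi> \<in> cells \<Psi> \<Delta> \<Longrightarrow> e \<in> \<Delta> \<Longrightarrow> ?l e (pick \<psi>) \<noteq> 0" by metis
  define sv where "sv x = {e\<in>\<Delta>. ?l e x > 0}" for x
  have "inj_on (\<lambda>\<psi>. sv (pick \<psi>)) (cells \<Psi> \<Delta>)"
  proof (rule inj_onI)
    fix \<psi> \<psi>' assume \<psi>: "\<psi> \<in> cells \<Psi> \<Delta>" "\<psi>' \<in> cells \<Psi> \<Delta>" and eq: "sv (pick \<psi>) = sv (pick \<psi>')"
    let ?S = "closed_segment (pick \<psi>) (pick \<psi>')"
    have avoid: "?S \<inter> \<Union>\<Delta> = {}"
    proof (rule ccontr)
      assume "?S \<inter> \<Union>\<Delta> \<noteq> {}"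
      then obtain x e where x: "x \<in> ?S" "x \<in> e" "e \<in> \<Delta>" by blast
      have "x \<in> closed_segment (src e) (tgt e)" using x(2) edge_ends(2)[OF x(3)] by simp
      then have l0: "?l e x = 0" by (rule lf_closed_segment)
      have nz: "?l e (pick \<psi>) \<noteq> 0" "?l e (pick \<psi>') \<noteq> 0" using pick(2) \<psi> x(3) by auto
      have iff: "?l e (pick \<psi>) > 0 \<longleftrightarrow> ?l e (pick \<psi>') > 0" using eq x(3) unfolding sv_def by blast
      show False
      proof (cases "?l e (pick \<psi>) > 0")
        case True
        then have "?S \<subseteq> {x. ?l e x > 0}" using iff by (intro closed_segment_subset convex_lf_side) auto
        then show False using x(1) l0 by auto
      next
        case False
        then have "?S \<subseteq> {x. ?l e x < 0}" using iff nz by (intro closed_segment_subset convex_lf_side) auto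
        then show False using x(1) l0 by auto
      qed
    qed
    have G: "pick \<xi> \<in> \<Psi> - \<Union>\<Delta>" if "\<xi> \<in> cells \<Psi> \<Delta>" for \<xi>
      using pick(1)[OF that] in_components_subset that unfolding cells_def by blast
    have "?S \<subseteq> \<Psi>"
    proof (rule ccontr)
      assume "\<not> ?S \<subseteq> \<Psi>"
      then have "?S \<inter> frontier \<Psi> \<noteq> {}" using G[OF \<psi>(1)] by (intro connected_Int_frontier) auto
      then show False using avoid frontier_dom by blast
    qed
    then have sub: "?S \<subseteq> \<Psi> - \<Union>\<Delta>" using avoid by blast
    have comp: "\<psi> \<in> components (\<Psi> - \<Union>\<Delta>)" "\<psi>' \<in> components (\<Psi> - \<Union>\<Delta>)" using \<psi> unfolding cells_def by auto
    have "?S \<subseteq> \<psi>"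
      by (rule components_maximal[OF comp(1) _ sub]) (use pick(1)[OF \<psi>(1)] in auto)
    then have "pick \<psi>' \<in> \<psi> \<inter> \<psi>'" using pick(1)[OF \<psi>(2)] by auto
    then show "\<psi> = \<psi>'" using components_nonoverlap[OF comp] by blast
  qed
  moreover have "(\<lambda>\<psi>. sv (pick \<psi>)) ` cells \<Psi> \<Delta> \<subseteq> Pow \<Delta>" unfolding sv_def by blast
  ultimately show ?thesis using finite_edges by (metis finite_Pow_iff inj_on_finite)
qed

lemma cells_cover: "x \<in> \<Psi> \<Longrightarrow> \<exists>\<psi>\<in>cells \<Psi> \<Delta>. x \<in> closure \<psi>"
proof -
  assume x: "x \<in> \<Psi>"
  have "x \<in> closure (\<Psi> - \<Union>\<Delta>)"
    unfolding closure_approachable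
  proof (intro allI impI)
    fix \<epsilon> :: real assume "\<epsilon> > 0"
    then have "ball x \<epsilon> \<inter> \<Psi> \<noteq> {}" using x by (auto intro: centre_in_ball[THEN iffD2])
    then obtain y where "y \<in> ball x \<epsilon>" "y \<in> \<Psi> - \<Union>\<Delta>" using complement_dense[OF open_ball] by blast
    then show "\<exists>y\<in>\<Psi> - \<Union>\<Delta>. dist y x < \<epsilon>" by (intro bexI[of _ y]) (auto simp: dist_commute)
  qed
  moreover have "closure (\<Psi> - \<Union>\<Delta>) \<subseteq> \<Union>(closure ` cells \<Psi> \<Delta>)"
  proof (rule closure_minimal)
    have "\<Psi> - \<Union>\<Delta> = \<Union>(cells \<Psi> \<Delta>)" unfolding cells_def by (rule Union_components[symmetric])
    moreover have "\<Union>(cells \<Psi> \<Delta>) \<subseteq> \<Union>(closure ` cells \<Psi> \<Delta>)"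
    proof (rule Union_least)
      show "\<psi> \<subseteq> \<Union>(closure ` cells \<Psi> \<Delta>)" if "\<psi> \<in> cells \<Psi> \<Delta>" for \<psi>
        by (rule subset_trans[OF closure_subset UN_upper[OF that]])
    qed
    ultimately show "\<Psi> - \<Union>\<Delta> \<subseteq> \<Union>(closure ` cells \<Psi> \<Delta>)" by (rule ord_eq_le_trans)
    show "closed (\<Union>(closure ` cells \<Psi> \<Delta>))" using finite_cells by (intro closed_Union) auto
  qed
  ultimately show ?thesis by blast
qed

lemma cell_props:
  assumes "\<psi> \<in> cells \<Psi> \<Delta>"
  shows "open \<psi>" "connected \<psi>" "\<psi> \<subseteq> \<Psi> - \<Union>\<Delta>" "\<psi> \<noteq> {}"
  using assms open_components[OF compl_open] in_components_connected in_components_subset in_components_nonempty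
  unfolding cells_def by blast+

lemma in_cell: "x \<in> \<Psi> - \<Union>\<Delta> \<Longrightarrow> \<exists>\<psi>\<in>cells \<Psi> \<Delta>. x \<in> \<psi>"
  unfolding cells_def using Union_components[of "\<Psi> - \<Union>\<Delta>"] by blast

end

section \<open>Splines and their jumps\<close>

lemma C_on_add: "C_on k S f \<Longrightarrow> C_on k S g \<Longrightarrow> C_on k S (\<lambda>x. f x + g x)"
proof (induction k arbitrary: f g)
  case 0
  then show ?case unfolding C_on.simps by (rule continuous_on_add)
next
  case (Suc k)
  obtain f' where f': "\<forall>x\<in>S. (f has_derivative f' x) (at x)" "\<forall>v. C_on k S (\<lambda>x. f' x v)"
    using Suc.prems(1) unfolding C_on.simps by (elim exE conjE)
  obtain g' where g': "\<forall>x\<in>S. (g has_derivative g' x) (at x)" "\<forall>v. C_on k S (\<lambda>x. g' x v)"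
    using Suc.prems(2) unfolding C_on.simps by (elim exE conjE)
  have "\<forall>x\<in>S. ((\<lambda>x. f x + g x) has_derivative (\<lambda>v. f' x v + g' x v)) (at x)"
    by (intro ballI has_derivative_add bspec[OF f'(1)] bspec[OF g'(1)])
  moreover have "\<forall>v. C_on k S (\<lambda>x. f' x v + g' x v)"
    by (intro allI Suc.IH spec[OF f'(2)] spec[OF g'(2)])
  ultimately show ?case unfolding C_on.simps by (intro exI[of _ "\<lambda>x v. f' x v + g' x v"] conjI)
qed

lemma C_on_scale: "C_on k S f \<Longrightarrow> C_on k S (\<lambda>x. c * f x)"
proof (induction k arbitrary: f)
  case 0
  then show ?case unfolding C_on.simps by (rule continuous_on_mult_left)
next
  case (Suc k)
  obtain f' where f': "\<forall>x\<in>S. (f has_derivative f' x) (at x)" "\<forall>v. C_on k S (\<lambda>x. f' x v)"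
    using Suc.prems(1) unfolding C_on.simps by (elim exE conjE)
  have "\<forall>x\<in>S. ((\<lambda>x. c * f x) has_derivative (\<lambda>v. c * f' x v)) (at x)"
    by (intro ballI has_derivative_mult_right bspec[OF f'(1)])
  moreover have "\<forall>v. C_on k S (\<lambda>x. c * f' x v)"
    by (intro allI Suc.IH spec[OF f'(2)])
  ultimately show ?case unfolding C_on.simps by (intro exI[of _ "\<lambda>x v. c * f' x v"] conjI)
qed

locale spline_setup = rpart +
  fixes d \<mu> :: nat
  assumes \<mu>d: "\<mu> < d"
begin

abbreviation "Spl \<equiv> spline_space d \<mu> \<Psi> \<Delta>"

lemma spline_zero: "f \<in> Spl \<Longrightarrow> x \<notin> \<Psi> \<Longrightarrow> f x = 0"
  unfolding spline_space_def by blast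

lemma spline_C_on: "f \<in> Spl \<Longrightarrow> C_on \<mu> \<Psi> f"
  unfolding spline_space_def by blast

lemma spline_poly: "f \<in> Spl \<Longrightarrow> \<psi> \<in> cells \<Psi> \<Delta> \<Longrightarrow> \<exists>p\<in>bivariate_polys d. \<forall>x\<in>\<psi>. f x = p x"
  unfolding spline_space_def by blast

lemma subspace_Spl: "fun_space.subspace Spl"
proof (rule fun_space.subspaceI)
  have "C_on k S (\<lambda>x. 0)" for k S
    by (induction k) (auto simp: continuous_on_const intro!: exI[of _ "\<lambda>x v. 0"])
  then show "0 \<in> Spl" unfolding spline_space_def zero_fun_def
    using const_in_bivariate_polys[of 0 d] by auto
next
  fix f g assume f: "f \<in> Spl" and g: "g \<in> Spl"
  have "\<exists>p\<in>bivariate_polys d. \<forall>x\<in>\<psi>. (f + g) x = p x" if \<psi>: "\<psi> \<in> cells \<Psi> \<Delta>" for \<psi>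
  proof -
    obtain p q where "p \<in> bivariate_polys d" "\<forall>x\<in>\<psi>. f x = p x" "q \<in> bivariate_polys d" "\<forall>x\<in>\<psi>. g x = q x"
      using spline_poly[OF f \<psi>] spline_poly[OF g \<psi>] by blast
    then show ?thesis using fun_space.subspace_add[OF subspace_bivariate_polys]
      by (intro bexI[of _ "p + q"]) auto
  qed
  then show "f + g \<in> Spl"
    using spline_zero[OF f] spline_zero[OF g] C_on_add[OF spline_C_on[OF f] spline_C_on[OF g]]
    unfolding spline_space_def plus_fun_def by simp
next
  fix c f assume f: "f \<in> Spl"
  have "\<exists>p\<in>bivariate_polys d. \<forall>x\<in>\<psi>. c * f x = p x" if \<psi>: "\<psi> \<in> cells \<Psi> \<Delta>" for \<psi>
  proof -
    obtain p where p: "p \<in> bivariate_polys d" "\<forall>x\<in>\<psi>. f x = p x" using spline_poly[OF f \<psi>] by blast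
    show ?thesis
      by (rule bexI[OF _ fun_space.subspace_scale[OF subspace_bivariate_polys p(1), of c]]) (simp add: p(2))
  qed
  then show "smul c f \<in> Spl"
    using spline_zero[OF f] C_on_scale[OF spline_C_on[OF f], of c] unfolding spline_space_def by simp
qed

definition is_local_poly :: "(real \<times> real \<Rightarrow> real) \<Rightarrow> real \<times> real \<Rightarrow> (real \<times> real \<Rightarrow> real) \<Rightarrow> bool" where
  "is_local_poly f x p \<longleftrightarrow> p \<in> bivariate_polys d \<and> (\<exists>r>0. \<forall>y\<in>ball x r. f y = p y)"

definition local_poly :: "(real \<times> real \<Rightarrow> real) \<Rightarrow> real \<times> real \<Rightarrow> real \<times> real \<Rightarrow> real" where
  "local_poly f x = (SOME p. is_local_poly f x p)"

lemma is_local_poly_unique: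
  assumes "is_local_poly f x p" "is_local_poly f x q"
  shows "p = q"
proof -
  obtain r s where rs: "r > 0" "\<forall>y\<in>ball x r. f y = p y" "s > 0" "\<forall>y\<in>ball x s. f y = q y"
    using assms unfolding is_local_poly_def by blast
  have rpf: "real_polynomial_function (\<lambda>y. p y - q y)"
    using assms unfolding is_local_poly_def by (intro real_polynomial_function_diff) (auto intro: bivariate_polys_rpf)
  have z: "p y - q y = 0" if "y \<in> ball x (min r s)" for y
  proof -
    have y: "y \<in> ball x r" "y \<in> ball x s" using that by auto
    show ?thesis using bspec[OF rs(2) y(1)] bspec[OF rs(4) y(2)] by simp
  qed
  have "min r s > 0" using rs by simp
  then have "p y - q y = 0" for y by (rule rpf_zero_on_ball[OF rpf _ z])
  then show ?thesis by (intro ext) simp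
qed

lemma is_local_poly_local_poly: "is_local_poly f x p \<Longrightarrow> local_poly f x = p"
proof -
  assume p: "is_local_poly f x p"
  show ?thesis unfolding local_poly_def by (rule is_local_poly_unique[OF someI[of "is_local_poly f x", OF p] p])
qed

lemma local_poly:
  assumes f: "f \<in> Spl" and x: "x \<in> \<Psi> - \<Union>\<Delta>"
  shows "is_local_poly f x (local_poly f x)"
proof -
  obtain \<psi> where \<psi>: "\<psi> \<in> cells \<Psi> \<Delta>" "x \<in> \<psi>" using in_cell[OF x] by blast
  obtain p where p: "p \<in> bivariate_polys d" "\<forall>y\<in>\<psi>. f y = p y" using spline_poly[OF f \<psi>(1)] by blast
  obtain r where r: "r > 0" "ball x r \<subseteq> \<psi>" using cell_props(1)[OF \<psi>(1)] \<psi>(2) by (rule openE)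
  have "is_local_poly f x p" unfolding is_local_poly_def using p r by blast
  then show ?thesis using is_local_poly_local_poly by simp
qed

lemma local_poly_value: "f \<in> Spl \<Longrightarrow> x \<in> \<Psi> - \<Union>\<Delta> \<Longrightarrow> f x = local_poly f x x"
  using local_poly[of f x] unfolding is_local_poly_def by auto

lemma local_poly_poly: "f \<in> Spl \<Longrightarrow> x \<in> \<Psi> - \<Union>\<Delta> \<Longrightarrow> local_poly f x \<in> bivariate_polys d"
  using local_poly[of f x] unfolding is_local_poly_def by auto

lemma local_poly_add:
  assumes f: "f \<in> Spl" and g: "g \<in> Spl" and x: "x \<in> \<Psi> - \<Union>\<Delta>"
  shows "local_poly (f + g) x = local_poly f x + local_poly g x"
proof (rule is_local_poly_local_poly)
  obtain r s where rs: "r > 0" "\<forall>y\<in>ball x r. f y = local_poly f x y" "s > 0" "\<forall>y\<in>ball x s. g y = local_poly g x y"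
    using local_poly[OF f x] local_poly[OF g x] unfolding is_local_poly_def by blast
  have "\<forall>y\<in>ball x (min r s). (f + g) y = (local_poly f x + local_poly g x) y" using rs by simp
  moreover have "min r s > 0" using rs by simp
  ultimately show "is_local_poly (f + g) x (local_poly f x + local_poly g x)" unfolding is_local_poly_def
    using fun_space.subspace_add[OF subspace_bivariate_polys local_poly_poly[OF f x] local_poly_poly[OF g x]]
    by (intro conjI exI[of _ "min r s"])
qed

lemma local_poly_scale:
  assumes f: "f \<in> Spl" and x: "x \<in> \<Psi> - \<Union>\<Delta>"
  shows "local_poly (smul c f) x = smul c (local_poly f x)"
proof (rule is_local_poly_local_poly)
  obtain r where r: "r > 0" "\<forall>y\<in>ball x r. f y = local_poly f x y"
    using local_poly[OF f x] unfolding is_local_poly_def by blast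
  then have "\<forall>y\<in>ball x r. c * f y = c * local_poly f x y" by simp
  then show "is_local_poly (smul c f) x (smul c (local_poly f x))" unfolding is_local_poly_def
    using fun_space.subspace_scale[OF subspace_bivariate_polys local_poly_poly[OF f x]] r(1)
    by (intro conjI exI[of _ r])
qed

lemma local_poly_loc_const:
  assumes f: "f \<in> Spl"
  shows "loc_const (\<lambda>x. local_poly f x z)"
  unfolding loc_const_def
proof
  fix x assume x: "x \<in> \<Psi> - \<Union>\<Delta>"
  obtain r where r: "r > 0" "\<forall>y\<in>ball x r. f y = local_poly f x y"
    using local_poly[OF f x] unfolding is_local_poly_def by blast
  have eq: "local_poly f y = local_poly f x" if y: "y \<in> ball x r" for y
  proof (rule is_local_poly_local_poly)
    obtain s where s: "s > 0" "ball y s \<subseteq> ball x r" using open_ball y by (rule openE)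
    then show "is_local_poly f y (local_poly f x)" unfolding is_local_poly_def using local_poly_poly[OF f x] r(2) by blast
  qed
  show "\<exists>r>0. \<forall>y\<in>ball x r. local_poly f y z = local_poly f x z"
    by (intro exI[of _ r] conjI ballI r(1) fun_cong[OF eq])
qed

definition is_probe :: "(real \<times> real) set \<Rightarrow> (real \<times> real) \<times> real \<times> (real \<times> real) \<times> (real \<times> real) \<Rightarrow> bool" where
  "is_probe e w \<longleftrightarrow> (case w of (m, r, p, q) \<Rightarrow>
     m \<in> open_segment (src e) (tgt e) \<and> r > 0 \<and> ball m r \<subseteq> \<Psi> \<and>
     (\<forall>x\<in>ball m r. x \<in> \<Union>\<Delta> \<longleftrightarrow> lf (src e) (tgt e) x = 0) \<and> p \<in> side e m r 1 \<and> q \<in> side e m r (-1))"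

definition probe :: "(real \<times> real) set \<Rightarrow> (real \<times> real) \<times> real \<times> (real \<times> real) \<times> (real \<times> real)" where
  "probe e = (SOME w. is_probe e w)"

definition probe_mid where "probe_mid e = fst (probe e)"
definition probe_rad where "probe_rad e = fst (snd (probe e))"
definition probe_pos where "probe_pos e = fst (snd (snd (probe e)))"
definition probe_neg where "probe_neg e = snd (snd (snd (probe e)))"

lemma probe:
  assumes e: "e \<in> E"
  shows "probe_mid e \<in> open_segment (src e) (tgt e)" "probe_rad e > 0" "ball (probe_mid e) (probe_rad e) \<subseteq> \<Psi>"
    "\<forall>x\<in>ball (probe_mid e) (probe_rad e). x \<in> \<Union>\<Delta> \<longleftrightarrow> lf (src e) (tgt e) x = 0"
    "probe_pos e \<in> side e (probe_mid e) (probe_rad e) 1" "probe_neg e \<in> side e (probe_mid e) (probe_rad e) (-1)"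
proof -
  obtain m where m: "m \<in> open_segment (src e) (tgt e)" using open_segment_nonempty[OF e] by blast
  obtain r where r: "r > 0" "ball m r \<subseteq> \<Psi>" "\<forall>x\<in>ball m r. x \<in> \<Union>\<Delta> \<longleftrightarrow> lf (src e) (tgt e) x = 0"
    using edge_near[OF e m] by blast
  have ne: "src e \<noteq> tgt e" using edge_ends(1) e E_sub by blast
  have l0: "lf (src e) (tgt e) m = 0" by (rule lf_closed_segment[OF open_closed_segment[OF m]])
  obtain p q where "p \<in> side e m r 1" "q \<in> side e m r (-1)"
    using lf_sides[OF ne l0 r(1)] unfolding side_def by auto
  then have "is_probe e (m, r, p, q)" unfolding is_probe_def using m r by simp
  then have "is_probe e (probe e)" unfolding probe_def by (rule someI)
  then show "probe_mid e \<in> open_segment (src e) (tgt e)" "probe_rad e > 0" "ball (probe_mid e) (probe_rad e) \<subseteq> \<Psi>"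
    "\<forall>x\<in>ball (probe_mid e) (probe_rad e). x \<in> \<Union>\<Delta> \<longleftrightarrow> lf (src e) (tgt e) x = 0"
    "probe_pos e \<in> side e (probe_mid e) (probe_rad e) 1" "probe_neg e \<in> side e (probe_mid e) (probe_rad e) (-1)"
    unfolding is_probe_def probe_mid_def probe_rad_def probe_pos_def probe_neg_def by (simp_all add: case_prod_unfold)
qed

lemma side_sub:
  assumes e: "e \<in> E" and s: "s = 1 \<or> s = -1"
  shows "side e (probe_mid e) (probe_rad e) s \<subseteq> \<Psi> - \<Union>\<Delta>"
proof
  fix x assume "x \<in> side e (probe_mid e) (probe_rad e) s"
  then have x: "x \<in> ball (probe_mid e) (probe_rad e)" "lf (src e) (tgt e) x \<noteq> 0" unfolding side_def by auto
  then show "x \<in> \<Psi> - \<Union>\<Delta>" using probe(3,4)[OF e] by blast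
qed

lemma probe_pos_in: "e \<in> E \<Longrightarrow> probe_pos e \<in> \<Psi> - \<Union>\<Delta>" and probe_neg_in: "e \<in> E \<Longrightarrow> probe_neg e \<in> \<Psi> - \<Union>\<Delta>"
  using side_sub probe(5,6) by blast+

lemma jump_probe:
  assumes u: "loc_const u" and e: "e \<in> E"
  shows "jump u e (u (probe_pos e) - u (probe_neg e))"
  by (rule jump_from_point[OF u e probe(1)[OF e] jump_at_values[OF u probe(2-6)[OF e]]])

definition jump_map :: "(real \<times> real \<Rightarrow> real) \<Rightarrow> (real \<times> real) set \<times> (real \<times> real) \<Rightarrow> real" where
  "jump_map f = (\<lambda>(e, z). if e \<in> E then local_poly f (probe_pos e) z - local_poly f (probe_neg e) z else 0)"

abbreviation "Edat \<equiv> fam_space E (\<lambda>e. line_polys (Suc \<mu>) (d - Suc \<mu>) (src e) (tgt e))"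

definition Ker :: "((real \<times> real) set \<times> (real \<times> real) \<Rightarrow> real) set" where
  "Ker = {h \<in> Edat. \<forall>A\<in>V. \<forall>z. vsum (\<lambda>e. h (e, z)) A = 0}"

lemma jump_map_add: "f \<in> Spl \<Longrightarrow> g \<in> Spl \<Longrightarrow> jump_map (f + g) = jump_map f + jump_map g"
  by (auto simp: fun_eq_iff jump_map_def local_poly_add[OF _ _ probe_pos_in] local_poly_add[OF _ _ probe_neg_in])

lemma jump_map_scale: "f \<in> Spl \<Longrightarrow> jump_map (smul c f) = smul c (jump_map f)"
  by (auto simp: fun_eq_iff jump_map_def local_poly_scale[OF _ probe_pos_in] local_poly_scale[OF _ probe_neg_in] algebra_simps)

lemma jump_map_jump:
  assumes f: "f \<in> Spl" and e: "e \<in> E"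
  shows "jump (\<lambda>x. local_poly f x z) e (jump_map f (e, z))"
  using jump_probe[OF local_poly_loc_const[OF f] e, of z] e by (simp add: jump_map_def)

lemma closure_side:
  assumes e: "e \<in> E" and y: "y \<in> ball (probe_mid e) (probe_rad e)" and l: "lf (src e) (tgt e) y = 0"
  shows "y \<in> closure (side e (probe_mid e) (probe_rad e) 1)" "y \<in> closure (side e (probe_mid e) (probe_rad e) (-1))"
proof -
  have ne: "src e \<noteq> tgt e" using edge_ends(1) e E_sub by blast
  obtain r where r: "r > 0" "ball y r \<subseteq> ball (probe_mid e) (probe_rad e)" using open_ball y by (rule openE)
  have *: "\<exists>x\<in>side e (probe_mid e) (probe_rad e) s. dist x y < \<epsilon>" if \<epsilon>: "\<epsilon> > 0" and s: "s = 1 \<or> s = -1" for \<epsilon> s :: real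
  proof -
    have m: "min r \<epsilon> > 0" using r \<epsilon> by simp
    obtain x where "x \<in> ball y (min r \<epsilon>)" "s * lf (src e) (tgt e) x > 0"
      using lf_sides[OF ne l m] s by auto
    moreover have "x \<in> ball (probe_mid e) (probe_rad e)" using calculation(1) by (intro subsetD[OF r(2)]) simp
    ultimately have "x \<in> side e (probe_mid e) (probe_rad e) s" "dist x y < \<epsilon>" unfolding side_def by (simp_all add: dist_commute)
    then show ?thesis by blast
  qed
  show "y \<in> closure (side e (probe_mid e) (probe_rad e) 1)" "y \<in> closure (side e (probe_mid e) (probe_rad e) (-1))"
    unfolding closure_approachable using * by simp_all
qed

lemma local_poly_side:
  assumes f: "f \<in> Spl" and e: "e \<in> E" and s: "s = 1 \<or> s = -1"
    and xy: "x \<in> side e (probe_mid e) (probe_rad e) s" "y \<in> side e (probe_mid e) (probe_rad e) s"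
  shows "f y = local_poly f x y"
proof -
  have sub: "side e (probe_mid e) (probe_rad e) s \<subseteq> \<Psi> - \<Union>\<Delta>" by (rule side_sub[OF e s])
  have "local_poly f y y = local_poly f x y"
    by (rule loc_const_constant[OF local_poly_loc_const[OF f] convex_connected[OF convex_side[OF s]] sub xy(2,1)])
  then show ?thesis using local_poly_value[OF f subsetD[OF sub xy(2)]] by simp
qed

lemma jump_map_in_Ker:
  assumes f: "f \<in> Spl"
  shows "jump_map f \<in> Ker"
proof -
  have line: "(\<lambda>z. jump_map f (e, z)) \<in> line_polys (Suc \<mu>) (d - Suc \<mu>) (src e) (tgt e)" if e: "e \<in> E" for e
  proof -
    let ?g = "\<lambda>z. local_poly f (probe_pos e) z - local_poly f (probe_neg e) z"
    have P: "local_poly f (probe_pos e) \<in> bivariate_polys d" "local_poly f (probe_neg e) \<in> bivariate_polys d"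
      using local_poly_poly[OF f] probe_pos_in[OF e] probe_neg_in[OF e] by auto
    have g: "?g \<in> bivariate_polys d"
      using fun_space.subspace_diff[OF subspace_bivariate_polys P] by (simp add: fun_diff_def)
    have ne: "src e \<noteq> tgt e" using edge_ends(1) e E_sub by blast
    have l0: "lf (src e) (tgt e) (probe_mid e) = 0" by (rule lf_closed_segment[OF open_closed_segment[OF probe(1)[OF e]]])
    define \<epsilon> where "\<epsilon> = probe_rad e / norm (tgt e - src e)"
    have \<epsilon>: "\<epsilon> > 0" using probe(2)[OF e] ne by (simp add: \<epsilon>_def)
    have flat: "flat \<mu> ?g (probe_mid e + s *\<^sub>R (tgt e - src e))" if s: "\<bar>s\<bar> < \<epsilon>" for s
    proof -
      let ?y = "probe_mid e + s *\<^sub>R (tgt e - src e)"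
      have "\<bar>s\<bar> * norm (tgt e - src e) < probe_rad e" using s ne by (simp add: \<epsilon>_def pos_less_divide_eq)
      then have y: "?y \<in> ball (probe_mid e) (probe_rad e)" by (simp add: dist_norm)
      have l: "lf (src e) (tgt e) ?y = 0"
        using l0 by (simp add: lf_def algebra_simps)
      have s1: "(1::real) = 1 \<or> (1::real) = -1" and s2: "(-1::real) = 1 \<or> (-1::real) = -1" by auto
      show ?thesis
      proof (rule C_on_imp_flat[OF open_dom _ spline_C_on[OF f] open_side _ closure_side(1)[OF e y l] _
            open_side _ closure_side(2)[OF e y l] _ bivariate_polys_rpf[OF P(1)] bivariate_polys_rpf[OF P(2)]])
        show "?y \<in> \<Psi>" using y probe(3)[OF e] by blast
        show "side e (probe_mid e) (probe_rad e) 1 \<subseteq> \<Psi>" "side e (probe_mid e) (probe_rad e) (-1) \<subseteq> \<Psi>"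
          using side_sub[OF e] by blast+
        show "f y = local_poly f (probe_pos e) y" if "y \<in> side e (probe_mid e) (probe_rad e) 1" for y
          by (rule local_poly_side[OF f e s1 probe(5)[OF e] that])
        show "f y = local_poly f (probe_neg e) y" if "y \<in> side e (probe_mid e) (probe_rad e) (-1)" for y
          by (rule local_poly_side[OF f e s2 probe(6)[OF e] that])
      qed
    qed
    obtain q where "q \<in> bivariate_polys (d - Suc \<mu>)" "?g = (\<lambda>z. lf (src e) (tgt e) z ^ Suc \<mu> * q z)"
      using flat_divisible[OF g ne l0 \<epsilon> flat \<mu>d] by blast
    then have "?g \<in> line_polys (Suc \<mu>) (d - Suc \<mu>) (src e) (tgt e)" unfolding line_polys_def
      by (intro image_eqI[where x = q])
    then show ?thesis using e by (simp add: jump_map_def)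
  qed
  have "vsum (\<lambda>e. jump_map f (e, z)) A = 0" if "A \<in> V" for A z
    by (rule vsum_zero[OF local_poly_loc_const[OF f] jump_map_jump[OF f] that])
  moreover have "jump_map f \<in> Edat" unfolding fam_space_def using line by (simp add: jump_map_def)
  ultimately show ?thesis unfolding Ker_def by simp
qed

lemma closure_dense: "x \<in> \<Psi> \<Longrightarrow> x \<in> closure (\<Psi> - \<Union>\<Delta>)"
  using cells_cover[of x] cell_props(3) closure_mono by blast

definition restr :: "(real \<times> real \<Rightarrow> real) \<Rightarrow> real \<times> real \<Rightarrow> real" where
  "restr p = (\<lambda>x. if x \<in> \<Psi> then p x else 0)"

lemma restr_spline:
  assumes p: "p \<in> bivariate_polys d"
  shows "restr p \<in> Spl"
proof -
  have rpf: "real_polynomial_function p" by (rule bivariate_polys_rpf[OF p])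
  have z: "flat k (\<lambda>z. 0 :: real) x" for k and x :: "real \<times> real"
    by (induction k) (simp_all add: pd_eqI[where p' = "\<lambda>x v. 0"])
  have "C_on \<mu> \<Psi> (restr p)"
    by (rule C_on_glue[where I = "{()}" and C = "\<lambda>_. UNIV" and p = "\<lambda>_. p"])
      (simp_all add: open_dom rpf restr_def z)
  moreover have "\<exists>q\<in>bivariate_polys d. \<forall>x\<in>\<psi>. restr p x = q x" if "\<psi> \<in> cells \<Psi> \<Delta>" for \<psi>
    using cell_props(3)[OF that] by (intro bexI[OF _ p]) (auto simp: restr_def)
  ultimately show ?thesis unfolding spline_space_def by (simp add: restr_def)
qed

lemma local_poly_restr:
  assumes p: "p \<in> bivariate_polys d" and x: "x \<in> \<Psi>"
  shows "local_poly (restr p) x = p"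
proof (rule is_local_poly_local_poly)
  obtain r where r: "r > 0" "ball x r \<subseteq> \<Psi>" using open_dom x by (rule openE)
  then have "\<forall>y\<in>ball x r. restr p y = p y" by (auto simp: restr_def)
  then show "is_local_poly (restr p) x p" unfolding is_local_poly_def using p r(1) by blast
qed

lemma jump_map_kernel: "{f \<in> Spl. jump_map f = 0} = restr ` bivariate_polys d"
proof
  show "restr ` bivariate_polys d \<subseteq> {f \<in> Spl. jump_map f = 0}"
  proof
    fix f assume "f \<in> restr ` bivariate_polys d"
    then obtain p where p: "p \<in> bivariate_polys d" "f = restr p" by blast
    have "jump_map f (e, z) = 0" for e z
      using local_poly_restr[OF p(1)] probe_pos_in[of e] probe_neg_in[of e] by (simp add: jump_map_def p(2))
    then have "jump_map f = 0" by (intro ext) (auto simp: zero_fun_def)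
    then show "f \<in> {f \<in> Spl. jump_map f = 0}" using restr_spline[OF p(1)] p(2) by simp
  qed
  show "{f \<in> Spl. jump_map f = 0} \<subseteq> restr ` bivariate_polys d"
  proof
    fix f assume "f \<in> {f \<in> Spl. jump_map f = 0}"
    then have f: "f \<in> Spl" and J0: "jump_map f = 0" by auto
    have "\<Psi> \<noteq> {}" using rp unfolding rectilinear_partition_def by (elim conjE)
    then obtain x0 where x0: "x0 \<in> \<Psi> - \<Union>\<Delta>" using complement_dense[OF open_UNIV] by auto
    have j0: "jump (\<lambda>x. local_poly f x z) e 0" if "e \<in> E" for e z
      using jump_map_jump[OF f that, of z] by (simp add: J0)
    have eq: "f x = local_poly f x0 x" if "x \<in> \<Psi> - \<Union>\<Delta>" for x
      using local_poly_value[OF f that] loc_const_no_jumps_constant[OF local_poly_loc_const[OF f] j0 that x0, of x] by simp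
    note p = local_poly_poly[OF f x0]
    have "f x = local_poly f x0 x" if x: "x \<in> \<Psi>" for x
    proof (rule continuous_eq_on_closure[OF _ _ closure_dense[OF x] eq])
      show "isCont f x" using C_on_continuous[OF spline_C_on[OF f]] open_dom x
        by (simp add: continuous_on_eq_continuous_at)
      show "isCont (local_poly f x0) x" by (rule rpf_isCont[OF bivariate_polys_rpf[OF p]])
    qed
    then have "f = restr (local_poly f x0)" using spline_zero[OF f] by (intro ext) (simp add: restr_def)
    then show "f \<in> restr ` bivariate_polys d" using p by (rule image_eqI)
  qed
qed

lemma has_dim_jump_map_kernel: "has_dim {f \<in> Spl. jump_map f = 0} (d + 2 choose 2)"
  unfolding jump_map_kernel
proof (rule has_dim_linear_image[OF has_dim_bivariate_polys])
  fix p assume p: "p \<in> bivariate_polys d" and 0: "restr p = 0"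
  have "p x = 0" if "x \<in> \<Psi>" for x using fun_cong[OF 0, of x] that by (simp add: restr_def)
  moreover have "\<Psi> \<noteq> {}" using rp unfolding rectilinear_partition_def by (elim conjE)
  ultimately show "p = 0" by (intro rpf_zero_on_open[OF bivariate_polys_rpf[OF p] open_dom])
qed (auto simp: restr_def fun_eq_iff)

lemma Ker_subset_jump_map:
  assumes h: "h \<in> Ker"
  shows "h \<in> jump_map ` Spl"
proof -
  have hE: "h \<in> Edat" and vs: "\<And>A z. A \<in> V \<Longrightarrow> vsum (\<lambda>e. h (e, z)) A = 0"
    using h unfolding Ker_def by auto
  have hline: "(\<lambda>z. h (e, z)) \<in> line_polys (Suc \<mu>) (d - Suc \<mu>) (src e) (tgt e)" if "e \<in> E" for e
    using hE that unfolding fam_space_def by simp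
  have hP: "(\<lambda>z. h (e, z)) \<in> bivariate_polys d" if "e \<in> E" for e
    using hline[OF that] line_polys_subset[of "Suc \<mu>" d "src e" "tgt e"] \<mu>d by auto
  have hflat: "flat \<mu> (\<lambda>z. h (e, z)) x" if e: "e \<in> E" "x \<in> e" for e x
  proof -
    have "x \<in> closed_segment (src e) (tgt e)" using edge_ends(2)[of e] e E_sub by auto
    then have l: "lf (src e) (tgt e) x = 0" by (rule lf_closed_segment)
    obtain q where q: "q \<in> bivariate_polys (d - Suc \<mu>)" "(\<lambda>z. h (e, z)) = (\<lambda>z. lf (src e) (tgt e) z ^ Suc \<mu> * q z)"
      using hline[OF e(1)] unfolding line_polys_def by blast
    show ?thesis unfolding q(2) by (rule flat_power_mult[OF lf_rpf l bivariate_polys_rpf[OF q(1)]])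
  qed
  define c where "c y = (\<lambda>z. \<Sum>e\<in>E. h (e, z) * edge_omega e y)" for y
  define f where "f x = (if x \<in> \<Psi> then c x x else 0)" for x
  have clc: "loc_const (\<lambda>y. c y z)" for z unfolding c_def by (rule sum_edge_omega_loc_const[OF vs])
  have cP: "c y \<in> bivariate_polys d" for y
  proof -
    have "c y = (\<Sum>e\<in>E. smul (edge_omega e y) (\<lambda>z. h (e, z)))"
      unfolding c_def by (intro ext) (simp add: sum_fun_apply mult.commute)
    also have "\<dots> \<in> bivariate_polys d"
      by (intro fun_space.subspace_sum[OF subspace_bivariate_polys] fun_space.subspace_scale[OF subspace_bivariate_polys] hP)
    finally show ?thesis .
  qed
  have ccell: "c y = c x" if "\<psi> \<in> cells \<Psi> \<Delta>" "x \<in> \<psi>" "y \<in> \<psi>" for \<psi> x y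
    by (intro ext) (rule loc_const_constant[OF clc cell_props(2)[OF that(1)] cell_props(3)[OF that(1)] that(3,2)])
  define yc where "yc \<psi> = (SOME y. y \<in> \<psi>)" for \<psi> :: "(real \<times> real) set"
  have yc: "yc \<psi> \<in> \<psi>" if "\<psi> \<in> cells \<Psi> \<Delta>" for \<psi>
    using cell_props(4)[OF that] unfolding yc_def ex_in_conv[symmetric] by (rule someI_ex)
  have edge_omega_lim: "(\<lambda>n. edge_omega e (s n)) \<longlonglongrightarrow> edge_omega e x" if "x \<in> \<Psi>" "e \<in> E" "x \<notin> e" "s \<longlonglongrightarrow> x" for e x s
    by (rule isCont_tendsto_compose[OF continuous_edge_omega[OF that(1-3)] that(4)])
  have fval: "f x = c (yc \<psi>) x" if \<psi>: "\<psi> \<in> cells \<Psi> \<Delta>" and x: "x \<in> \<Psi>" "x \<in> closure \<psi>" for \<psi> x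
  proof -
    obtain s where s: "\<And>n::nat. s n \<in> \<psi>" "s \<longlonglongrightarrow> x" using x(2) unfolding closure_sequential by blast
    have "(\<lambda>n. c (s n) x) \<longlonglongrightarrow> c x x" unfolding c_def
    proof (rule tendsto_sum)
      fix e assume e: "e \<in> E"
      show "(\<lambda>n. h (e, x) * edge_omega e (s n)) \<longlonglongrightarrow> h (e, x) * edge_omega e x"
      proof (cases "x \<in> e")
        case True
        then have "h (e, x) = 0" using flat_zero[OF hflat[OF e]] by simp
        then show ?thesis by simp
      next
        case False
        show ?thesis by (intro tendsto_mult_left edge_omega_lim x(1) e False s(2))
      qed
    qed
    moreover have "(\<lambda>n. c (s n) x) = (\<lambda>n. c (yc \<psi>) x)"
      by (intro ext fun_cong[OF ccell[OF \<psi> yc[OF \<psi>] s(1)]])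
    ultimately have "c x x = c (yc \<psi>) x" using LIMSEQ_unique tendsto_const by metis
    then show ?thesis using x(1) by (simp add: f_def)
  qed
  have "C_on \<mu> \<Psi> f"
  proof (rule C_on_glue[where I = "cells \<Psi> \<Delta>" and C = closure and p = "\<lambda>\<psi>. c (yc \<psi>)"])
    show "finite (cells \<Psi> \<Delta>)" by (rule finite_cells)
    show "open \<Psi>" by (rule open_dom)
    show "\<exists>\<psi>\<in>cells \<Psi> \<Delta>. x \<in> closure \<psi>" if "x \<in> \<Psi>" for x by (rule cells_cover[OF that])
    show "real_polynomial_function (c (yc \<psi>))" for \<psi> by (rule bivariate_polys_rpf[OF cP])
    show "f x = c (yc \<psi>) x" if "\<psi> \<in> cells \<Psi> \<Delta>" "x \<in> \<Psi>" "x \<in> closure \<psi>" for \<psi> x by (rule fval[OF that])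
    fix \<psi> \<psi>' x assume \<psi>: "\<psi> \<in> cells \<Psi> \<Delta>" "\<psi>' \<in> cells \<Psi> \<Delta>" and x: "x \<in> \<Psi>" "x \<in> closure \<psi>" "x \<in> closure \<psi>'"
    obtain s where s: "\<And>n::nat. s n \<in> \<psi>" "s \<longlonglongrightarrow> x" using x(2) unfolding closure_sequential by blast
    obtain t where t: "\<And>n::nat. t n \<in> \<psi>'" "t \<longlonglongrightarrow> x" using x(3) unfolding closure_sequential by blast
    show "flat \<mu> (\<lambda>z. c (yc \<psi>) z - c (yc \<psi>') z) x"
    proof (rule flat_limit[OF finite_E, where h = "\<lambda>e z. h (e, z)" and a = "\<lambda>n e. edge_omega e (s n) - edge_omega e (t n)"])
      show "real_polynomial_function (\<lambda>z. h (e, z))" if "e \<in> E" for e by (rule bivariate_polys_rpf[OF hP[OF that]])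
      show "(\<lambda>z. c (yc \<psi>) z - c (yc \<psi>') z) = (\<lambda>z. \<Sum>e\<in>E. (edge_omega e (s n) - edge_omega e (t n)) * h (e, z))" for n
      proof -
        have 1: "c (yc \<psi>) = c (s n)" by (rule ccell[OF \<psi>(1) s(1) yc[OF \<psi>(1)]])
        have 2: "c (yc \<psi>') = c (t n)" by (rule ccell[OF \<psi>(2) t(1) yc[OF \<psi>(2)]])
        show ?thesis unfolding 1 2
          unfolding c_def by (simp only: sum_subtractf[symmetric] left_diff_distrib right_diff_distrib mult.commute)
      qed
      show "flat \<mu> (\<lambda>z. h (e, z)) x \<or> (\<lambda>n. edge_omega e (s n) - edge_omega e (t n)) \<longlonglongrightarrow> 0" if e: "e \<in> E" for e
      proof (cases "x \<in> e")
        case True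
        then show ?thesis using hflat[OF e] by simp
      next
        case False
        have "(\<lambda>n. edge_omega e (s n) - edge_omega e (t n)) \<longlonglongrightarrow> edge_omega e x - edge_omega e x"
          by (intro tendsto_diff edge_omega_lim x(1) e False s(2) t(2))
        then show ?thesis by simp
      qed
    qed
  qed simp
  moreover have "\<exists>p\<in>bivariate_polys d. \<forall>x\<in>\<psi>. f x = p x" if \<psi>: "\<psi> \<in> cells \<Psi> \<Delta>" for \<psi>
  proof (rule bexI[OF _ cP[of "yc \<psi>"]], rule ballI)
    fix x assume x: "x \<in> \<psi>"
    then have "x \<in> \<Psi>" "x \<in> closure \<psi>" using cell_props(3)[OF \<psi>] closure_subset[of \<psi>] by blast+
    then show "f x = c (yc \<psi>) x" by (rule fval[OF \<psi>])
  qed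
  ultimately have fS: "f \<in> Spl" unfolding spline_space_def by (simp add: f_def)
  have locf: "local_poly f x = c x" if x: "x \<in> \<Psi> - \<Union>\<Delta>" for x
  proof (rule is_local_poly_local_poly)
    obtain \<psi> where \<psi>: "\<psi> \<in> cells \<Psi> \<Delta>" "x \<in> \<psi>" using in_cell[OF x] by blast
    obtain r where r: "r > 0" "ball x r \<subseteq> \<psi>" using cell_props(1)[OF \<psi>(1)] \<psi>(2) by (rule openE)
    have "f y = c x y" if "y \<in> ball x r" for y
    proof -
      have y: "y \<in> \<psi>" using r(2) that by blast
      then have "y \<in> \<Psi>" using cell_props(3)[OF \<psi>(1)] by blast
      then show ?thesis unfolding f_def by (simp add: ccell[OF \<psi> y])
    qed
    then show "is_local_poly f x (c x)" unfolding is_local_poly_def using cP r(1) by blast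
  qed
  have "jump_map f (e, z) = h (e, z)" for e z
  proof (cases "e \<in> E")
    case True
    have 1: "jump (\<lambda>y. c y z) e (h (e, z))" unfolding c_def by (rule sum_edge_omega_jump[OF vs True])
    have "c (probe_pos e) z - c (probe_neg e) z = h (e, z)"
      by (rule jump_unique[OF True jump_probe[OF clc True] 1])
    then show ?thesis using True locf[OF probe_pos_in[OF True]] locf[OF probe_neg_in[OF True]] by (simp add: jump_map_def)
  next
    case False
    then have "h (e, z) = 0" using hE unfolding fam_space_def by blast
    then show ?thesis using False by (simp add: jump_map_def)
  qed
  then have "h = jump_map f" by (intro ext) auto
  then show ?thesis using fS by (rule image_eqI)
qed

lemma jump_map_image: "jump_map ` Spl = Ker"
  using jump_map_in_Ker Ker_subset_jump_map by (intro equalityI subsetI) auto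

lemma has_dim_spline_space:
  assumes "has_dim Ker k"
  shows "has_dim Spl ((d + 2 choose 2) + k)"
  by (rule rank_nullity_on[OF subspace_Spl jump_map_add jump_map_scale has_dim_jump_map_kernel]) (use assms jump_map_image in simp_all)

end

section \<open>Reaching all vertex conditions\<close>

lemma affine_hull_segment_eq:
  fixes a b :: "real \<times> real"
  assumes "a \<noteq> b"
  shows "affine hull (closed_segment a b) = {z. lf a b z = 0}"
proof -
  have "affine hull (closed_segment a b) = affine hull {a, b}"
    by (simp add: segment_convex_hull affine_hull_convex_hull)
  also have "\<dots> = {z. lf a b z = 0}"
  proof (intro equalityI subsetI)
    fix z assume "z \<in> affine hull {a, b}"
    then obtain u v where "z = u *\<^sub>R a + v *\<^sub>R b" "u + v = 1" unfolding affine_hull_2 by blast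
    then show "z \<in> {z. lf a b z = 0}" using lf_affine[of u v a b a b] by simp
  next
    fix z assume "z \<in> {z. lf a b z = 0}"
    then obtain s where "z = a + s *\<^sub>R (b - a)" using lf_zero_imp_on_line[OF assms] by blast
    then have "z = (1 - s) *\<^sub>R a + s *\<^sub>R b" by (simp add: algebra_simps)
    then have "\<exists>u v. z = u *\<^sub>R a + v *\<^sub>R b \<and> u + v = 1" by (intro exI[of _ "1 - s"] exI[of _ s]) simp
    then show "z \<in> affine hull {a, b}" unfolding affine_hull_2 by blast
  qed
  finally show ?thesis .
qed

definition pt :: "real \<times> real \<Rightarrow> real \<times> real \<Rightarrow> real \<Rightarrow> real \<times> real" where
  "pt p q s = p + s *\<^sub>R (q - p)"

lemma lf_pt: "lf (pt p q s) (pt p q t) z = (t - s) * lf p q z"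
  by (simp add: lf_def pt_def algebra_simps)

lemma pt_inj: "p \<noteq> q \<Longrightarrow> pt p q s = pt p q t \<longleftrightarrow> s = t"
  by (simp add: pt_def)

lemma pt_segment: "x \<in> closed_segment p q \<longleftrightarrow> (\<exists>s. 0 \<le> s \<and> s \<le> 1 \<and> x = pt p q s)"
  unfolding in_segment pt_def by (simp add: algebra_simps conj_ac)

lemma pt_pt: "pt (pt p q s) (pt p q t) u = pt p q (s + u * (t - s))"
  by (simp add: pt_def algebra_simps)

lemma pt_in_closed_segment:
  assumes "p \<noteq> q" "s < t"
  shows "pt p q u \<in> closed_segment (pt p q s) (pt p q t) \<longleftrightarrow> s \<le> u \<and> u \<le> t"
proof
  assume "pt p q u \<in> closed_segment (pt p q s) (pt p q t)"
  then obtain v where v: "0 \<le> v" "v \<le> 1" "u = s + v * (t - s)"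
    unfolding pt_segment pt_pt pt_inj[OF assms(1)] by blast
  have "v * (t - s) \<le> 1 * (t - s)" using v assms by (intro mult_right_mono) auto
  moreover have "0 \<le> v * (t - s)" using v assms by simp
  ultimately show "s \<le> u \<and> u \<le> t" unfolding v(3) by simp
next
  assume "s \<le> u \<and> u \<le> t"
  then have "0 \<le> (u - s) / (t - s)" "(u - s) / (t - s) \<le> 1" "u = s + (u - s) / (t - s) * (t - s)"
    using assms(2) by auto
  then show "pt p q u \<in> closed_segment (pt p q s) (pt p q t)"
    unfolding pt_segment pt_pt pt_inj[OF assms(1)] by blast
qed

lemma pt_in_open_segment:
  assumes "p \<noteq> q" "s < u" "u < t"
  shows "pt p q u \<in> open_segment (pt p q s) (pt p q t)"
  using pt_in_closed_segment[OF assms(1), of s t u] assms pt_inj[OF assms(1)]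
  by (auto simp: open_segment_def)

lemma line_polys_pt:
  assumes "s \<noteq> t"
  shows "line_polys m r p q \<subseteq> line_polys m r (pt p q s) (pt p q t)"
proof
  fix g assume "g \<in> line_polys m r p q"
  then obtain h where h: "h \<in> bivariate_polys r" "g = (\<lambda>z. lf p q z ^ m * h z)" unfolding line_polys_def by blast
  have "g = (\<lambda>z. lf (pt p q s) (pt p q t) z ^ m * ((1 / (t - s) ^ m) * h z))"
    unfolding h(2) lf_pt using assms by (simp add: power_mult_distrib)
  then show "g \<in> line_polys m r (pt p q s) (pt p q t)"
    unfolding line_polys_def
    using fun_space.subspace_scale[OF subspace_bivariate_polys h(1), of "1 / (t - s) ^ m"]
    by (rule image_eqI)
qed

context spline_setup
begin

definition vertex_map :: "((real \<times> real) set \<times> (real \<times> real) \<Rightarrow> real) \<Rightarrow> (real \<times> real) \<times> (real \<times> real) \<Rightarrow> real" where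
  "vertex_map h = (\<lambda>(A, z). if A \<in> V then vsum (\<lambda>e. h (e, z)) A else 0)"

abbreviation "Vdat \<equiv> fam_space V (\<lambda>A. ctr_polys (Suc \<mu>) d A)"

definition delta :: "real \<times> real \<Rightarrow> (real \<times> real \<Rightarrow> real) \<Rightarrow> (real \<times> real) \<times> (real \<times> real) \<Rightarrow> real" where
  "delta A g = (\<lambda>(B, z). if B = A then g z else 0)"

definition single :: "(real \<times> real) set \<Rightarrow> (real \<times> real \<Rightarrow> real) \<Rightarrow> (real \<times> real) set \<times> (real \<times> real) \<Rightarrow> real" where
  "single e g = (\<lambda>(e', z). if e' = e then g z else 0)"

lemma subspace_line_polys: "fun_space.subspace (line_polys m r a b)"
  unfolding line_polys_def by (rule subspace_mult_image[OF subspace_bivariate_polys])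

lemma subspace_Edat: "fun_space.subspace Edat"
  by (rule subspace_fam_space) (rule subspace_line_polys)

lemma vertex_map_add: "vertex_map (h + k) = vertex_map h + vertex_map k"
  unfolding vertex_map_def vsum_def by (auto simp: fun_eq_iff sum.distrib distrib_right)

lemma vertex_map_scale: "vertex_map (smul c h) = smul c (vertex_map h)"
  unfolding vertex_map_def vsum_def by (auto simp: fun_eq_iff sum_distrib_left mult.assoc)

lemma subspace_vertex_map: "fun_space.subspace (vertex_map ` Edat)"
  by (rule subspace_image_on[OF subspace_Edat vertex_map_add vertex_map_scale])

lemma vertex_map_single:
  assumes e: "e \<in> E"
  shows "vertex_map (single e g) (B, z) = (if B \<in> V then g z * (of_bool (src e = B) - of_bool (tgt e = B)) else 0)"
proof -
  have "(\<Sum>e'\<in>E. single e g (e', z) * (of_bool (src e' = B) - of_bool (tgt e' = B)))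
    = (\<Sum>e'\<in>E. if e' = e then g z * (of_bool (src e = B) - of_bool (tgt e = B)) else 0)"
    by (rule sum.cong) (auto simp: single_def)
  also have "\<dots> = g z * (of_bool (src e = B) - of_bool (tgt e = B))"
    using finite_E e by (simp only: sum.delta if_True)
  finally show ?thesis unfolding vertex_map_def vsum_def by simp
qed

lemma single_in_Edat:
  assumes "g \<in> line_polys (Suc \<mu>) (d - Suc \<mu>) (src e) (tgt e)" "e \<in> E"
  shows "single e g \<in> Edat"
proof -
  have "(\<lambda>z. single e g (e', z)) \<in> line_polys (Suc \<mu>) (d - Suc \<mu>) (src e') (tgt e')" for e'
    using assms(1) fun_space.subspace_0[OF subspace_line_polys]
    by (cases "e' = e") (simp_all add: single_def zero_fun_def)
  then show ?thesis unfolding fam_space_def using assms(2) by (auto simp: single_def)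
qed

lemma delta_step:
  assumes e: "e \<in> E" and ends: "{src e, tgt e} = {C, b}" "C \<noteq> b" and C: "C \<in> V"
    and g: "g \<in> line_polys (Suc \<mu>) (d - Suc \<mu>) (src e) (tgt e)"
    and b: "b \<in> V \<Longrightarrow> delta b g \<in> vertex_map ` Edat"
  shows "delta C g \<in> vertex_map ` Edat"
proof -
  define \<sigma> :: real where "\<sigma> = (if src e = C then 1 else -1)"
  have \<sigma>: "\<sigma> * \<sigma> = 1" by (simp add: \<sigma>_def)
  have sb: "of_bool (src e = B) - of_bool (tgt e = B) = \<sigma> * (of_bool (B = C) - of_bool (B = b))" for B
    using ends unfolding doubleton_eq_iff by (auto simp: \<sigma>_def)
  have Ts: "smul \<sigma> (vertex_map (single e g)) \<in> vertex_map ` Edat"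
    by (intro fun_space.subspace_scale[OF subspace_vertex_map] imageI single_in_Edat g e)
  have "delta C g = smul \<sigma> (vertex_map (single e g)) + (if b \<in> V then delta b g else 0)"
  proof (rule ext, clarify)
    fix B z
    have k: "\<sigma> * (g z * (\<sigma> * k)) = g z * k" for k
    proof -
      have "\<sigma> * (g z * (\<sigma> * k)) = (\<sigma> * \<sigma>) * (g z * k)" by (simp only: mult_ac)
      then show ?thesis unfolding \<sigma> by simp
    qed
    have 1: "\<sigma> * vertex_map (single e g) (B, z) = (if B \<in> V then g z * (of_bool (B = C) - of_bool (B = b)) else 0)"
      unfolding vertex_map_single[OF e] sb by (cases "B \<in> V") (simp_all only: if_True if_False k mult_zero_right)
    show "delta C g (B, z) = (smul \<sigma> (vertex_map (single e g)) + (if b \<in> V then delta b g else 0)) (B, z)"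
      unfolding plus_fun_apply 1 using C ends(2) by (auto simp: delta_def)
  qed
  moreover have "(if b \<in> V then delta b g else 0) \<in> vertex_map ` Edat"
    using b fun_space.subspace_0[OF subspace_vertex_map] by simp
  ultimately show ?thesis using fun_space.subspace_add[OF subspace_vertex_map Ts] by (simp only:)
qed

lemma next_edge:
  assumes pq: "p \<noteq> q" and F: "F \<subseteq> E" "closed_segment p q = \<Union>F" and c: "0 \<le> c" "c < 1"
    and C: "pt p q c \<in> vertices \<Delta>"
  shows "\<exists>e\<in>F. \<exists>t. c < t \<and> t \<le> 1 \<and> {src e, tgt e} = {pt p q c, pt p q t}
    \<and> (\<exists>s1 s2. src e = pt p q s1 \<and> tgt e = pt p q s2)"
proof -
  define D where "D = {s. s > c \<and> pt p q s \<in> vertices \<Delta>}"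
  have inj: "inj_on (pt p q) D" by (rule inj_onI) (simp add: pt_inj[OF pq])
  have "pt p q ` D \<subseteq> vertices \<Delta>" unfolding D_def by blast
  then have finD: "finite D" using finite_vertices inj finite_imageD finite_subset by metis
  define m where "m = Min (insert 1 D)"
  have m: "c < m" "m \<le> 1" "\<And>s. s \<in> D \<Longrightarrow> m \<le> s"
    using finD c by (auto simp: m_def D_def)
  define y where "y = (c + m) / 2"
  have y: "c < y" "y < m" "0 \<le> y" "y \<le> 1" using m c by (auto simp: y_def)
  have "pt p q y \<in> closed_segment p q" unfolding pt_segment using y by blast
  then obtain e where e: "e \<in> F" "pt p q y \<in> e" using F(2) by blast
  have eE: "e \<in> E" "e \<in> \<Delta>" using e F(1) E_sub by auto
  note ends = edge_ends[OF eE(2)]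
  have "closed_segment (src e) (tgt e) \<subseteq> closed_segment p q" unfolding ends(2) F(2) using e(1) by blast
  then have "src e \<in> closed_segment p q" "tgt e \<in> closed_segment p q" by auto
  then obtain s1 s2 where s: "src e = pt p q s1" "tgt e = pt p q s2" "0 \<le> s1" "s1 \<le> 1" "0 \<le> s2" "s2 \<le> 1"
    unfolding pt_segment by blast
  define lo hi where "lo = min s1 s2" and "hi = max s1 s2"
  have "s1 \<noteq> s2" using ends(1) s by auto
  then have lohi: "lo < hi" by (auto simp: lo_def hi_def)
  have ee: "{src e, tgt e} = {pt p q lo, pt p q hi}" unfolding s lo_def hi_def by (auto simp: min_def max_def)
  have "closed_segment (pt p q lo) (pt p q hi) = closed_segment (src e) (tgt e)"
    unfolding closed_segment_eq by (rule ee[symmetric])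
  then have cs: "closed_segment (pt p q lo) (pt p q hi) = e" unfolding ends(2) .
  have os: "open_segment (pt p q lo) (pt p q hi) \<inter> vertices \<Delta> = {}"
    using ends(3) ee cs ends(2) unfolding open_segment_def by simp
  have "lo \<le> y \<and> y \<le> hi" using e(2) unfolding cs[symmetric] pt_in_closed_segment[OF pq lohi] .
  have vs: "pt p q lo \<in> vertices \<Delta>" "pt p q hi \<in> vertices \<Delta>"
    using ends_in_vertices[OF eE(2)] ee by (auto simp: doubleton_eq_iff)
  have "y \<notin> D" using m(3) y(2) by force
  then have yv: "pt p q y \<notin> vertices \<Delta>" using y(1) by (simp add: D_def)
  have "lo \<noteq> y" "hi \<noteq> y" using vs yv by auto
  then have loy: "lo < y" "y < hi" using \<open>lo \<le> y \<and> y \<le> hi\<close> by auto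
  have "lo \<notin> D" using m(3)[of lo] loy y by auto
  then have "lo \<le> c" using vs(1) unfolding D_def by auto
  moreover have "\<not> lo < c"
  proof
    assume "lo < c"
    then have "pt p q c \<in> open_segment (pt p q lo) (pt p q hi)"
      using loy y by (intro pt_in_open_segment[OF pq]) auto
    then show False using os C by blast
  qed
  ultimately have "lo = c" by simp
  moreover have "hi \<le> 1" using s by (simp add: hi_def)
  ultimately show ?thesis using ee e(1) s(1,2) loy y(1) by (intro bexI[of _ e] exI[of _ hi]) auto
qed

text \<open>Pushing a cofactor along collinear edges towards the boundary changes the vertex condition
  at the starting vertex only.\<close>

lemma delta_ray:
  assumes pq: "p \<noteq> q" and F: "F \<subseteq> E" "closed_segment p q = \<Union>F" and q: "q \<notin> \<Psi>"
    and g: "g \<in> line_polys (Suc \<mu>) (d - Suc \<mu>) p q"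
    and A: "A \<in> V" "A \<in> closed_segment p q"
  shows "delta A g \<in> vertex_map ` Edat"
proof -
  have main: "delta (pt p q c) g \<in> vertex_map ` Edat" if "0 \<le> c" "c \<le> 1" "pt p q c \<in> V" for c
    using that
  proof (induction "card {s. c \<le> s \<and> pt p q s \<in> vertices \<Delta>}" arbitrary: c rule: less_induct)
    case less
    have Cv: "pt p q c \<in> vertices \<Delta>" using less.prems(3) V_eq by blast
    have "c \<noteq> 1"
    proof
      assume "c = 1"
      then have "pt p q c = q" by (simp add: pt_def)
      moreover have "pt p q c \<in> \<Psi>" using less.prems(3) unfolding V_eq by (rule IntD2)
      ultimately show False using q by simp
    qed
    then have c1: "c < 1" using less.prems(2) by simp
    obtain e t s1 s2 where e: "e \<in> F" "c < t" "t \<le> 1" "{src e, tgt e} = {pt p q c, pt p q t}"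
      and s: "src e = pt p q s1" "tgt e = pt p q s2"
      using next_edge[OF pq F less.prems(1) c1 Cv] by blast
    have eE: "e \<in> E" using e(1) F(1) by blast
    have ne: "src e \<noteq> tgt e" using edge_ends(1) eE E_sub by blast
    then have "s1 \<noteq> s2" using s by auto
    then have ge: "g \<in> line_polys (Suc \<mu>) (d - Suc \<mu>) (src e) (tgt e)"
      unfolding s using subsetD[OF line_polys_pt g] by blast
    have fin: "finite {s. c \<le> s \<and> pt p q s \<in> vertices \<Delta>}"
    proof (rule finite_imageD)
      show "finite (pt p q ` {s. c \<le> s \<and> pt p q s \<in> vertices \<Delta>})"
        by (rule finite_subset[OF _ finite_vertices]) auto
      show "inj_on (pt p q) {s. c \<le> s \<and> pt p q s \<in> vertices \<Delta>}" by (rule inj_onI) (simp add: pt_inj[OF pq])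
    qed
    have "card {s. t \<le> s \<and> pt p q s \<in> vertices \<Delta>} < card {s. c \<le> s \<and> pt p q s \<in> vertices \<Delta>}"
    proof (rule psubset_card_mono[OF fin])
      have "c \<in> {s. c \<le> s \<and> pt p q s \<in> vertices \<Delta>}" "c \<notin> {s. t \<le> s \<and> pt p q s \<in> vertices \<Delta>}"
        using Cv e(2) by auto
      moreover have "{s. t \<le> s \<and> pt p q s \<in> vertices \<Delta>} \<subseteq> {s. c \<le> s \<and> pt p q s \<in> vertices \<Delta>}"
        using e(2) by auto
      ultimately show "{s. t \<le> s \<and> pt p q s \<in> vertices \<Delta>} \<subset> {s. c \<le> s \<and> pt p q s \<in> vertices \<Delta>}" by blast
    qed
    then have IH: "delta (pt p q t) g \<in> vertex_map ` Edat" if "pt p q t \<in> V"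
      by (rule less.hyps) (use e(2,3) less.prems(1) that in auto)
    show ?case
      by (rule delta_step[OF eE e(4) _ less.prems(3) ge IH]) (use e(2) pt_inj[OF pq] in auto)
  qed
  obtain c where "0 \<le> c" "c \<le> 1" "A = pt p q c" using A(2) unfolding pt_segment by blast
  then show ?thesis using main A(1) by blast
qed

lemma vertex_map_in_Vdat:
  assumes h: "h \<in> Edat"
  shows "vertex_map h \<in> Vdat"
proof -
  have "(\<lambda>z. vsum (\<lambda>e. h (e, z)) A) \<in> ctr_polys (Suc \<mu>) d A" if "A \<in> V" for A
  proof -
    note S = has_dim_subspace[OF has_dim_ctr_polys[of "Suc \<mu>" d A]]
    let ?k = "\<lambda>e. of_bool (src e = A) - of_bool (tgt e = A) :: real"
    have "(\<lambda>z. vsum (\<lambda>e. h (e, z)) A) = (\<Sum>e\<in>E. smul (?k e) (\<lambda>z. h (e, z)))"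
      unfolding vsum_def by (intro ext) (simp add: sum_fun_apply mult.commute)
    also have "\<dots> \<in> ctr_polys (Suc \<mu>) d A"
    proof (rule fun_space.subspace_sum[OF S])
      fix e assume e: "e \<in> E"
      show "smul (?k e) (\<lambda>z. h (e, z)) \<in> ctr_polys (Suc \<mu>) d A"
      proof (cases "src e = A \<or> tgt e = A")
        case True
        then have l: "lf (src e) (tgt e) A = 0" by auto
        have "(\<lambda>z. h (e, z)) \<in> line_polys (Suc \<mu>) (d - Suc \<mu>) (src e) (tgt e)"
          using h e unfolding fam_space_def by simp
        then have "(\<lambda>z. h (e, z)) \<in> ctr_polys (Suc \<mu>) d A"
          using line_polys_subset_ctr[OF l, of "Suc \<mu>" d] \<mu>d by auto
        then show ?thesis by (rule fun_space.subspace_scale[OF S])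
      next
        case False
        then have "smul (?k e) (\<lambda>z. h (e, z)) = 0" by (auto simp: fun_eq_iff)
        then show ?thesis using fun_space.subspace_0[OF S] by (simp only:)
      qed
    qed
    finally show ?thesis .
  qed
  then show ?thesis unfolding fam_space_def vertex_map_def by simp
qed

lemma Ker_eq: "Ker = {h \<in> Edat. vertex_map h = 0}"
proof -
  have "(\<forall>A\<in>V. \<forall>z. vsum (\<lambda>e. h (e, z)) A = 0) \<longleftrightarrow> vertex_map h = 0" for h
  proof
    assume "\<forall>A\<in>V. \<forall>z. vsum (\<lambda>e. h (e, z)) A = 0"
    then have "vsum (\<lambda>e. h (e, z)) A = 0" if "A \<in> V" for A z using that by blast
    then have "vertex_map h (A, z) = 0" for A z by (cases "A \<in> V") (simp_all add: vertex_map_def)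
    then show "vertex_map h = 0" by (intro ext) (auto simp: zero_fun_def)
  next
    assume T0: "vertex_map h = 0"
    show "\<forall>A\<in>V. \<forall>z. vsum (\<lambda>e. h (e, z)) A = 0"
    proof (intro ballI allI)
      fix A z assume "A \<in> V"
      then show "vsum (\<lambda>e. h (e, z)) A = 0" using fun_cong[OF T0, of "(A, z)"] by (simp add: vertex_map_def)
    qed
  qed
  then show ?thesis unfolding Ker_def by simp
qed

lemma maximal_chain:
  assumes e: "e \<in> E"
  shows "\<exists>L\<in>interior_l_edges \<Psi> \<Delta>. e \<subseteq> L"
proof -
  have ends: "src e \<noteq> tgt e" "closed_segment (src e) (tgt e) = e" using edge_ends e E_sub by auto
  have "edge_chain \<Psi> \<Delta> e" unfolding edge_chain_def
  proof
    show "\<exists>p q. p \<noteq> q \<and> e = closed_segment p q"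
      by (intro exI[of _ "src e"] exI[of _ "tgt e"] conjI ends(1) ends(2)[symmetric])
    show "\<exists>F\<subseteq>E. e = \<Union>F" using e by (intro exI[of _ "{e}"]) simp
  qed
  then have mem: "e \<in> {L. edge_chain \<Psi> \<Delta> L}" by simp
  have fin: "finite {L. edge_chain \<Psi> \<Delta> L}"
  proof (rule finite_subset)
    show "{L. edge_chain \<Psi> \<Delta> L} \<subseteq> Union ` Pow E" unfolding edge_chain_def by blast
  qed (simp add: finite_E)
  obtain L where L: "L \<in> {L. edge_chain \<Psi> \<Delta> L}" "e \<subseteq> L" "\<forall>L'\<in>{L. edge_chain \<Psi> \<Delta> L}. L \<subseteq> L' \<longrightarrow> L = L'"
    using finite_has_maximal2[OF fin mem] by (elim bexE conjE)
  have "L \<in> interior_l_edges \<Psi> \<Delta>" unfolding interior_l_edges_def mem_Collect_eq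
  proof (intro conjI allI impI)
    show "edge_chain \<Psi> \<Delta> L" using L(1) by simp
    show "L' = L" if "edge_chain \<Psi> \<Delta> L' \<and> L \<subseteq> L'" for L'
      using bspec[OF L(3), of L'] that by simp
  qed
  then show ?thesis using L(2) by (rule bexI[rotated])
qed

lemma l_edge_hull:
  assumes e: "e \<in> E" and L: "p \<noteq> q" "e \<subseteq> closed_segment p q"
  shows "affine hull e = {z. lf p q z = 0}"
proof -
  have ends: "src e \<noteq> tgt e" "closed_segment (src e) (tgt e) = e" using edge_ends e E_sub by auto
  have "src e \<in> closed_segment (src e) (tgt e)" "tgt e \<in> closed_segment (src e) (tgt e)" by auto
  then have "src e \<in> closed_segment p q" "tgt e \<in> closed_segment p q" unfolding ends(2) using L(2) by auto
  then obtain s1 s2 where s: "src e = pt p q s1" "tgt e = pt p q s2" unfolding pt_segment by blast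
  then have "s2 - s1 \<noteq> 0" using ends(1) by auto
  then have "{z. lf (src e) (tgt e) z = 0} = {z. lf p q z = 0}" unfolding s lf_pt by simp
  then show ?thesis using affine_hull_segment_eq[OF ends(1)] unfolding ends(2) by simp
qed

lemma ctr_polys_reached:
  assumes disj: "disjoint_truncated_l_edges \<Psi> \<Delta>" and A: "A \<in> V" and N: "num_directions \<Delta> A \<ge> \<mu> + 3"
    and g: "g \<in> ctr_polys (Suc \<mu>) d A"
  shows "delta A g \<in> vertex_map ` Edat"
proof -
  have A\<Psi>: "A \<in> \<Psi>" using A V_eq by blast
  define EA where "EA = {e \<in> \<Delta>. A \<in> e}"
  have EA: "e \<in> E" "A \<in> e" if "e \<in> EA" for e
    using that edge_meets_dom[of e A] A\<Psi> unfolding EA_def by simp_all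
  define Ls where "Ls = (\<lambda>e. affine hull e) ` EA"
  have "num_directions \<Delta> A = card Ls"
    unfolding num_directions_def Ls_def EA_def by (rule arg_cong[where f = card]) blast
  then have cardL: "card Ls \<ge> \<mu> + 3" using N by simp
  have finL: "finite Ls" unfolding Ls_def EA_def using finite_edges by simp
  have "\<forall>e\<in>EA. \<exists>L\<in>interior_l_edges \<Psi> \<Delta>. e \<subseteq> L" using maximal_chain EA by blast
  then obtain M where M: "\<And>e. e \<in> EA \<Longrightarrow> M e \<in> interior_l_edges \<Psi> \<Delta>" "\<And>e. e \<in> EA \<Longrightarrow> e \<subseteq> M e" by metis
  have Mseg: "\<exists>p q. p \<noteq> q \<and> M e = closed_segment p q" if "e \<in> EA" for e
    using M(1)[OF that] unfolding interior_l_edges_def edge_chain_def by blast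
  have bad: "affine hull e = affine hull e'"
    if "e \<in> EA" "e' \<in> EA" "M e \<in> truncated_l_edges \<Psi> \<Delta>" "M e' \<in> truncated_l_edges \<Psi> \<Delta>" for e e'
  proof -
    have "A \<in> M e \<inter> M e'" using M(2) EA(2) that(1,2) by blast
    then have "M e = M e'"
      using disj that(3,4) unfolding disjoint_truncated_l_edges_def pairwise_def disjnt_def by blast
    moreover have "\<exists>p q. p \<noteq> q \<and> M e = closed_segment p q" by (rule Mseg[OF that(1)])
    then obtain p q where pq: "p \<noteq> q" "M e = closed_segment p q" by blast
    ultimately have sub: "e \<subseteq> closed_segment p q" "e' \<subseteq> closed_segment p q" using M(2) that(1,2) by auto
    show ?thesis
      using l_edge_hull[OF EA(1)[OF that(1)] pq(1) sub(1)] l_edge_hull[OF EA(1)[OF that(2)] pq(1) sub(2)] by simp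
  qed
  define B where "B = (\<lambda>e. affine hull e) ` {e\<in>EA. M e \<in> truncated_l_edges \<Psi> \<Delta>}"
  have "card B \<le> 1"
  proof (cases "B = {}")
    case False
    then obtain l where l: "l \<in> B" by blast
    have "B \<subseteq> {l}" using bad l unfolding B_def by blast
    then show ?thesis using card_mono[of "{l}" B] by simp
  qed simp
  have BL: "B \<subseteq> Ls" unfolding B_def Ls_def by blast
  have "card (Ls - B) = card Ls - card B" by (rule card_Diff_subset[OF finite_subset[OF BL finL] BL])
  then have cardG: "card (Ls - B) \<ge> Suc (Suc \<mu>)" using cardL \<open>card B \<le> 1\<close> by linarith
  have good: "\<exists>w. fst w \<noteq> snd w \<and> l = {z. lf (fst w) (snd w) z = 0} \<and> snd w \<notin> \<Psi> \<and>
      A \<in> closed_segment (fst w) (snd w) \<and> (\<exists>F\<subseteq>E. closed_segment (fst w) (snd w) = \<Union>F)" (is "\<exists>w. ?P l w")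
    if l: "l \<in> Ls - B" for l
  proof -
    obtain e where e: "e \<in> EA" "l = affine hull e" using l unfolding Ls_def by blast
    have nt: "M e \<notin> truncated_l_edges \<Psi> \<Delta>" using l e unfolding B_def by blast
    obtain p q F where pq: "p \<noteq> q" "M e = closed_segment p q" "F \<subseteq> E" "M e = \<Union>F"
      using M(1)[OF e(1)] unfolding interior_l_edges_def edge_chain_def by blast
    have Apq: "A \<in> closed_segment p q" using EA(2)[OF e(1)] M(2)[OF e(1)] pq(2) by blast
    have "p \<in> frontier \<Psi> \<or> q \<in> frontier \<Psi>"
      using nt M(1)[OF e(1)] pq(2) unfolding truncated_l_edges_def by blast
    moreover have "x \<notin> \<Psi>" if "x \<in> frontier \<Psi>" for x
      using that interior_open[OF open_dom] by (simp add: frontier_def)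
    ultimately consider "q \<notin> \<Psi>" | "p \<notin> \<Psi>" by blast
    then show ?thesis
    proof cases
      case 1
      have "l = {z. lf p q z = 0}" using l_edge_hull[OF EA(1)[OF e(1)] pq(1)] M(2)[OF e(1)] pq(2) e(2) by simp
      moreover have "\<exists>F\<subseteq>E. closed_segment p q = \<Union>F"
        by (intro exI[of _ F] conjI pq(3) trans[OF pq(2)[symmetric] pq(4)])
      ultimately have "?P l (p, q)" unfolding fst_conv snd_conv by (intro conjI 1 pq(1) Apq)
      then show ?thesis by (rule exI)
    next
      case 2
      have qp: "q \<noteq> p" "M e = closed_segment q p"
        using pq(1) by (simp, simp only: pq(2) closed_segment_commute[of q p])
      have "l = {z. lf q p z = 0}" using l_edge_hull[OF EA(1)[OF e(1)] qp(1)] M(2)[OF e(1)] qp(2) e(2) by simp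
      moreover have "\<exists>F\<subseteq>E. closed_segment q p = \<Union>F"
        by (intro exI[of _ F] conjI pq(3) trans[OF qp(2)[symmetric] pq(4)])
      moreover have "A \<in> closed_segment q p" using Apq by (simp add: closed_segment_commute)
      ultimately have "?P l (q, p)" unfolding fst_conv snd_conv by (intro conjI 2 qp(1))
      then show ?thesis by (rule exI)
    qed
  qed
  define W where "W l = (SOME w. ?P l w)" for l
  have W: "?P l (W l)" if "l \<in> Ls - B" for l unfolding W_def by (rule someI_ex[OF good[OF that]])
  define w where "w l = (snd (snd (W l)) - snd (fst (W l)), - (fst (snd (W l)) - fst (fst (W l))))" for l
  have lf0: "lf (fst (W l)) (snd (W l)) A = 0" if "l \<in> Ls - B" for l
    using W[OF that] lf_closed_segment by blast
  have lfw: "lf (fst (W l)) (snd (W l)) z = dotf (w l) (z - A)" if "l \<in> Ls - B" for l z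
    unfolding w_def by (rule lf_eq_dotf[OF lf0[OF that]])
  have wnz: "w l \<noteq> 0" if "l \<in> Ls - B" for l
    using W[OF that] unfolding w_def by (auto simp: prod_eq_iff zero_prod_def)
  have lset: "l = {z. dotf (w l) (z - A) = 0}" if "l \<in> Ls - B" for l
    using W[OF that] lfw[OF that] by auto
  have cross: "fst (w l) * snd (w l') - snd (w l) * fst (w l') \<noteq> 0"
    if "l \<in> Ls - B" "l' \<in> Ls - B" "l \<noteq> l'" for l l'
  proof
    assume 0: "fst (w l) * snd (w l') - snd (w l) * fst (w l') = 0"
    have sub: "dotf v y = 0" if "dotf u y = 0" "u \<noteq> 0" "fst u * snd v - snd u * fst v = 0" for u v y
    proof -
      have "fst u * dotf v y = fst v * dotf u y" "snd u * dotf v y = snd v * dotf u y"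
        using that(3) unfolding dotf_def by (simp_all add: algebra_simps)
      then show ?thesis using that(1,2) by (auto simp: prod_eq_iff)
    qed
    have "dotf (w l) y = 0 \<longleftrightarrow> dotf (w l') y = 0" for y
      using sub[of "w l" y "w l'"] sub[of "w l'" y "w l"] wnz that(1,2) 0 by (auto simp: algebra_simps)
    then have "{z. dotf (w l) (z - A) = 0} = {z. dotf (w l') (z - A) = 0}" by simp
    then show False using lset[OF that(1)] lset[OF that(2)] that(3) by simp
  qed
  have injw: "inj_on w (Ls - B)"
  proof (rule inj_onI, rule ccontr)
    fix l l' assume "l \<in> Ls - B" "l' \<in> Ls - B" "w l = w l'" "l \<noteq> l'"
    then show False using cross[of l l'] by (simp add: mult.commute)
  qed
  let ?U = "{g. delta A g \<in> vertex_map ` Edat}"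
  have "ctr_polys (Suc \<mu>) d A \<subseteq> ?U"
  proof (rule ctr_polys_subset[where K = "w ` (Ls - B)"])
    show "finite (w ` (Ls - B))" using finL by simp
    show "Suc (Suc \<mu>) \<le> card (w ` (Ls - B))" using cardG card_image[OF injw] by simp
    show "Suc \<mu> \<le> d" using \<mu>d by simp
    show "fst u * snd v - snd u * fst v \<noteq> 0" if "u \<in> w ` (Ls - B)" "v \<in> w ` (Ls - B)" "u \<noteq> v" for u v
      using that cross by blast
    show "u \<noteq> 0" if "u \<in> w ` (Ls - B)" for u using that by (elim imageE) (simp only: wnz not_False_eq_True)
    show "fun_space.subspace ?U"
    proof (rule fun_space.subspaceI)
      have "delta A 0 = 0" by (auto simp: delta_def fun_eq_iff)
      then show "0 \<in> ?U" using fun_space.subspace_0[OF subspace_vertex_map] by simp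
    next
      fix x y assume xy: "x \<in> ?U" "y \<in> ?U"
      have "delta A (x + y) = delta A x + delta A y" by (auto simp: delta_def fun_eq_iff)
      then show "x + y \<in> ?U" using fun_space.subspace_add[OF subspace_vertex_map] xy by simp
    next
      fix c x assume x: "x \<in> ?U"
      have eq: "delta A (smul c x) = smul c (delta A x)" by (auto simp: delta_def fun_eq_iff)
      have "smul c (delta A x) \<in> vertex_map ` Edat" by (rule fun_space.subspace_scale[OF subspace_vertex_map]) (use x in simp)
      then show "smul c x \<in> ?U" unfolding mem_Collect_eq eq .
    qed
    fix u r assume u: "u \<in> w ` (Ls - B)" and r: "r \<in> bivariate_polys (d - Suc \<mu>)"
    obtain l where l: "l \<in> Ls - B" "u = w l" using u by blast
    obtain F where F: "F \<subseteq> E" "closed_segment (fst (W l)) (snd (W l)) = \<Union>F" using W[OF l(1)] by blast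
    have ne: "fst (W l) \<noteq> snd (W l)" "snd (W l) \<notin> \<Psi>" "A \<in> closed_segment (fst (W l)) (snd (W l))"
      using W[OF l(1)] by blast+
    have "(\<lambda>z. lf (fst (W l)) (snd (W l)) z ^ Suc \<mu> * r z) \<in> line_polys (Suc \<mu>) (d - Suc \<mu>) (fst (W l)) (snd (W l))"
      unfolding line_polys_def by (rule imageI[OF r])
    from delta_ray[OF ne(1) F ne(2) this A ne(3)]
    show "(\<lambda>z. dotf u (z - A) ^ Suc \<mu> * r z) \<in> ?U" unfolding lfw[OF l(1)] l(2) by simp
  qed
  then show ?thesis using g by blast
qed

lemma vertex_map_image:
  assumes disj: "disjoint_truncated_l_edges \<Psi> \<Delta>" and N: "\<And>A. A \<in> V \<Longrightarrow> num_directions \<Delta> A \<ge> \<mu> + 3"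
  shows "vertex_map ` Edat = Vdat"
proof
  show "vertex_map ` Edat \<subseteq> Vdat" using vertex_map_in_Vdat by blast
  show "Vdat \<subseteq> vertex_map ` Edat"
  proof
    fix G assume G: "G \<in> Vdat"
    have GA: "(\<lambda>z. G (A, z)) \<in> ctr_polys (Suc \<mu>) d A" if "A \<in> V" for A using G that unfolding fam_space_def by simp
    have G0: "G (A, z) = 0" if "A \<notin> V" for A z using G that unfolding fam_space_def by blast
    have "G = (\<Sum>A\<in>V. delta A (\<lambda>z. G (A, z)))"
    proof (rule ext, clarify)
      fix B :: "real \<times> real" and z :: "real \<times> real"
      have "(\<Sum>A\<in>V. delta A (\<lambda>z. G (A, z))) (B, z) = (\<Sum>A\<in>V. if A = B then G (B, z) else 0)"
        unfolding sum_fun_apply by (rule sum.cong) (auto simp: delta_def)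
      also have "\<dots> = (if B \<in> V then G (B, z) else 0)" using finite_V by (simp only: sum.delta)
      also have "\<dots> = G (B, z)" using G0 by simp
      finally show "G (B, z) = (\<Sum>A\<in>V. delta A (\<lambda>z. G (A, z))) (B, z)" by (rule sym)
    qed
    also have "\<dots> \<in> vertex_map ` Edat"
      by (intro fun_space.subspace_sum[OF subspace_vertex_map] ctr_polys_reached[OF disj _ N GA])
    finally show "G \<in> vertex_map ` Edat" .
  qed
qed

lemma dim_spline_space:
  assumes disj: "disjoint_truncated_l_edges \<Psi> \<Delta>" and N: "\<And>A. A \<in> V \<Longrightarrow> num_directions \<Delta> A \<ge> \<mu> + 3"
  shows "int (fun_space.dim Spl) = Low d \<mu> \<Psi> \<Delta>"
proof -
  let ?c = "d - \<mu> + 1 choose 2" and ?w = "card (deg_idx (Suc \<mu>) d)"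
  have dE: "has_dim Edat (card E * ?c)"
  proof -
    have r: "d - Suc \<mu> + 2 = d - \<mu> + 1" using \<mu>d by simp
    have "has_dim Edat (\<Sum>e\<in>E. ?c)"
    proof (rule has_dim_fam_space[OF finite_E])
      fix e assume "e \<in> E"
      then have "src e \<noteq> tgt e" using edge_ends(1) E_sub by blast
      from has_dim_line_polys[OF this, of "Suc \<mu>" "d - Suc \<mu>"]
      show "has_dim (line_polys (Suc \<mu>) (d - Suc \<mu>) (src e) (tgt e)) ?c" unfolding r .
    qed
    then show ?thesis by simp
  qed
  have "has_dim Vdat (\<Sum>A\<in>V. ?w)" by (rule has_dim_fam_space[OF finite_V has_dim_ctr_polys])
  moreover have "vertex_map ` Edat = Vdat" by (rule vertex_map_image[OF disj N])
  ultimately have dV: "has_dim (vertex_map ` Edat) (card V * ?w)" by (simp only: sum_constant of_nat_id)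
  have sK: "fun_space.subspace {h \<in> Edat. vertex_map h = 0}"
  proof (rule fun_space.subspaceI)
    have "vertex_map 0 = 0" by (auto simp: vertex_map_def vsum_def fun_eq_iff)
    then show "0 \<in> {h \<in> Edat. vertex_map h = 0}" using fun_space.subspace_0[OF subspace_Edat] by simp
  next
    fix x y assume "x \<in> {h \<in> Edat. vertex_map h = 0}" "y \<in> {h \<in> Edat. vertex_map h = 0}"
    then show "x + y \<in> {h \<in> Edat. vertex_map h = 0}" using fun_space.subspace_add[OF subspace_Edat] vertex_map_add[of x y] by simp
  next
    fix c x assume x: "x \<in> {h \<in> Edat. vertex_map h = 0}"
    have "vertex_map (smul c x) = 0" unfolding vertex_map_scale using x by (auto simp: fun_eq_iff)
    moreover have "smul c x \<in> Edat" by (rule fun_space.subspace_scale[OF subspace_Edat]) (use x in simp)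
    ultimately show "smul c x \<in> {h \<in> Edat. vertex_map h = 0}" by simp
  qed
  obtain k where k: "has_dim {h \<in> Edat. vertex_map h = 0} k"
    using subspace_imp_has_dim[OF sK _ dE] by blast
  have "has_dim Edat (k + card V * ?w)" by (rule rank_nullity_on[OF subspace_Edat vertex_map_add vertex_map_scale k dV])
  then have eq: "k + card V * ?w = card E * ?c" using has_dim_unique dE by blast
  have "fun_space.dim Spl = (d + 2 choose 2) + k"
    using has_dim_dim[OF has_dim_spline_space] k unfolding Ker_eq by blast
  then have dim: "int (fun_space.dim Spl) = int (d + 2 choose 2) + int k" by simp
  have "?w + (Suc \<mu> + 1 choose 2) = (d + 2 choose 2)" by (rule card_deg_idx) (use \<mu>d in simp)
  then have w: "int ?w = int (d + 2 choose 2) - int (\<mu> + 2 choose 2)"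
    by (simp add: algebra_simps)
  have sig: "sigma d \<mu> (num_directions \<Delta> A) = 0" if A: "A \<in> V" for A
    unfolding sigma_def
  proof (rule sum.neutral, rule ballI)
    fix j assume j: "j \<in> {1..d - \<mu>}"
    have 1: "int (num_directions \<Delta> A) - 1 \<ge> int \<mu> + 2" using N[OF A] by linarith
    have "1 * (int \<mu> + 2) \<le> int j * (int (num_directions \<Delta> A) - 1)"
      using j 1 by (intro mult_mono) auto
    then have "int \<mu> + 1 + int j * (1 - int (num_directions \<Delta> A)) \<le> 0" by (simp add: algebra_simps)
    then show "max 0 (int \<mu> + 1 + int j * (1 - int (num_directions \<Delta> A))) = 0" by simp
  qed
  have "int k = int (card E) * int ?c - int (card V) * int ?w"
    using arg_cong[OF eq, of int] by simp
  then show ?thesis unfolding Low_def dim w using sum.neutral[of V "\<lambda>A. sigma d \<mu> (num_directions \<Delta> A)"] sig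
    by (simp add: algebra_simps)
qed

end

theorem theorem4p2:
  fixes \<mu> d :: nat
    and \<Psi> :: "(real \<times> real) set"
    and \<Delta> :: "(real \<times> real) set set"
  assumes "\<mu> < d"
    and "rectilinear_partition \<Psi> \<Delta>"
    and "simply_connected \<Psi>"
    and "disjoint_truncated_l_edges \<Psi> \<Delta>"
    and "\<forall>A\<in>interior_vertices \<Psi> \<Delta>. num_directions \<Delta> A \<ge> \<mu> + 3"
  shows "int (fun_space.dim (spline_space d \<mu> \<Psi> \<Delta>)) = Low d \<mu> \<Psi> \<Delta>"
proof -
  interpret spline_setup \<Psi> \<Delta> d \<mu>
    by unfold_locales (use assms in auto)
  show ?thesis using dim_spline_space assms(4,5) by blast
qed

end
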